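(* Let $\mathcal{G}=(V,E,\Phi,\chi)$ be a random decision network with $|\chi|=T$ satisfying the following two assumptions. (1) For all $v\in V$ and $x\neq y$ in $\chi$, $B_{\mathcal{G},v}(x)-B_{\mathcal{G},v}(y)$ is a continuous random variable with density bounded above by a constant $g>0$. (2) There is $K_\Phi$ such that $\big(\sum_{x,y\in\chi}\mathbb{E}|\Phi_e(x,y)|^2\big)^{1/2}\le K_\Phi$ for every $e\in E$ and $\big(\sum_{x\in\chi}\mathbb{E}|\Phi_v(x)|^2\big)^{1/2}\le K_\Phi$ for every $v\in V$. Let $\mathbf{x}$ be the (almost surely unique) optimal solution of $\mathcal{G}$, and for each $r$ let $\mathbf{x}^r=(x^r_v)_{v\in V}$ with $x^r_v\in\arg\max_{x\in\chi}\mathrm{CE}[\mathcal{G},v,r,x]$, ties broken arbitrarily. Suppose $\mathcal{G}$ exhibits the exponential correlation decay property with rate $\alpha_c$ (and constant $K_c$), and let $K_1=10K_\Phi T(|V|+|E|)$ and $K_2=K_1(gK_c)^{1/4}$. Then, for any $\epsilon>0$, if $$r\ge\big(8|\log\epsilon|+4|\log K_2|\big)\,|\log\alpha_c|^{-1},$$ then $$\mathbb{P}\big(F_{\mathcal{G}}(\mathbf{x})-F_{\mathcal{G}}(\mathbf{x}^r)>\epsilon\big)\le\epsilon,$$ and $\mathbf{x}^r$ can be computed in time polynomial in $|V|$, $1/\epsilon$.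
   Context: A decision network $\mathcal{G}=(V,E,\Phi,\chi)$ consists of a finite undirected simple graph $(V,E)$, an action set $\chi=\{0,\ldots,T-1\}$, potential functions $\Phi_v:\chi\to\mathbb{R}$ ($v\in V$) and interaction functions $\Phi_e:\chi^2\to\mathbb{R}\cup\{-\infty\}$ ($e\in E$); here $\Phi$ is random. $F_{\mathcal{G}}(\mathbf{x})=\sum_{(u,v)\in E}\Phi_{u,v}(x_u,x_v)+\sum_{v}\Phi_v(x_v)$; a solution is optimal if it maximizes $F_{\mathcal{G}}$; $J_{\mathcal{G},v}(x)=\max_{\mathbf{x}:x_v=x}F_{\mathcal{G}}(\mathbf{x})$; the cavity is $B_{\mathcal{G},v}(x)=J_{\mathcal{G},v}(x)-J_{\mathcal{G},v}(0)$. Partial cavity function: $\mu_{u\leftarrow v}(x,B)=\max_{y}(\Phi_{u,v}(x,y)+B(y))-\max_{y}(\Phi_{u,v}(0,y)+B(y))$ for a vector $B=(B(y))_{y\in\chi}$. For a node $u$ with neighbors $v_1,\ldots,v_d$ (in a fixed order), $\mathcal{G}(u,j,x)$ is the decision network on the subgraph induced by $V\setminus\{u\}$ with the same interaction functions on the remaining edges and potentials $\Phi'_v(y)=\Phi_v(y)+\Phi_{u,v}(x,y)$ for $v\in\{v_1,\ldots,v_{j-1}\}$, $\Phi'_v(y)=\Phi_v(y)+\Phi_{u,v}(0,y)$ for $v\in\{v_{j+1},\ldots,v_d\}$, and $\Phi'_v=\Phi_v$ otherwise. Cavity Expansion (CE): $\mathrm{CE}[\mathcal{G},u,0,x]=0$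 and for $r\ge1$, $\mathrm{CE}[\mathcal{G},u,r,x]=\Phi_u(x)-\Phi_u(0)+\sum_{j=1}^d\mu_{u\leftarrow v_j}\big(x,\mathrm{CE}[\mathcal{G}(u,j,x),v_j,r-1]\big)$, where $\mathrm{CE}[\cdot,\cdot,r-1]$ is the vector over actions and the sum is $0$ if $u$ has no neighbors. Unrolling the recursion, let $(\mathcal{G}_i,v_i,0,x_i)_{i}$ be the depth-$0$ calls used in computing $\mathrm{CE}[\mathcal{G},u,r,x]$. A boundary condition $\mathcal{C}=(\mathcal{C}_i)_i$ assigns to the $i$-th such call a value $\mathcal{C}_i$ to be returned in place of $0$ (a constant, or a quantity determined by the network $\mathcal{G}_i$, such as the "true boundary condition" $\mathcal{C}^*_i=B_{\mathcal{G}_i,v_i}(x_i)$); the output is denoted $\mathrm{CE}[\mathcal{G},u,r,x,\mathcal{C}]$. $\mathcal{G}$ exhibits the exponential correlation decay property with rate $\alpha_c<1$ and constant $K_c>0$ if for every $r\ge1$ and every two boundary conditions $\mathcal{C},\mathcal{C}'$, $\max_{u,x}\mathbb{E}\big|\mathrm{CE}[\mathcal{G},u,r,x,\mathcal{C}]-\mathrm{CE}[\mathcal{G},u,r,x,\mathcal{C}']\big|\le K_c\alpha_c^r$. In particular $\mathbb{E}|\mathrm{CE}[\mathcal{G},u,r,x]-B_{\mathcal{G},u}(x)|\le K_c\alpha_c^r$ for all $u,x$ and $r\ge1$. For the running-time assertion, the maximum degree $\Delta$, $T$, $g$, $K_\Phi$, $K_c$, $\alpha_c$ are fixed constants and $r$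 is taken to be the least positive integer satisfying the stated inequality.
   Formalization: For ε > 1 the running time is polynomial in |V| and ε, not in |V| and 1/ε: r grows with |log ε|, and for ε exponential in |V| the literal claim would give exact optimization, an NP-hard task, in time polynomial in |V|. Also α_c > 0 and K_Φ > 0 are assumed so that the logarithms exist. *)

theory Defs
  imports "HOL-Probability.Probability"
begin

section \<open>Decision networks\<close>

text \<open>
  The graph is undirected and simple.  Each edge is stored exactly once, as a pair in an arbitrary
  orientation, so that sums over \<open>edges\<close> count every edge once and \<open>edge_pot\<close> needs no symmetry
  condition.  The actions are \<open>0, \<dots>, acts - 1\<close>.  The list \<open>nbrs u\<close> is the fixed order of the
  neighbours of \<open>u\<close>.  Node potentials are \<open>ereal\<close>-valued only because the potentials of the
  subnetworks below absorb interaction values, which may be \<open>-\<infinity>\<close>.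
\<close>

record 'v network =
  nodes :: "'v set"
  edges :: "('v \<times> 'v) set"
  nbrs :: "'v \<Rightarrow> 'v list"
  acts :: nat
  node_pot :: "'v \<Rightarrow> nat \<Rightarrow> ereal"
  edge_pot :: "'v \<times> 'v \<Rightarrow> nat \<Rightarrow> nat \<Rightarrow> ereal"

definition neighbours :: "'v network \<Rightarrow> 'v \<Rightarrow> 'v set" where
  "neighbours G u = {v. (u, v) \<in> edges G \<or> (v, u) \<in> edges G}"

definition decision_network :: "'v network \<Rightarrow> bool" where
  "decision_network G \<longleftrightarrow>
     finite (nodes G) \<and>
     edges G \<subseteq> nodes G \<times> nodes G \<and>
     (\<forall>u v. (u, v) \<in> edges G \<longrightarrow> (v, u) \<notin> edges G) \<and>
     (\<forall>u\<in>nodes G. distinct (nbrs G u) \<and> set (nbrs G u) = neighbours G u) \<and>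
     0 < acts G \<and>
     (\<forall>v\<in>nodes G. \<forall>x<acts G. \<bar>node_pot G v x\<bar> \<noteq> \<infinity>) \<and>
     (\<forall>e\<in>edges G. \<forall>x<acts G. \<forall>y<acts G. edge_pot G e x y \<noteq> \<infinity>)"

definition interaction :: "'v network \<Rightarrow> 'v \<Rightarrow> 'v \<Rightarrow> nat \<Rightarrow> nat \<Rightarrow> ereal" where
  "interaction G u v x y =
     (if (u, v) \<in> edges G then edge_pot G (u, v) x y else edge_pot G (v, u) y x)"

definition solutions :: "'v network \<Rightarrow> ('v \<Rightarrow> nat) set" where
  "solutions G = (\<Pi>\<^sub>E v\<in>nodes G. {..<acts G})"

definition objective :: "'v network \<Rightarrow> ('v \<Rightarrow> nat) \<Rightarrow> ereal" where
  "objective G x =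
     (\<Sum>(u, v)\<in>edges G. edge_pot G (u, v) (x u) (x v)) + (\<Sum>v\<in>nodes G. node_pot G v (x v))"

definition optimal_solution :: "'v network \<Rightarrow> ('v \<Rightarrow> nat) \<Rightarrow> bool" where
  "optimal_solution G x \<longleftrightarrow>
     x \<in> solutions G \<and> (\<forall>z\<in>solutions G. objective G z \<le> objective G x)"

definition J_val :: "'v network \<Rightarrow> 'v \<Rightarrow> nat \<Rightarrow> ereal" where
  "J_val G v a = Max (objective G ` {x \<in> solutions G. x v = a})"

definition cavity :: "'v network \<Rightarrow> 'v \<Rightarrow> nat \<Rightarrow> ereal" where
  "cavity G v a = J_val G v a - J_val G v 0"


section \<open>The cavity expansion\<close>

definition partial_cavity :: "'v network \<Rightarrow> 'v \<Rightarrow> 'v \<Rightarrow> nat \<Rightarrow> (nat \<Rightarrow> ereal) \<Rightarrow> ereal" where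
  "partial_cavity G u v x b =
     Max ((\<lambda>y. interaction G u v x y + b y) ` {..<acts G})
     - Max ((\<lambda>y. interaction G u v 0 y + b y) ` {..<acts G})"

text \<open>
  Here \<open>j\<close> is a 0-based position in \<open>nbrs G u\<close>.  Potentials outside the remaining nodes, edges and
  actions are reset to 0, so that a function of the subnetwork cannot depend on deleted data.
\<close>

definition subnetwork :: "'v network \<Rightarrow> 'v \<Rightarrow> nat \<Rightarrow> nat \<Rightarrow> 'v network" where
  "subnetwork G u j x =
     (let V' = nodes G - {u};
          E' = {(v, w) \<in> edges G. v \<noteq> u \<and> w \<noteq> u}
      in \<lparr> nodes = V',
           edges = E',
           nbrs = (\<lambda>v. removeAll u (nbrs G v)),
           acts = acts G,
           node_pot = (\<lambda>v y.
             if v \<in> V' \<and> y < acts G then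
               node_pot G v y +
               (if v \<in> set (take j (nbrs G u)) then interaction G u v x y
                else if v \<in> set (drop (Suc j) (nbrs G u)) then interaction G u v 0 y
                else 0)
             else 0),
           edge_pot = (\<lambda>e y z.
             if e \<in> E' \<and> y < acts G \<and> z < acts G then edge_pot G e y z else 0) \<rparr>)"

text \<open>
  A recursive call is identified by the list of steps leading to it from the root call: the step
  \<open>(j, y)\<close> goes from a call at \<open>u\<close> to the call at the \<open>j\<close>-th neighbour of \<open>u\<close> with action \<open>y\<close>.
  A boundary condition \<open>C\<close> maps a depth-0 call (its list of steps, its network, its node and its
  action) to the value returned there.
\<close>

type_synonym steps = "(nat \<times> nat) list"

type_synonym 'v bdry = "steps \<Rightarrow> 'v network \<Rightarrow> 'v \<Rightarrow> nat \<Rightarrow> ereal"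

fun CE_bdry :: "'v bdry \<Rightarrow> 'v network \<Rightarrow> 'v \<Rightarrow> nat \<Rightarrow> nat \<Rightarrow> ereal" where
  "CE_bdry C G u 0 x = C [] G u x"
| "CE_bdry C G u (Suc r) x =
     node_pot G u x - node_pot G u 0 +
     (\<Sum>j<length (nbrs G u).
        partial_cavity G u (nbrs G u ! j) x
          (\<lambda>y. CE_bdry (\<lambda>p. C ((j, y) # p)) (subnetwork G u j x) (nbrs G u ! j) r y))"

definition CE :: "'v network \<Rightarrow> 'v \<Rightarrow> nat \<Rightarrow> nat \<Rightarrow> ereal" where
  "CE = CE_bdry (\<lambda>_ _ _ _. 0)"

definition CE_argmax :: "'v network \<Rightarrow> nat \<Rightarrow> ('v \<Rightarrow> nat) \<Rightarrow> bool" where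
  "CE_argmax G r x \<longleftrightarrow>
     (\<forall>v\<in>nodes G. x v < acts G \<and> (\<forall>a<acts G. CE G v r a \<le> CE G v r (x v)))"

text \<open>The depth-0 calls made by \<open>CE_bdry C G u r x\<close>, and the arguments of such a call.\<close>

fun leaf_calls :: "'v network \<Rightarrow> 'v \<Rightarrow> nat \<Rightarrow> nat \<Rightarrow> steps set" where
  "leaf_calls G u 0 x = {[]}"
| "leaf_calls G u (Suc r) x =
     {(j, y) # p | j y p. j < length (nbrs G u) \<and> y < acts G \<and>
        p \<in> leaf_calls (subnetwork G u j x) (nbrs G u ! j) r y}"

fun call_args :: "'v network \<Rightarrow> 'v \<Rightarrow> nat \<Rightarrow> steps \<Rightarrow> 'v network \<times> 'v \<times> nat" where
  "call_args G u x [] = (G, u, x)"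
| "call_args G u x ((j, y) # p) = call_args (subnetwork G u j x) (nbrs G u ! j) y p"


section \<open>Random decision networks\<close>

definition random_decision_network ::
  "'w measure \<Rightarrow> 'v set \<Rightarrow> ('v \<times> 'v) set \<Rightarrow> ('v \<Rightarrow> 'v list) \<Rightarrow> nat \<Rightarrow> ('w \<Rightarrow> 'v network) \<Rightarrow> bool"
where
  "random_decision_network M V E nb T G \<longleftrightarrow>
     prob_space M \<and>
     (\<forall>\<omega>\<in>space M. decision_network (G \<omega>) \<and>
        nodes (G \<omega>) = V \<and> edges (G \<omega>) = E \<and> nbrs (G \<omega>) = nb \<and> acts (G \<omega>) = T) \<and>
     (\<forall>v\<in>V. \<forall>x<T. (\<lambda>\<omega>. node_pot (G \<omega>) v x) \<in> borel_measurable M) \<and>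
     (\<forall>e\<in>E. \<forall>x<T. \<forall>y<T. (\<lambda>\<omega>. edge_pot (G \<omega>) e x y) \<in> borel_measurable M)"

definition density_bounded_by :: "'w measure \<Rightarrow> ('w \<Rightarrow> ereal) \<Rightarrow> real \<Rightarrow> bool" where
  "density_bounded_by M X g \<longleftrightarrow>
     (AE \<omega> in M. \<bar>X \<omega>\<bar> \<noteq> \<infinity>) \<and>
     (\<exists>f. distributed M lborel (\<lambda>\<omega>. real_of_ereal (X \<omega>)) f \<and> (\<forall>t. f t \<le> ennreal g))"

definition cavity_densities_bounded ::
  "'w measure \<Rightarrow> 'v set \<Rightarrow> nat \<Rightarrow> ('w \<Rightarrow> 'v network) \<Rightarrow> real \<Rightarrow> bool"
where
  "cavity_densities_bounded M V T G g \<longleftrightarrow>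
     (\<forall>v\<in>V. \<forall>x<T. \<forall>y<T. x \<noteq> y \<longrightarrow>
        density_bounded_by M (\<lambda>\<omega>. cavity (G \<omega>) v x - cavity (G \<omega>) v y) g)"

definition second_moments_bounded ::
  "'w measure \<Rightarrow> 'v set \<Rightarrow> ('v \<times> 'v) set \<Rightarrow> nat \<Rightarrow> ('w \<Rightarrow> 'v network) \<Rightarrow> real \<Rightarrow> bool"
where
  "second_moments_bounded M V E T G K \<longleftrightarrow>
     (\<forall>e\<in>E.
        let S = (\<Sum>x<T. \<Sum>y<T. \<integral>\<^sup>+\<omega>. e2ennreal (\<bar>edge_pot (G \<omega>) e x y\<bar> ^ 2) \<partial>M)
        in S < \<infinity> \<and> sqrt (enn2real S) \<le> K) \<and>
     (\<forall>v\<in>V.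
        let S = (\<Sum>x<T. \<integral>\<^sup>+\<omega>. e2ennreal (\<bar>node_pot (G \<omega>) v x\<bar> ^ 2) \<partial>M)
        in S < \<infinity> \<and> sqrt (enn2real S) \<le> K)"

text \<open>
  A boundary value may be a constant or any function of the network of the depth-0 call, provided it
  is an almost surely finite random variable.
\<close>

definition boundary_condition ::
  "'w measure \<Rightarrow> ('w \<Rightarrow> 'v network) \<Rightarrow> 'v \<Rightarrow> nat \<Rightarrow> nat \<Rightarrow> 'v bdry \<Rightarrow> bool"
where
  "boundary_condition M G u r x C \<longleftrightarrow>
     (\<forall>\<omega>0\<in>space M. \<forall>p\<in>leaf_calls (G \<omega>0) u r x.
        let val = (\<lambda>\<omega>. case call_args (G \<omega>) u x p of (N, v, y) \<Rightarrow> C p N v y)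
        in val \<in> borel_measurable M \<and> (AE \<omega> in M. \<bar>val \<omega>\<bar> \<noteq> \<infinity>))"

definition exp_correlation_decay ::
  "'w measure \<Rightarrow> 'v set \<Rightarrow> nat \<Rightarrow> ('w \<Rightarrow> 'v network) \<Rightarrow> real \<Rightarrow> real \<Rightarrow> bool"
where
  "exp_correlation_decay M V T G \<alpha> K \<longleftrightarrow>
     (\<forall>r\<ge>1. \<forall>u\<in>V. \<forall>x<T. \<forall>C C'.
        boundary_condition M G u r x C \<and> boundary_condition M G u r x C' \<longrightarrow>
        (\<integral>\<^sup>+\<omega>. e2ennreal \<bar>CE_bdry C (G \<omega>) u r x - CE_bdry C' (G \<omega>) u r x\<bar> \<partial>M)
          \<le> ennreal (K * \<alpha> ^ r))"

text \<open>The arguments \<open>n\<close> and \<open>m\<close> are the numbers of nodes and edges.\<close>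

definition depth_bound ::
  "nat \<Rightarrow> real \<Rightarrow> real \<Rightarrow> real \<Rightarrow> real \<Rightarrow> nat \<Rightarrow> nat \<Rightarrow> real \<Rightarrow> real"
where
  "depth_bound T g K_Phi K_c \<alpha> n m \<epsilon> =
     (let K1 = 10 * K_Phi * real T * real (n + m);
          K2 = K1 * (g * K_c) powr (1 / 4)
      in (8 * \<bar>ln \<epsilon>\<bar> + 4 * \<bar>ln K2\<bar>) * inverse \<bar>ln \<alpha>\<bar>)"


section \<open>Algorithms and their running time\<close>

text \<open>
  The machine model is a first-order functional language with recursion over binary trees of atoms.
  Numbers are handled as in the real RAM: an arithmetic operation or comparison on exact numbers
  takes one step.  Evaluation of every syntax node and every function call takes one step; node names
  can only be compared for equality, and natural numbers only be incremented, decremented and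
  compared for equality.
\<close>

datatype 'v val = Null | Node 'v | Nat nat | Num ereal | Pair "'v val" "'v val"

datatype op1 = Fst | Snd | IsPair | Incr | Decr

datatype op2 = Cons2 | Eq | Add | Sub | Leq

datatype expr =
    Var nat
  | NullLit
  | NatLit nat
  | NumLit int
  | Op1 op1 expr
  | Op2 op2 expr expr
  | Cond expr expr expr
  | LetIn expr expr
  | Call nat expr

abbreviation truth :: "bool \<Rightarrow> 'v val" where
  "truth b \<equiv> Nat (if b then 1 else 0)"

fun app1 :: "op1 \<Rightarrow> 'v val \<Rightarrow> 'v val option" where
  "app1 Fst (Pair a b) = Some a"
| "app1 Snd (Pair a b) = Some b"
| "app1 IsPair v = Some (truth (case v of Pair _ _ \<Rightarrow> True | _ \<Rightarrow> False))"
| "app1 Incr (Nat n) = Some (Nat (n + 1))"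
| "app1 Decr (Nat n) = Some (Nat (n - 1))"
| "app1 _ _ = None"

fun app2 :: "op2 \<Rightarrow> 'v val \<Rightarrow> 'v val \<Rightarrow> 'v val option" where
  "app2 Cons2 a b = Some (Pair a b)"
| "app2 Eq (Node a) (Node b) = Some (truth (a = b))"
| "app2 Eq (Nat a) (Nat b) = Some (truth (a = b))"
| "app2 Add (Num a) (Num b) = Some (Num (a + b))"
| "app2 Sub (Num a) (Num b) = Some (Num (a - b))"
| "app2 Leq (Num a) (Num b) = Some (truth (a \<le> b))"
| "app2 _ _ _ = None"

text \<open>
  \<open>eval fs \<rho> e v t\<close>: in the environment \<open>\<rho>\<close> (de Bruijn indices), \<open>e\<close> evaluates to \<open>v\<close> in \<open>t\<close>
  steps.  The program \<open>fs\<close> is the list of bodies of its one-argument functions.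
\<close>

inductive eval :: "expr list \<Rightarrow> 'v val list \<Rightarrow> expr \<Rightarrow> 'v val \<Rightarrow> nat \<Rightarrow> bool" for fs where
  eval_Var: "i < length \<rho> \<Longrightarrow> eval fs \<rho> (Var i) (\<rho> ! i) 1"
| eval_NullLit: "eval fs \<rho> NullLit Null 1"
| eval_NatLit: "eval fs \<rho> (NatLit n) (Nat n) 1"
| eval_NumLit: "eval fs \<rho> (NumLit k) (Num (ereal (of_int k))) 1"
| eval_Op1: "eval fs \<rho> e a t \<Longrightarrow> app1 f a = Some v \<Longrightarrow> eval fs \<rho> (Op1 f e) v (t + 1)"
| eval_Op2: "eval fs \<rho> e a t \<Longrightarrow> eval fs \<rho> e' a' t' \<Longrightarrow> app2 f a a' = Some v \<Longrightarrow>
    eval fs \<rho> (Op2 f e e') v (t + t' + 1)"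
| eval_Cond_True: "eval fs \<rho> b (Nat (Suc n)) t \<Longrightarrow> eval fs \<rho> e v t' \<Longrightarrow>
    eval fs \<rho> (Cond b e e') v (t + t' + 1)"
| eval_Cond_False: "eval fs \<rho> b (Nat 0) t \<Longrightarrow> eval fs \<rho> e' v t' \<Longrightarrow>
    eval fs \<rho> (Cond b e e') v (t + t' + 1)"
| eval_LetIn: "eval fs \<rho> e a t \<Longrightarrow> eval fs (a # \<rho>) e' v t' \<Longrightarrow>
    eval fs \<rho> (LetIn e e') v (t + t' + 1)"
| eval_Call: "f < length fs \<Longrightarrow> eval fs \<rho> e a t \<Longrightarrow> eval fs [a] (fs ! f) v t' \<Longrightarrow>
    eval fs \<rho> (Call f e) v (t + t' + 1)"

text \<open>The first function of a program is its entry point.\<close>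

definition runs :: "expr list \<Rightarrow> 'v val \<Rightarrow> 'v val \<Rightarrow> nat \<Rightarrow> bool" where
  "runs fs inp out t \<longleftrightarrow> fs \<noteq> [] \<and> eval fs [inp] (fs ! 0) out t"

fun enc_list :: "'v val list \<Rightarrow> 'v val" where
  "enc_list [] = Null"
| "enc_list (a # as) = Pair a (enc_list as)"

text \<open>
  Adjacency-list representation: for each node its name, the table of its potentials, and the ordered
  list of its neighbours, each with the table of interactions.  The list \<open>vs\<close> enumerates the nodes.
\<close>

definition enc_adj :: "'v network \<Rightarrow> 'v \<Rightarrow> 'v \<Rightarrow> 'v val" where
  "enc_adj G v w =
     Pair (Node w)
       (enc_list (map (\<lambda>x. enc_list (map (\<lambda>y. Num (interaction G v w x y)) [0..<acts G]))
          [0..<acts G]))"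

definition enc_node :: "'v network \<Rightarrow> 'v \<Rightarrow> 'v val" where
  "enc_node G v =
     Pair (Node v)
       (Pair (enc_list (map (\<lambda>x. Num (node_pot G v x)) [0..<acts G]))
             (enc_list (map (enc_adj G v) (nbrs G v))))"

definition enc_input :: "'v network \<Rightarrow> 'v list \<Rightarrow> nat \<Rightarrow> 'v val" where
  "enc_input G vs r = Pair (Nat r) (enc_list (map (enc_node G) vs))"

definition enc_solution :: "'v list \<Rightarrow> ('v \<Rightarrow> nat) \<Rightarrow> 'v val" where
  "enc_solution vs x = enc_list (map (\<lambda>v. Pair (Node v) (Nat (x v))) vs)"

end

theory Submission
  imports Defs
begin

text \<open>
  The proof has a probabilistic and an algorithmic half, joined by the choice of the depth.

  \<^bold>\<open>Cavity expansion is close to the cavity.\<close>  Changing the action of a node \<open>u\<close> from \<open>0\<close> to \<open>a\<close> in the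
  view of one neighbour after the other turns \<open>J(a) - J(0)\<close> into a telescoping sum whose \<open>j\<close>-th
  term is the partial cavity function applied to the cavity of the \<open>j\<close>-th subnetwork
  (\<open>cavity_recursion\<close>).  So the expansion with the true cavities at its leaves returns the true
  cavity (\<open>CE_true_boundary\<close>).  The second moments make all potentials almost surely finite, hence
  the true cavities form an admissible boundary condition, and correlation decay bounds the mean
  error of the expansion with zero boundary by \<open>K\<^sub>c \<alpha> ^ r\<close> (\<open>CE_error\<close>).

  \<^bold>\<open>A wrong decision is unlikely.\<close>  An optimal solution maximises the cavity at every node.  The
  maximiser of the expansion can differ from it at \<open>v\<close> only if two cavities at \<open>v\<close> are within
  \<open>2 \<delta>\<close> of each other, of probability \<open>O(\<delta> g)\<close> by the density bound, or some error is at least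
  \<open>\<delta>\<close>, of probability \<open>O(K\<^sub>c \<alpha> ^ r / \<delta>)\<close> by Markov.  The balance \<open>\<delta> = sqrt (K\<^sub>c \<alpha> ^ r / g)\<close> makes
  both of order \<open>sqrt (g K\<^sub>c \<alpha> ^ r)\<close> (\<open>ambiguous_measure\<close>, \<open>not_ambiguous\<close>).  The
  density also excludes ties of cavities, whence the uniqueness of the optimum
  (\<open>unique_optimum_AE\<close>).

  \<^bold>\<open>A wrong decision is cheap.\<close>  Only nodes and edges touched by a wrong decision contribute to the
  loss, and their contribution has a second moment of order \<open>K\<^sub>\<Phi>\<^sup>2\<close>.  Cauchy-Schwarz, in the form
  of Young's inequality with an optimised parameter (\<open>gap_le_square_sum\<close>), bounds the expected
  loss by \<open>K\<^sub>2 \<alpha> ^ (r/4)\<close>.  The depth is such that this is at most \<open>\<epsilon>\<^sup>2\<close> (\<open>depth_suffices\<close>), and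
  Markov's inequality finishes the estimate (\<open>gap_probability\<close>).

  \<^bold>\<open>The expansion is computable in polynomial time.\<close>  The program represents a subnetwork by the
  unchanged input together with the list of deleted nodes and the list of interaction rows that
  were added to potentials (\<open>represents\<close>).  A call then costs \<open>O(n + r)\<close> steps and makes at most
  \<open>\<Delta> T\<close> recursive calls, which gives \<open>(\<Delta> T + 1) ^ r\<close> up to this factor (\<open>CE_runs\<close>).  Since \<open>r\<close> is at
  most a constant multiple of \<open>ln (n + max \<epsilon> (1/\<epsilon>))\<close> plus a constant (\<open>depth_le_log\<close>), any
  exponential in \<open>r\<close> is a polynomial (\<open>running_time_polynomial\<close>).
\<close>

section \<open>The cavity recursion\<close>

text \<open>
  This is the structural part of \<^const>\<open>decision_network\<close>, which passes to subnetworks.  Finiteness of node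
  potentials does not, because a subnetwork absorbs interaction values that may be \<open>-\<infinity>\<close>; it is
  treated separately as \<open>finite_potentials\<close>, which is inherited when the interactions are finite too.
\<close>

definition wf_network :: "'v network \<Rightarrow> bool" where
  "wf_network G \<longleftrightarrow>
     finite (nodes G) \<and>
     edges G \<subseteq> nodes G \<times> nodes G \<and>
     (\<forall>u v. (u, v) \<in> edges G \<longrightarrow> (v, u) \<notin> edges G) \<and>
     (\<forall>u\<in>nodes G. distinct (nbrs G u) \<and> set (nbrs G u) = neighbours G u) \<and>
     0 < acts G"

text \<open>
  The arithmetic of \<^typ>\<open>ereal\<close> allows cancellation only away from \<open>\<plusminus>\<infinity>\<close>.  A name for this condition
  keeps the simplifier from splitting it into two inequations.
\<close>

definition is_real :: "ereal \<Rightarrow> bool" where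
  "is_real a \<longleftrightarrow> \<bar>a\<bar> \<noteq> \<infinity>"

definition finite_potentials :: "'v network \<Rightarrow> bool" where
  "finite_potentials G \<longleftrightarrow>
     (\<forall>v\<in>nodes G. \<forall>x<acts G. is_real (node_pot G v x)) \<and>
     (\<forall>e\<in>edges G. \<forall>x<acts G. \<forall>y<acts G. is_real (edge_pot G e x y))"

lemma decision_network_wf: "decision_network G \<Longrightarrow> wf_network G"
  by (simp add: decision_network_def wf_network_def)

lemma wf_networkD:
  assumes "wf_network G"
  shows "finite (nodes G)" "edges G \<subseteq> nodes G \<times> nodes G" "finite (edges G)" "0 < acts G"
    "(u, v) \<in> edges G \<Longrightarrow> (v, u) \<notin> edges G"
    "(u, u) \<notin> edges G"
    "u \<in> nodes G \<Longrightarrow> distinct (nbrs G u)"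
    "u \<in> nodes G \<Longrightarrow> set (nbrs G u) = neighbours G u"
  using assms unfolding wf_network_def
  by (auto dest: finite_subset[OF _ finite_cartesian_product])

lemma nbrs_subset:
  assumes "wf_network G" "u \<in> nodes G"
  shows "set (nbrs G u) \<subseteq> nodes G - {u}"
  using wf_networkD(2,6,8)[OF assms(1)] assms(2) by (auto simp: neighbours_def)

lemma nbrs_nth:
  assumes "wf_network G" "u \<in> nodes G" "j < length (nbrs G u)"
  shows "nbrs G u ! j \<in> nodes G" "nbrs G u ! j \<noteq> u" "nbrs G u ! j \<in> set (nbrs G u)"
  using nbrs_subset[OF assms(1,2)] nth_mem[OF assms(3)] by auto

lemma subnetwork_simps [simp]:
  "nodes (subnetwork G u j x) = nodes G - {u}"
  "edges (subnetwork G u j x) = {(v, w) \<in> edges G. v \<noteq> u \<and> w \<noteq> u}"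
  "nbrs (subnetwork G u j x) = (\<lambda>v. removeAll u (nbrs G v))"
  "acts (subnetwork G u j x) = acts G"
  "v \<in> nodes G \<Longrightarrow> v \<noteq> u \<Longrightarrow> y < acts G \<Longrightarrow> node_pot (subnetwork G u j x) v y =
     node_pot G v y +
       (if v \<in> set (take j (nbrs G u)) then interaction G u v x y
        else if v \<in> set (drop (Suc j) (nbrs G u)) then interaction G u v 0 y else 0)"
  "e \<in> edges G \<Longrightarrow> fst e \<noteq> u \<Longrightarrow> snd e \<noteq> u \<Longrightarrow> y < acts G \<Longrightarrow> z < acts G \<Longrightarrow>
     edge_pot (subnetwork G u j x) e y z = edge_pot G e y z"
  by (auto simp: subnetwork_def Let_def)

lemma wf_subnetwork:
  assumes "wf_network G" "u \<in> nodes G"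
  shows "wf_network (subnetwork G u j x)"
proof -
  note D = wf_networkD[OF assms(1)]
  show ?thesis
    unfolding wf_network_def
    using D(1,2,4,5,7,8) by (auto simp: distinct_removeAll neighbours_def)
qed

lemma finite_interaction:
  assumes "finite_potentials G" "(u, v) \<in> edges G \<or> (v, u) \<in> edges G" "x < acts G" "y < acts G"
  shows "is_real (interaction G u v x y)"
  using assms unfolding finite_potentials_def interaction_def by auto

lemma finite_interaction_nbrs:
  assumes "wf_network G" "u \<in> nodes G" "finite_potentials G" "v \<in> set (nbrs G u)" "x < acts G" "y < acts G"
  shows "is_real (interaction G u v x y)"
  using assms finite_interaction[of G u v x y] wf_networkD(8)[OF assms(1,2)]
  by (auto simp: neighbours_def)

lemma is_real_add:
  "is_real a \<Longrightarrow> is_real b \<Longrightarrow> is_real (a + b)"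
  "is_real a \<Longrightarrow> is_real b \<Longrightarrow> is_real (a - b)"
  by (cases a; cases b; simp add: is_real_def)+

lemma is_real_sum:
  assumes "\<And>i. i \<in> A \<Longrightarrow> is_real (f i)"
  shows "is_real (\<Sum>i\<in>A. f i)"
  using assms by (induction A rule: infinite_finite_induct) (auto intro: is_real_add simp: is_real_def[of 0])

lemma finite_subnetwork:
  assumes "wf_network G" "finite_potentials G" "u \<in> nodes G" "x < acts G"
  shows "finite_potentials (subnetwork G u j x)"
proof -
  have T: "0 < acts G" using wf_networkD[OF assms(1)] by auto
  have E: "is_real (edge_pot (subnetwork G u j x) e y z)"
    if "e \<in> edges (subnetwork G u j x)" "y < acts G" "z < acts G" for e y z
    using that assms(2) unfolding finite_potentials_def
    by (cases e) auto
  have N: "is_real (node_pot (subnetwork G u j x) v y)"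
    if "v \<in> nodes G - {u}" "y < acts G" for v y
  proof -
    have "is_real (node_pot G v y)"
      using that assms(2) unfolding finite_potentials_def by auto
    moreover have "is_real (if v \<in> set (take j (nbrs G u)) then interaction G u v x y
        else if v \<in> set (drop (Suc j) (nbrs G u)) then interaction G u v 0 y else 0)"
      using finite_interaction_nbrs[OF assms(1,3,2), of v] T assms(4) that
      by (auto dest: in_set_takeD in_set_dropD simp: is_real_def[of 0])
    ultimately show ?thesis
      using that by (simp del: if_split add: is_real_add)
  qed
  show ?thesis
    unfolding finite_potentials_def using E N by auto
qed

lemma finite_solutions: "wf_network G \<Longrightarrow> finite (solutions G)"
  unfolding solutions_def by (intro finite_PiE) (auto dest: wf_networkD)

lemma solution_with_value:
  assumes "wf_network G" "a < acts G"
  shows "\<exists>z \<in> solutions G. v \<in> nodes G \<longrightarrow> z v = a"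
  by (rule bexI[of _ "\<lambda>w\<in>nodes G. a"]) (use assms in \<open>auto simp: solutions_def\<close>)

lemma finite_objective:
  assumes "finite_potentials G" "edges G \<subseteq> nodes G \<times> nodes G" "\<And>v. v \<in> nodes G \<Longrightarrow> z v < acts G"
  shows "is_real (objective G z)"
  unfolding objective_def
  by (intro is_real_add is_real_sum)
     (use assms in \<open>auto simp: finite_potentials_def\<close>)

lemma J_val_set:
  assumes "wf_network G" "v \<in> nodes G" "a < acts G"
  shows "finite {z \<in> solutions G. z v = a}" "{z \<in> solutions G. z v = a} \<noteq> {}"
  using finite_solutions[OF assms(1)] solution_with_value[OF assms(1,3), of v] assms(2) by auto

lemma finite_J_val:
  assumes "wf_network G" "finite_potentials G" "v \<in> nodes G" "a < acts G"
  shows "is_real (J_val G v a)"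
proof -
  have "J_val G v a \<in> objective G ` {z \<in> solutions G. z v = a}"
    unfolding J_val_def using J_val_set[OF assms(1,3,4)] by (intro Max_in) auto
  then obtain z where "J_val G v a = objective G z" "z \<in> solutions G" by auto
  then show ?thesis
    using finite_objective[OF assms(2), of z] wf_networkD(2)[OF assms(1)]
    by (auto simp: solutions_def)
qed

lemma finite_cavity:
  assumes "wf_network G" "finite_potentials G" "v \<in> nodes G" "a < acts G"
  shows "is_real (cavity G v a)"
  unfolding cavity_def using assms wf_networkD(4)[OF assms(1)]
  by (intro is_real_add finite_J_val) auto

lemma Max_add_const_ereal:
  assumes "finite S" "S \<noteq> {}"
  shows "Max ((\<lambda>z. c + f z) ` S) = (c :: ereal) + Max (f ` S)"
proof -
  have "c + Max (f ` S) = Max ((+) c ` f ` S)"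
    by (rule mono_Max_commute) (use assms in \<open>auto simp: mono_def intro: add_mono\<close>)
  then show ?thesis by (simp add: image_image)
qed

lemma Max_group:
  fixes f :: "'a \<Rightarrow> 'b :: linorder"
  assumes "finite S" "finite Y" "Y \<noteq> {}" "\<And>y. y \<in> Y \<Longrightarrow> {z \<in> S. h z = y} \<noteq> {}" "h ` S \<subseteq> Y"
  shows "Max (f ` S) = Max ((\<lambda>y. Max (f ` {z \<in> S. h z = y})) ` Y)"
proof (rule antisym)
  have S: "S \<noteq> {}" using assms(3,4) by blast
  have "f z \<le> Max ((\<lambda>y. Max (f ` {z \<in> S. h z = y})) ` Y)" if "z \<in> S" for z
  proof -
    have "f z \<le> Max (f ` {z' \<in> S. h z' = h z})"
      using assms(1) that by (intro Max_ge) auto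
    also have "\<dots> \<le> Max ((\<lambda>y. Max (f ` {z \<in> S. h z = y})) ` Y)"
      using assms(2,5) that by (intro Max_ge) auto
    finally show ?thesis .
  qed
  then show "Max (f ` S) \<le> Max ((\<lambda>y. Max (f ` {z \<in> S. h z = y})) ` Y)"
    using assms(1) S by (intro Max.boundedI) auto
  have "Max (f ` {z \<in> S. h z = y}) \<le> Max (f ` S)" if "y \<in> Y" for y
    using assms(1) assms(4)[OF that] by (intro Max_mono) auto
  then show "Max ((\<lambda>y. Max (f ` {z \<in> S. h z = y})) ` Y) \<le> Max (f ` S)"
    using assms(2,3) by (intro Max.boundedI) auto
qed

definition rest_objective :: "'v network \<Rightarrow> 'v \<Rightarrow> ('v \<Rightarrow> nat) \<Rightarrow> ereal" where
  "rest_objective G u z =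
     (\<Sum>(v, w)\<in>{(v, w) \<in> edges G. v \<noteq> u \<and> w \<noteq> u}. edge_pot G (v, w) (z v) (z w)) +
     (\<Sum>v\<in>nodes G - {u}. node_pot G v (z v))"

text \<open>
  The interpolation behind the cavity recursion: the first \<open>j\<close> neighbours of \<open>u\<close> see the action \<open>a\<close>
  at \<open>u\<close>, the others still see the action \<open>0\<close>.  The potential of \<open>u\<close> itself is left out.
\<close>

definition mixed_objective :: "'v network \<Rightarrow> 'v \<Rightarrow> nat \<Rightarrow> nat \<Rightarrow> ('v \<Rightarrow> nat) \<Rightarrow> ereal" where
  "mixed_objective G u a j z =
     rest_objective G u z +
     (\<Sum>i<length (nbrs G u). interaction G u (nbrs G u ! i) (if i < j then a else 0) (z (nbrs G u ! i)))"

lemma sum_nbrs: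
  assumes "wf_network G" "u \<in> nodes G"
  shows "(\<Sum>v\<in>neighbours G u. f v) = (\<Sum>i<length (nbrs G u). f (nbrs G u ! i))"
proof -
  have "(\<Sum>v\<in>neighbours G u. f v) = sum_list (map f (nbrs G u))"
    using wf_networkD(7,8)[OF assms(1,2)] by (metis sum_list_distinct_conv_sum_set)
  also have "\<dots> = (\<Sum>i<length (nbrs G u). f (nbrs G u ! i))"
    by (simp add: sum_list_sum_nth atLeast0LessThan)
  finally show ?thesis .
qed

lemma objective_split:
  assumes wf: "wf_network G" and u: "u \<in> nodes G"
  shows "objective G z = node_pot G u (z u) + rest_objective G u z +
           (\<Sum>i<length (nbrs G u). interaction G u (nbrs G u ! i) (z u) (z (nbrs G u ! i)))"
proof -
  note D = wf_networkD[OF wf]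
  let ?f = "\<lambda>(v, w). edge_pot G (v, w) (z v) (z w)"
  let ?E = "{(v, w) \<in> edges G. v \<noteq> u \<and> w \<noteq> u}"
  let ?A = "{v. (u, v) \<in> edges G}" and ?B = "{v. (v, u) \<in> edges G}"
  have fin: "finite ?A" "finite ?B"
    using D(1,2) by (auto intro: finite_subset[of _ "nodes G"])
  have "sum ?f (edges G) = sum ?f (?E \<union> ((\<lambda>v. (u, v)) ` ?A \<union> (\<lambda>v. (v, u)) ` ?B))"
    by (rule sum.cong) auto
  also have "\<dots> = sum ?f ?E + sum ?f ((\<lambda>v. (u, v)) ` ?A \<union> (\<lambda>v. (v, u)) ` ?B)"
    by (rule sum.union_disjoint) (use D(3) fin in \<open>auto intro: finite_subset[of _ "edges G"]\<close>)
  also have "sum ?f ((\<lambda>v. (u, v)) ` ?A \<union> (\<lambda>v. (v, u)) ` ?B) =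
      sum ?f ((\<lambda>v. (u, v)) ` ?A) + sum ?f ((\<lambda>v. (v, u)) ` ?B)"
    by (rule sum.union_disjoint) (use fin D(6) in auto)
  also have "sum ?f ((\<lambda>v. (u, v)) ` ?A) = (\<Sum>v\<in>?A. interaction G u v (z u) (z v))"
    by (subst sum.reindex) (auto simp: inj_on_def interaction_def intro!: sum.cong)
  also have "sum ?f ((\<lambda>v. (v, u)) ` ?B) = (\<Sum>v\<in>?B. interaction G u v (z u) (z v))"
    by (subst sum.reindex) (use D(5) in \<open>auto simp: inj_on_def interaction_def intro!: sum.cong\<close>)
  also have "(\<Sum>v\<in>?A. interaction G u v (z u) (z v)) + (\<Sum>v\<in>?B. interaction G u v (z u) (z v)) =
     (\<Sum>v\<in>neighbours G u. interaction G u v (z u) (z v))"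
    by (subst sum.union_disjoint[symmetric]) (use fin D(5) in \<open>auto simp: neighbours_def intro!: sum.cong\<close>)
  finally have 1: "sum ?f (edges G) = sum ?f ?E + (\<Sum>v\<in>neighbours G u. interaction G u v (z u) (z v))" .
  have 2: "(\<Sum>v\<in>nodes G. node_pot G v (z v)) =
      node_pot G u (z u) + (\<Sum>v\<in>nodes G - {u}. node_pot G v (z v))"
    using D(1) u by (simp add: sum.remove)
  show ?thesis
    unfolding objective_def rest_objective_def 1 2 sum_nbrs[OF wf u] by (simp add: ac_simps)
qed

text \<open>
  The network \<open>subnetwork G u j a\<close> contains every interaction of \<open>u\<close> in its interpolated form except
  the one with the \<open>j\<close>-th neighbour.  Adding that one back for the action \<open>0\<close> or for the action
  \<open>a\<close> gives two consecutive interpolations.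
\<close>

lemma objective_subnetwork:
  assumes wf: "wf_network G" and u: "u \<in> nodes G" and j: "j < length (nbrs G u)"
    and z: "\<And>v. v \<in> nodes G - {u} \<Longrightarrow> z v < acts G"
  shows "mixed_objective G u a j z =
           interaction G u (nbrs G u ! j) 0 (z (nbrs G u ! j)) + objective (subnetwork G u j a) z"
    and "mixed_objective G u a (Suc j) z =
           interaction G u (nbrs G u ! j) a (z (nbrs G u ! j)) + objective (subnetwork G u j a) z"
proof -
  note D = wf_networkD[OF wf]
  let ?vs = "nbrs G u" and ?d = "length (nbrs G u)"
  let ?E = "{(v, w) \<in> edges G. v \<noteq> u \<and> w \<noteq> u}"
  define ex where "ex v = (if v \<in> set (take j ?vs) then interaction G u v a (z v)
        else if v \<in> set (drop (Suc j) ?vs) then interaction G u v 0 (z v) else 0)" for v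
  have dist: "distinct ?vs" by (rule D(7)[OF u])
  have sub: "neighbours G u \<subseteq> nodes G - {u}"
    using nbrs_subset[OF wf u] D(8)[OF u] by simp
  have "(\<Sum>v\<in>nodes G - {u}. ex v) = (\<Sum>v\<in>neighbours G u. ex v)"
    by (rule sum.mono_neutral_right)
       (use D(1,8) sub u in \<open>auto simp: ex_def dest!: in_set_takeD in_set_dropD\<close>)
  also have "\<dots> = (\<Sum>i<?d. ex (?vs ! i))" by (rule sum_nbrs[OF wf u])
  also have "\<dots> = (\<Sum>i<?d. if i = j then 0
       else interaction G u (?vs ! i) (if i < j then a else 0) (z (?vs ! i)))"
  proof (intro sum.cong refl)
    fix i assume "i \<in> {..<?d}"
    then have i: "i < ?d" by simp
    have t: "?vs ! i \<in> set (take j ?vs) \<longleftrightarrow> i < j"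
      using i j dist by (auto simp: in_set_conv_nth nth_eq_iff_index_eq)
    have d: "?vs ! i \<in> set (drop (Suc j) ?vs) \<longleftrightarrow> i > j"
    proof
      assume "?vs ! i \<in> set (drop (Suc j) ?vs)"
      then show "i > j" using i j dist by (auto simp: in_set_conv_nth nth_eq_iff_index_eq)
    next
      assume "i > j"
      then show "?vs ! i \<in> set (drop (Suc j) ?vs)"
        using i by (auto simp: in_set_conv_nth intro!: exI[of _ "i - Suc j"])
    qed
    show "ex (?vs ! i) = (if i = j then 0
        else interaction G u (?vs ! i) (if i < j then a else 0) (z (?vs ! i)))"
      unfolding ex_def t d by auto
  qed
  finally have ex: "(\<Sum>v\<in>nodes G - {u}. ex v) = (\<Sum>i<?d. if i = j then 0
       else interaction G u (?vs ! i) (if i < j then a else 0) (z (?vs ! i)))" .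
  have e: "(\<Sum>(v, w)\<in>?E. edge_pot (subnetwork G u j a) (v, w) (z v) (z w)) =
           (\<Sum>(v, w)\<in>?E. edge_pot G (v, w) (z v) (z w))"
    by (rule sum.cong) (use z D(2) in auto)
  have n: "(\<Sum>v\<in>nodes G - {u}. node_pot (subnetwork G u j a) v (z v)) =
      (\<Sum>v\<in>nodes G - {u}. node_pot G v (z v)) + (\<Sum>v\<in>nodes G - {u}. ex v)"
    unfolding sum.distrib[symmetric] by (rule sum.cong) (use z in \<open>auto simp: ex_def\<close>)
  have obj: "objective (subnetwork G u j a) z = rest_objective G u z + (\<Sum>v\<in>nodes G - {u}. ex v)"
    unfolding objective_def rest_objective_def subnetwork_simps(1,2) e n by (simp add: ac_simps)
  have split: "(\<Sum>i<?d. f i) = f j + (\<Sum>i<?d. if i = j then 0 else f i)" for f :: "nat \<Rightarrow> ereal"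
    using j by (subst sum.remove[of _ j], simp, simp, subst (2) sum.remove[of _ j])
      (auto intro!: arg_cong[of _ _ "\<lambda>s. f j + s"] sum.cong)
  show "mixed_objective G u a j z =
           interaction G u (nbrs G u ! j) 0 (z (nbrs G u ! j)) + objective (subnetwork G u j a) z"
    unfolding mixed_objective_def obj ex
    by (subst split) (simp add: ac_simps)
  have "(\<Sum>i<?d. if i = j then 0
       else interaction G u (?vs ! i) (if i < Suc j then a else 0) (z (?vs ! i))) =
     (\<Sum>i<?d. if i = j then 0
       else interaction G u (?vs ! i) (if i < j then a else 0) (z (?vs ! i)))"
    by (intro sum.cong) auto
  then show "mixed_objective G u a (Suc j) z =
           interaction G u (nbrs G u ! j) a (z (nbrs G u ! j)) + objective (subnetwork G u j a) z"
    unfolding mixed_objective_def obj ex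
    by (subst split) (simp add: ac_simps)
qed

lemma rest_objective_cong:
  assumes "edges G \<subseteq> nodes G \<times> nodes G" "\<And>v. v \<in> nodes G - {u} \<Longrightarrow> z v = z' v"
  shows "rest_objective G u z = rest_objective G u z'"
proof -
  have "(\<Sum>(v, w)\<in>{(v, w) \<in> edges G. v \<noteq> u \<and> w \<noteq> u}. edge_pot G (v, w) (z v) (z w)) =
        (\<Sum>(v, w)\<in>{(v, w) \<in> edges G. v \<noteq> u \<and> w \<noteq> u}. edge_pot G (v, w) (z' v) (z' w))"
    by (rule sum.cong) (use assms in auto)
  moreover have "(\<Sum>v\<in>nodes G - {u}. node_pot G v (z v)) = (\<Sum>v\<in>nodes G - {u}. node_pot G v (z' v))"
    by (rule sum.cong) (use assms in auto)
  ultimately show ?thesis unfolding rest_objective_def by simp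
qed

lemma mixed_objective_cong:
  assumes wf: "wf_network G" "u \<in> nodes G" and "\<And>v. v \<in> nodes G - {u} \<Longrightarrow> z v = z' v"
  shows "mixed_objective G u a j z = mixed_objective G u a j z'"
proof -
  have "rest_objective G u z = rest_objective G u z'"
    by (rule rest_objective_cong) (use wf_networkD(2)[OF wf(1)] assms(3) in auto)
  moreover have "(\<Sum>i<length (nbrs G u). interaction G u (nbrs G u ! i) (if i < j then a else 0) (z (nbrs G u ! i))) =
    (\<Sum>i<length (nbrs G u). interaction G u (nbrs G u ! i) (if i < j then a else 0) (z' (nbrs G u ! i)))"
    by (rule sum.cong) (use nbrs_nth[OF wf] assms(3) in auto)
  ultimately show ?thesis unfolding mixed_objective_def by simp
qed

definition mixed_max :: "'v network \<Rightarrow> 'v \<Rightarrow> nat \<Rightarrow> nat \<Rightarrow> ereal" where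
  "mixed_max G u a j = Max (mixed_objective G u a j ` (\<Pi>\<^sub>E v\<in>nodes G - {u}. {..<acts G}))"

text \<open>
  At the two ends of the interpolation all neighbours see the same action of \<open>u\<close>, so that only the
  potential of \<open>u\<close> separates the interpolated maximum from \<^const>\<open>J_val\<close>.
\<close>

lemma J_val_mixed:
  assumes wf: "wf_network G" and u: "u \<in> nodes G" and b: "b < acts G"
    and j: "b = a \<and> j = length (nbrs G u) \<or> b = 0 \<and> j = 0"
  shows "J_val G u b = node_pot G u b + mixed_max G u a j"
proof -
  let ?S = "\<Pi>\<^sub>E v\<in>nodes G - {u}. {..<acts G}"
  have S: "finite ?S" "?S \<noteq> {}"
    using wf_networkD(1,4)[OF wf] by (auto intro!: finite_PiE simp: PiE_eq_empty_iff)
  have obj: "objective G z = node_pot G u b + mixed_objective G u a j z" if "z u = b" for z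
  proof -
    have "(\<Sum>i<length (nbrs G u). interaction G u (nbrs G u ! i) b (z (nbrs G u ! i))) =
      (\<Sum>i<length (nbrs G u). interaction G u (nbrs G u ! i) (if i < j then a else 0) (z (nbrs G u ! i)))"
      by (rule sum.cong) (use j in auto)
    then show ?thesis
      unfolding objective_split[OF wf u] mixed_objective_def that by (simp add: ac_simps)
  qed
  have "objective G ` {z \<in> solutions G. z u = b} = (\<lambda>z. node_pot G u b + mixed_objective G u a j z) ` ?S"
  proof (intro equalityI subsetI)
    fix t assume "t \<in> objective G ` {z \<in> solutions G. z u = b}"
    then obtain z where z: "z \<in> solutions G" "z u = b" "t = objective G z" by auto
    have "t = node_pot G u b + mixed_objective G u a j (restrict z (nodes G - {u}))"
      unfolding z(3) obj[of z, OF z(2)] by (subst mixed_objective_cong[OF wf u]) auto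
    moreover have "restrict z (nodes G - {u}) \<in> ?S"
      using z(1) by (auto simp: solutions_def)
    ultimately show "t \<in> (\<lambda>z. node_pot G u b + mixed_objective G u a j z) ` ?S" by blast
  next
    fix t assume "t \<in> (\<lambda>z. node_pot G u b + mixed_objective G u a j z) ` ?S"
    then obtain z where z: "z \<in> ?S" "t = node_pot G u b + mixed_objective G u a j z" by auto
    have "t = objective G (z(u := b))"
      unfolding z(2) by (subst obj, simp, subst mixed_objective_cong[OF wf u, of z "z(u := b)"]) auto
    moreover have "z(u := b) \<in> {z \<in> solutions G. z u = b}"
      using z(1) u b by (auto simp: solutions_def PiE_iff extensional_def)
    ultimately show "t \<in> objective G ` {z \<in> solutions G. z u = b}" by blast
  qed
  then show ?thesis
    unfolding J_val_def mixed_max_def by (simp add: Max_add_const_ereal[OF S])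
qed

text \<open>
  Maximise first over the solutions of the subnetwork with prescribed action \<open>y\<close> at the \<open>j\<close>-th
  neighbour and then over \<open>y\<close>.  Both interpolations adjacent to \<open>j\<close> involve the same subnetwork.
\<close>

lemma mixed_max_subnetwork:
  assumes wf: "wf_network G" and u: "u \<in> nodes G" and j: "j < length (nbrs G u)"
    and b: "b = 0 \<and> i = j \<or> b = a \<and> i = Suc j"
  shows "mixed_max G u a i = Max ((\<lambda>y. interaction G u (nbrs G u ! j) b y +
           J_val (subnetwork G u j a) (nbrs G u ! j) y) ` {..<acts G})"
proof -
  let ?S = "\<Pi>\<^sub>E v\<in>nodes G - {u}. {..<acts G}" and ?v = "nbrs G u ! j" and ?N = "subnetwork G u j a"
  have T: "0 < acts G" using wf_networkD(4)[OF wf] .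
  have S: "?S = solutions ?N" by (simp add: solutions_def)
  have wfN: "wf_network ?N" by (rule wf_subnetwork[OF wf u])
  have v: "?v \<in> nodes ?N" using nbrs_nth[OF wf u j] by simp
  have ne: "finite {z \<in> ?S. z ?v = y}" "{z \<in> ?S. z ?v = y} \<noteq> {}" if "y < acts G" for y
    unfolding S using J_val_set[OF wfN v] that by auto
  have "mixed_max G u a i = Max ((\<lambda>y. Max (mixed_objective G u a i ` {z \<in> ?S. z ?v = y})) ` {..<acts G})"
    unfolding mixed_max_def
  proof (rule Max_group)
    show "(\<lambda>z. z ?v) ` ?S \<subseteq> {..<acts G}" using v by (auto simp: PiE_iff)
  qed (use T ne finite_solutions[OF wfN] S in auto)
  also have "\<dots> = Max ((\<lambda>y. interaction G u ?v b y + J_val ?N ?v y) ` {..<acts G})"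
  proof (intro arg_cong[of _ _ Max] image_cong refl)
    fix y assume "y \<in> {..<acts G}"
    then have y: "y < acts G" by simp
    have "mixed_objective G u a i ` {z \<in> ?S. z ?v = y} =
          (\<lambda>z. interaction G u ?v b y + objective ?N z) ` {z \<in> ?S. z ?v = y}"
    proof (intro image_cong refl)
      fix z assume z: "z \<in> {z \<in> ?S. z ?v = y}"
      then have "z v < acts G" if "v \<in> nodes G - {u}" for v using that by (auto simp: PiE_iff)
      note objective_subnetwork[where a = a, OF wf u j this]
      then show "mixed_objective G u a i z = interaction G u ?v b y + objective ?N z"
        using b z by auto
    qed
    then show "Max (mixed_objective G u a i ` {z \<in> ?S. z ?v = y}) =
        interaction G u ?v b y + J_val ?N ?v y"
      unfolding J_val_def using Max_add_const_ereal[OF ne[OF y]] S by simp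
  qed
  finally show ?thesis .
qed

text \<open>
  By the preceding lemma, the difference of two consecutive interpolated maxima is the partial
  cavity function at the cavity of the subnetwork: replacing \<^const>\<open>J_val\<close> by \<^const>\<open>cavity\<close> shifts both
  maxima by the same constant.  The differences telescope.
\<close>

theorem cavity_recursion:
  assumes wf: "wf_network G" and fin: "finite_potentials G" and u: "u \<in> nodes G" and a: "a < acts G"
  shows "cavity G u a = node_pot G u a - node_pot G u 0 +
     (\<Sum>j<length (nbrs G u). partial_cavity G u (nbrs G u ! j) a
        (cavity (subnetwork G u j a) (nbrs G u ! j)))"
proof -
  let ?d = "length (nbrs G u)"
  have T: "0 < acts G" using wf_networkD(4)[OF wf] .
  have pot: "is_real (node_pot G u b)" if "b < acts G" for b
    using fin u that by (auto simp: finite_potentials_def)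
  have H: "is_real (mixed_max G u a i)" for i
  proof -
    let ?S = "\<Pi>\<^sub>E v\<in>nodes G - {u}. {..<acts G}"
    have S: "finite ?S" "?S \<noteq> {}"
      using wf_networkD(1,4)[OF wf] by (auto intro!: finite_PiE simp: PiE_eq_empty_iff)
    have "mixed_max G u a i \<in> mixed_objective G u a i ` ?S"
      unfolding mixed_max_def using S by (intro Max_in) auto
    then obtain z where z: "z \<in> ?S" and eq: "mixed_max G u a i = mixed_objective G u a i z" by auto
    have zv: "z v < acts G" if "v \<in> nodes G - {u}" for v using z that by (auto simp: PiE_iff)
    show ?thesis
      unfolding eq mixed_objective_def rest_objective_def
    proof (intro is_real_add is_real_sum)
      fix i' assume "i' \<in> {..<?d}"
      then have i': "i' < ?d" by simp
      show "is_real (interaction G u (nbrs G u ! i') (if i' < i then a else 0) (z (nbrs G u ! i')))"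
        using finite_interaction_nbrs[OF wf u fin nbrs_nth(3)[OF wf u i'], of _ "z (nbrs G u ! i')"]
          zv[of "nbrs G u ! i'"] nbrs_nth[OF wf u i'] a T by auto
    qed (use fin zv wf_networkD(2)[OF wf] in \<open>auto simp: finite_potentials_def\<close>)
  qed
  define h where "h i = real_of_ereal (mixed_max G u a i)" for i
  have h: "mixed_max G u a i = ereal (h i)" for i
    using H[of i] by (cases "mixed_max G u a i") (auto simp: h_def is_real_def)
  have mu: "partial_cavity G u (nbrs G u ! j) a (cavity (subnetwork G u j a) (nbrs G u ! j)) =
      ereal (h (Suc j) - h j)" if j: "j < ?d" for j
  proof -
    let ?v = "nbrs G u ! j" and ?N = "subnetwork G u j a"
    have v: "?v \<in> nodes ?N" using nbrs_nth[OF wf u j] by simp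
    have J: "is_real (J_val ?N ?v y)" if "y < acts G" for y
      using finite_J_val[OF wf_subnetwork[OF wf u] finite_subnetwork[OF wf fin u a] v] that by simp
    obtain c where c: "J_val ?N ?v 0 = ereal c" using J[OF T] by (cases "J_val ?N ?v 0") (auto simp: is_real_def)
    \<comment> \<open>Cavities differ from \<^const>\<open>J_val\<close> by the constant \<open>c\<close>, which cancels in the partial cavity.\<close>
    have M: "Max ((\<lambda>y. interaction G u ?v b y + cavity ?N ?v y) ` {..<acts G}) = ereal (h i - c)"
      if "b = 0 \<and> i = j \<or> b = a \<and> i = Suc j" for b i
    proof -
      have "ereal (h i) = Max ((\<lambda>y. ereal c + (interaction G u ?v b y + cavity ?N ?v y)) ` {..<acts G})"
        unfolding h[symmetric] mixed_max_subnetwork[OF wf u j that]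
      proof (intro arg_cong[of _ _ Max] image_cong refl)
        fix y assume "y \<in> {..<acts G}"
        then have "is_real (J_val ?N ?v y)" using J by simp
        then show "interaction G u ?v b y + J_val ?N ?v y = ereal c + (interaction G u ?v b y + cavity ?N ?v y)"
          unfolding cavity_def c by (cases "J_val ?N ?v y"; cases "interaction G u ?v b y") (auto simp: is_real_def)
      qed
      also have "\<dots> = ereal c + Max ((\<lambda>y. interaction G u ?v b y + cavity ?N ?v y) ` {..<acts G})"
        using T by (intro Max_add_const_ereal) auto
      finally show ?thesis
        by (cases "Max ((\<lambda>y. interaction G u ?v b y + cavity ?N ?v y) ` {..<acts G})") auto
    qed
    show ?thesis
      unfolding partial_cavity_def using M[of 0 j] M[of a "Suc j"] by simp
  qed
  have "(\<Sum>j<?d. partial_cavity G u (nbrs G u ! j) a (cavity (subnetwork G u j a) (nbrs G u ! j))) =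
     ereal (h ?d - h 0)"
    by (simp add: mu sum_lessThan_telescope)
  moreover have "J_val G u a = node_pot G u a + ereal (h ?d)" "J_val G u 0 = node_pot G u 0 + ereal (h 0)"
    using J_val_mixed[OF wf u a, of a ?d] J_val_mixed[OF wf u T, of a 0] by (auto simp: h)
  ultimately show ?thesis
    unfolding cavity_def using pot[OF a] pot[OF T]
    by (cases "node_pot G u a"; cases "node_pot G u 0") (auto simp: is_real_def)
qed

theorem CE_true_boundary:
  assumes "wf_network G" "finite_potentials G" "u \<in> nodes G" "a < acts G"
  shows "CE_bdry (\<lambda>_. cavity) G u r a = cavity G u a"
  using assms
proof (induction r arbitrary: G u a)
  case (Suc r)
  have "partial_cavity G u (nbrs G u ! j) a
          (\<lambda>y. CE_bdry (\<lambda>_. cavity) (subnetwork G u j a) (nbrs G u ! j) r y) =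
        partial_cavity G u (nbrs G u ! j) a (cavity (subnetwork G u j a) (nbrs G u ! j))"
    if j: "j < length (nbrs G u)" for j
  proof -
    have "CE_bdry (\<lambda>_. cavity) (subnetwork G u j a) (nbrs G u ! j) r y =
          cavity (subnetwork G u j a) (nbrs G u ! j) y" if "y < acts G" for y
      using Suc.prems that nbrs_nth[OF Suc.prems(1,3) j]
      by (intro Suc.IH wf_subnetwork finite_subnetwork) auto
    then show ?thesis
      unfolding partial_cavity_def
      by (intro arg_cong2[of _ _ _ _ "(-)"] arg_cong[of _ _ Max] image_cong) auto
  qed
  then show ?case
    unfolding cavity_recursion[OF Suc.prems] by simp
qed simp

section \<open>Random networks and the error of the cavity expansion\<close>

lemma CE_simps:
  "CE G u 0 x = 0"
  "CE G u (Suc r) x = node_pot G u x - node_pot G u 0 +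
     (\<Sum>j<length (nbrs G u). partial_cavity G u (nbrs G u ! j) x
          (CE (subnetwork G u j x) (nbrs G u ! j) r))"
  by (simp_all add: CE_def)


text \<open>
  The induction over the depth of the expansion runs through random subnetworks.  What they share
  with the original network is a deterministic graph, measurable potentials, and finiteness of the
  potentials outside a null set.
\<close>

definition random_wf_network ::
  "'w measure \<Rightarrow> 'v set \<Rightarrow> ('v \<times> 'v) set \<Rightarrow> ('v \<Rightarrow> 'v list) \<Rightarrow> nat \<Rightarrow> ('w \<Rightarrow> 'v network) \<Rightarrow> bool"
where
  "random_wf_network M V E nb T G \<longleftrightarrow>
     space M \<noteq> {} \<and>
     (\<forall>\<omega>\<in>space M. wf_network (G \<omega>) \<and>
        nodes (G \<omega>) = V \<and> edges (G \<omega>) = E \<and> nbrs (G \<omega>) = nb \<and> acts (G \<omega>) = T) \<and>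
     (\<forall>v\<in>V. \<forall>x<T. (\<lambda>\<omega>. node_pot (G \<omega>) v x) \<in> borel_measurable M) \<and>
     (\<forall>e\<in>E. \<forall>x<T. \<forall>y<T. (\<lambda>\<omega>. edge_pot (G \<omega>) e x y) \<in> borel_measurable M) \<and>
     (AE \<omega> in M. finite_potentials (G \<omega>))"

lemma random_wf_networkD:
  assumes "random_wf_network M V E nb T G"
  shows "space M \<noteq> {}"
    "\<omega> \<in> space M \<Longrightarrow> wf_network (G \<omega>)" "\<omega> \<in> space M \<Longrightarrow> nodes (G \<omega>) = V"
    "\<omega> \<in> space M \<Longrightarrow> edges (G \<omega>) = E" "\<omega> \<in> space M \<Longrightarrow> nbrs (G \<omega>) = nb"
    "\<omega> \<in> space M \<Longrightarrow> acts (G \<omega>) = T"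
    "v \<in> V \<Longrightarrow> x < T \<Longrightarrow> (\<lambda>\<omega>. node_pot (G \<omega>) v x) \<in> borel_measurable M"
    "e \<in> E \<Longrightarrow> x < T \<Longrightarrow> y < T \<Longrightarrow> (\<lambda>\<omega>. edge_pot (G \<omega>) e x y) \<in> borel_measurable M"
    "AE \<omega> in M. finite_potentials (G \<omega>)"
  using assms unfolding random_wf_network_def by blast+

lemma random_graph:
  assumes "random_wf_network M V E nb T G"
  shows "finite V" "E \<subseteq> V \<times> V" "finite E" "0 < T" "u \<in> V \<Longrightarrow> set (nb u) = {v. (u, v) \<in> E \<or> (v, u) \<in> E}"
    "u \<in> V \<Longrightarrow> set (nb u) \<subseteq> V - {u}"
proof -
  note D = random_wf_networkD[OF assms]
  obtain \<omega> where \<omega>: "\<omega> \<in> space M" using D(1) by auto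
  note W = wf_networkD[OF D(2)[OF \<omega>], unfolded D(3-6)[OF \<omega>] neighbours_def]
  show "finite V" "E \<subseteq> V \<times> V" "finite E" "0 < T" using W by auto
  show "u \<in> V \<Longrightarrow> set (nb u) = {v. (u, v) \<in> E \<or> (v, u) \<in> E}" using W(8) .
  show "u \<in> V \<Longrightarrow> set (nb u) \<subseteq> V - {u}"
    using nbrs_subset[OF D(2)[OF \<omega>], unfolded D(3-6)[OF \<omega>]] .
qed

lemma interaction_measurable:
  assumes "random_wf_network M V E nb T G" "u \<in> V" "v \<in> set (nb u)" "x < T" "y < T"
  shows "(\<lambda>\<omega>. interaction (G \<omega>) u v x y) \<in> borel_measurable M"
proof -
  note D = random_wf_networkD[OF assms(1)]
  have "(u, v) \<in> E \<or> (v, u) \<in> E" using random_graph(5)[OF assms(1,2)] assms(3) by auto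
  then have "(\<lambda>\<omega>. if (u, v) \<in> E then edge_pot (G \<omega>) (u, v) x y else edge_pot (G \<omega>) (v, u) y x)
      \<in> borel_measurable M"
    using D(8) assms(4,5) by (cases "(u, v) \<in> E") simp_all
  then show ?thesis
    by (rule measurable_cong[THEN iffD1, rotated]) (simp add: interaction_def D(4))
qed

lemma random_subnetwork:
  assumes rn: "random_wf_network M V E nb T G" and u: "u \<in> V" and x: "x < T"
  shows "random_wf_network M (V - {u}) {(v, w) \<in> E. v \<noteq> u \<and> w \<noteq> u} (\<lambda>v. removeAll u (nb v)) T
           (\<lambda>\<omega>. subnetwork (G \<omega>) u j x)"
proof -
  note D = random_wf_networkD[OF rn]
  have T: "0 < T" by (rule random_graph(4)[OF rn])
  have n: "(\<lambda>\<omega>. node_pot (subnetwork (G \<omega>) u j x) v y) \<in> borel_measurable M"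
    if v: "v \<in> V - {u}" and y: "y < T" for v y
  proof -
    have "(\<lambda>\<omega>. node_pot (G \<omega>) v y +
       (if v \<in> set (take j (nb u)) then interaction (G \<omega>) u v x y
        else if v \<in> set (drop (Suc j) (nb u)) then interaction (G \<omega>) u v 0 y else 0)) \<in> borel_measurable M"
    proof (rule borel_measurable_ereal_add)
      show "(\<lambda>\<omega>. node_pot (G \<omega>) v y) \<in> borel_measurable M" using D(7) v y by simp
      have I: "(\<lambda>\<omega>. interaction (G \<omega>) u v z y) \<in> borel_measurable M"
        if "v \<in> set (nb u)" "z < T" for z
        using interaction_measurable[OF rn u that y] .
      show "(\<lambda>\<omega>. if v \<in> set (take j (nb u)) then interaction (G \<omega>) u v x y
        else if v \<in> set (drop (Suc j) (nb u)) then interaction (G \<omega>) u v 0 y else 0)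
        \<in> borel_measurable M"
      proof (cases "v \<in> set (take j (nb u))")
        case True
        then show ?thesis using I[OF in_set_takeD[OF True] x] by simp
      next
        case False
        show ?thesis
        proof (cases "v \<in> set (drop (Suc j) (nb u))")
          case True
          then show ?thesis using False I[OF in_set_dropD[OF True] T] by simp
        qed (use False in simp)
      qed
    qed
    then show ?thesis
      by (rule measurable_cong[THEN iffD1, rotated]) (use v y D in simp)
  qed
  have e: "(\<lambda>\<omega>. edge_pot (subnetwork (G \<omega>) u j x) e y z) \<in> borel_measurable M"
    if e: "e \<in> {(v, w) \<in> E. v \<noteq> u \<and> w \<noteq> u}" and y: "y < T" "z < T" for e y z
    by (rule measurable_cong[THEN iffD1, OF _ D(8)[of e y z]]) (use e y D in auto)
  have f: "AE \<omega> in M. finite_potentials (subnetwork (G \<omega>) u j x)"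
    using D(9) by (rule AE_mp) (use D u x in \<open>auto intro!: AE_I2 finite_subnetwork\<close>)
  show ?thesis
    unfolding random_wf_network_def
    using D(1) wf_subnetwork[OF D(2)] D(3-6) u n e f by auto
qed

lemma CE_measurable:
  assumes "random_wf_network M V E nb T G" "u \<in> V" "x < T"
  shows "(\<lambda>\<omega>. CE (G \<omega>) u r x) \<in> borel_measurable M"
  using assms
proof (induction r arbitrary: V E nb G u x)
  case 0
  then show ?case by (simp add: CE_simps)
next
  case (Suc r)
  note rn = Suc.prems(1) and u = Suc.prems(2) and x = Suc.prems(3)
  note D = random_wf_networkD[OF rn]
  have T: "0 < T" by (rule random_graph(4)[OF rn])
  define b where "b j \<omega> = CE (subnetwork (G \<omega>) u j x) (nb u ! j) r" for j \<omega>
  have M: "(\<lambda>\<omega>. Max ((\<lambda>y. interaction (G \<omega>) u (nb u ! j) z y + b j \<omega> y) ` {..<T})) \<in> borel_measurable M"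
    if j: "j < length (nb u)" and z: "z < T" for j z
  proof (rule borel_measurable_Max)
    fix y assume "y \<in> {..<T}"
    then have y: "y < T" by simp
    have v: "nb u ! j \<in> V - {u}" using random_graph(6)[OF rn u] nth_mem[OF j] by auto
    have "(\<lambda>\<omega>. b j \<omega> y) \<in> borel_measurable M"
      unfolding b_def by (rule Suc.IH[OF random_subnetwork[OF rn u x] v y])
    then show "(\<lambda>\<omega>. interaction (G \<omega>) u (nb u ! j) z y + b j \<omega> y) \<in> borel_measurable M"
      using interaction_measurable[OF rn u nth_mem[OF j] z y] by (rule borel_measurable_ereal_add[rotated])
  qed simp
  have "(\<lambda>\<omega>. node_pot (G \<omega>) u x - node_pot (G \<omega>) u 0 +
     (\<Sum>j<length (nb u). Max ((\<lambda>y. interaction (G \<omega>) u (nb u ! j) x y + b j \<omega> y) ` {..<T}) -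
        Max ((\<lambda>y. interaction (G \<omega>) u (nb u ! j) 0 y + b j \<omega> y) ` {..<T}))) \<in> borel_measurable M"
    by (intro borel_measurable_ereal_add borel_measurable_ereal_diff borel_measurable_ereal_sum M D(7) u x T)
       auto
  then show ?case
    by (rule measurable_cong[THEN iffD1, rotated])
       (simp add: CE_simps partial_cavity_def D(5,6) b_def)
qed

lemma cavity_measurable:
  assumes rn: "random_wf_network M V E nb T G" and v: "v \<in> V" and a: "a < T"
  shows "(\<lambda>\<omega>. cavity (G \<omega>) v a) \<in> borel_measurable M"
proof -
  note D = random_wf_networkD[OF rn] and R = random_graph[OF rn]
  have J: "(\<lambda>\<omega>. J_val (G \<omega>) v b) \<in> borel_measurable M" for b
  proof -
    let ?S = "{z \<in> \<Pi>\<^sub>E v\<in>V. {..<T}. z v = b}"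
    have "(\<lambda>\<omega>. Max ((\<lambda>z. (\<Sum>(u, w)\<in>E. edge_pot (G \<omega>) (u, w) (z u) (z w)) +
        (\<Sum>w\<in>V. node_pot (G \<omega>) w (z w))) ` ?S)) \<in> borel_measurable M"
    proof (rule borel_measurable_Max)
      show "finite ?S" using finite_PiE[of V "\<lambda>_. {..<T}"] R(1) by simp
      fix z assume "z \<in> ?S"
      then have z: "z w < T" if "w \<in> V" for w using that by (auto simp: PiE_iff)
      show "(\<lambda>\<omega>. (\<Sum>(u, w)\<in>E. edge_pot (G \<omega>) (u, w) (z u) (z w)) +
        (\<Sum>w\<in>V. node_pot (G \<omega>) w (z w))) \<in> borel_measurable M"
        unfolding case_prod_beta
        using R(2) by (intro borel_measurable_ereal_add borel_measurable_ereal_sum D(7,8) z) auto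
    qed
    then show ?thesis
      by (rule measurable_cong[THEN iffD1, rotated])
         (simp add: J_val_def objective_def[abs_def] solutions_def D)
  qed
  show ?thesis unfolding cavity_def by (intro borel_measurable_ereal_diff J)
qed

lemma cavity_AE_finite:
  assumes rn: "random_wf_network M V E nb T G" and v: "v \<in> V" and a: "a < T"
  shows "AE \<omega> in M. is_real (cavity (G \<omega>) v a)"
  using random_wf_networkD(9)[OF rn]
  by (rule AE_mp) (use random_wf_networkD[OF rn] v a in \<open>auto intro!: AE_I2 finite_cavity\<close>)

text \<open>
  Every leaf call has a deterministic position in the graph and a network obtained from \<open>G\<close> by
  repeated formation of subnetworks; so its cavity is a measurable and almost surely finite
  function.
\<close>

lemma true_boundary_condition:
  assumes "random_wf_network M V E nb T G" "u \<in> V" "x < T"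
  shows "boundary_condition M G u r x (\<lambda>_. cavity)"
proof -
  have "(\<lambda>\<omega>. case call_args (G \<omega>) u x p of (N, v, y) \<Rightarrow> cavity N v y) \<in> borel_measurable M \<and>
        (AE \<omega> in M. is_real (case call_args (G \<omega>) u x p of (N, v, y) \<Rightarrow> cavity N v y))"
    if "\<omega>0 \<in> space M" "p \<in> leaf_calls (G \<omega>0) u r x" for \<omega>0 p
    using assms that
  proof (induction r arbitrary: V E nb G u x p)
    case 0
    then show ?case using cavity_measurable cavity_AE_finite by auto
  next
    case (Suc r)
    note rn = Suc.prems(1) and u = Suc.prems(2) and x = Suc.prems(3)
    note D = random_wf_networkD[OF rn]
    from Suc.prems(5) obtain j y p' where p: "p = (j, y) # p'" and j: "j < length (nb u)" and y: "y < T"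
      and p': "p' \<in> leaf_calls (subnetwork (G \<omega>0) u j x) (nb u ! j) r y"
      using D(5,6)[OF Suc.prems(4)] by auto
    have v: "nb u ! j \<in> V - {u}" using random_graph(6)[OF rn u] nth_mem[OF j] by auto
    note IH = Suc.IH[OF random_subnetwork[OF rn u x] v y Suc.prems(4) p']
    have eq: "call_args (G \<omega>) u x p = call_args (subnetwork (G \<omega>) u j x) (nb u ! j) y p'"
      if "\<omega> \<in> space M" for \<omega>
      using D(5)[OF that] by (simp add: p)
    show ?case
    proof
      show "(\<lambda>\<omega>. case call_args (G \<omega>) u x p of (N, v, y) \<Rightarrow> cavity N v y) \<in> borel_measurable M"
        by (rule measurable_cong[THEN iffD1, OF _ conjunct1[OF IH]]) (simp add: eq)
      show "AE \<omega> in M. is_real (case call_args (G \<omega>) u x p of (N, v, y) \<Rightarrow> cavity N v y)"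
        using conjunct2[OF IH] by (rule AE_mp) (auto intro!: AE_I2 simp: eq)
    qed
  qed
  then show ?thesis unfolding boundary_condition_def Let_def is_real_def by blast
qed

lemma zero_boundary_condition: "boundary_condition M G u r x (\<lambda>_ _ _ _. 0)"
  unfolding boundary_condition_def Let_def by (auto simp: case_prod_beta)

text \<open>
  Correlation decay compares the zero boundary condition, which defines \<^const>\<open>CE\<close>, with the true one,
  for which the expansion returns the cavity.
\<close>

lemma CE_error:
  assumes rn: "random_wf_network M V E nb T G" and decay: "exp_correlation_decay M V T G \<alpha> K"
    and "1 \<le> r" and u: "u \<in> V" and x: "x < T"
  shows "(\<integral>\<^sup>+\<omega>. e2ennreal \<bar>CE (G \<omega>) u r x - cavity (G \<omega>) u x\<bar> \<partial>M) \<le> ennreal (K * \<alpha> ^ r)"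
proof -
  note D = random_wf_networkD[OF rn]
  have "(\<integral>\<^sup>+\<omega>. e2ennreal \<bar>CE (G \<omega>) u r x - cavity (G \<omega>) u x\<bar> \<partial>M) =
     (\<integral>\<^sup>+\<omega>. e2ennreal \<bar>CE_bdry (\<lambda>_ _ _ _. 0) (G \<omega>) u r x - CE_bdry (\<lambda>_. cavity) (G \<omega>) u r x\<bar> \<partial>M)"
    by (rule nn_integral_cong_AE, rule AE_mp[OF D(9)])
       (use D u x in \<open>auto intro!: AE_I2 simp: CE_def CE_true_boundary\<close>)
  also have "\<dots> \<le> ennreal (K * \<alpha> ^ r)"
    using decay true_boundary_condition[OF rn u x] zero_boundary_condition[of M G u r x] assms(3) u x
    unfolding exp_correlation_decay_def by blast
  finally show ?thesis .
qed

lemma density_interval: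
  assumes "density_bounded_by M X g" "0 \<le> d" "0 \<le> g"
  shows "emeasure M {\<omega>\<in>space M. \<bar>real_of_ereal (X \<omega>)\<bar> \<le> d} \<le> ennreal (2 * d * g)"
    and "{\<omega>\<in>space M. \<bar>real_of_ereal (X \<omega>)\<bar> \<le> d} \<in> sets M"
proof -
  from assms(1) obtain f where f: "distributed M lborel (\<lambda>\<omega>. real_of_ereal (X \<omega>)) f" "\<And>t. f t \<le> ennreal g"
    unfolding density_bounded_by_def by blast
  note [measurable] = distributed_measurable[OF f(1)] distributed_borel_measurable[OF f(1)]
  have eq: "{\<omega>\<in>space M. \<bar>real_of_ereal (X \<omega>)\<bar> \<le> d} = (\<lambda>\<omega>. real_of_ereal (X \<omega>)) -` {-d..d} \<inter> space M"
    by (auto simp: abs_le_iff simp del: abs_real_of_ereal)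
  show "{\<omega>\<in>space M. \<bar>real_of_ereal (X \<omega>)\<bar> \<le> d} \<in> sets M"
    unfolding eq by (rule measurable_sets[OF distributed_measurable[OF f(1)]]) simp
  have "emeasure M {\<omega>\<in>space M. \<bar>real_of_ereal (X \<omega>)\<bar> \<le> d} =
      emeasure (distr M lborel (\<lambda>\<omega>. real_of_ereal (X \<omega>))) {-d..d}"
    unfolding eq by (subst emeasure_distr) (use distributed_measurable[OF f(1)] in auto)
  also have "\<dots> = (\<integral>\<^sup>+t. f t * indicator {-d..d} t \<partial>lborel)"
    unfolding distributed_distr_eq_density[OF f(1)] by (subst emeasure_density) auto
  also have "\<dots> \<le> (\<integral>\<^sup>+t. ennreal g * indicator {-d..d} t \<partial>lborel)"
    using f(2) by (intro nn_integral_mono mult_right_mono) auto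
  also have "\<dots> = ennreal g * emeasure lborel {-d..d}"
    by (subst nn_integral_cmult_indicator) auto
  also have "\<dots> = ennreal (2 * d * g)"
    using assms(2,3) by (simp add: ennreal_mult[symmetric] mult.commute)
  finally show "emeasure M {\<omega>\<in>space M. \<bar>real_of_ereal (X \<omega>)\<bar> \<le> d} \<le> ennreal (2 * d * g)" .
qed

section \<open>Optimal solutions and wrong decisions\<close>

lemma Markov_ennreal:
  assumes f: "f \<in> borel_measurable M" and "0 < \<epsilon>"
  shows "emeasure M {\<omega>\<in>space M. ennreal \<epsilon> \<le> f \<omega>} \<le> ennreal (1 / \<epsilon>) * (\<integral>\<^sup>+\<omega>. f \<omega> \<partial>M)"
proof -
  have "{\<omega>\<in>space M. ennreal \<epsilon> \<le> f \<omega>} \<subseteq> {\<omega>\<in>space M. 1 \<le> ennreal (1 / \<epsilon>) * f \<omega>}"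
  proof safe
    fix \<omega> assume "ennreal \<epsilon> \<le> f \<omega>"
    then have "ennreal (1 / \<epsilon>) * ennreal \<epsilon> \<le> ennreal (1 / \<epsilon>) * f \<omega>" by (rule mult_left_mono) simp
    then show "1 \<le> ennreal (1 / \<epsilon>) * f \<omega>" using assms(2) by (simp flip: ennreal_mult)
  qed
  then have "emeasure M {\<omega>\<in>space M. ennreal \<epsilon> \<le> f \<omega>} \<le> emeasure M {\<omega>\<in>space M. 1 \<le> ennreal (1 / \<epsilon>) * f \<omega>}"
    using f by (intro emeasure_mono) measurable
  also have "\<dots> \<le> ennreal (1 / \<epsilon>) * (\<integral>\<^sup>+\<omega>. f \<omega> * indicator (space M) \<omega> \<partial>M)"
    using f by (intro nn_integral_Markov_inequality) auto
  also have "(\<integral>\<^sup>+\<omega>. f \<omega> * indicator (space M) \<omega> \<partial>M) = (\<integral>\<^sup>+\<omega>. f \<omega> \<partial>M)"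
    by (intro nn_integral_cong) auto
  finally show ?thesis .
qed

lemma e2ennreal_square: "e2ennreal (\<bar>ereal a\<bar> ^ 2) = ennreal (a\<^sup>2)"
  by (simp add: ennreal.abs_eq[symmetric] e2ennreal_ereal)

definition edge_square :: "'v network \<Rightarrow> 'v \<times> 'v \<Rightarrow> ennreal" where
  "edge_square G e = (\<Sum>x<acts G. \<Sum>y<acts G. e2ennreal (\<bar>edge_pot G e x y\<bar> ^ 2))"

definition node_square :: "'v network \<Rightarrow> 'v \<Rightarrow> ennreal" where
  "node_square G v = (\<Sum>x<acts G. e2ennreal (\<bar>node_pot G v x\<bar> ^ 2))"

lemma ereal_power2_measurable:
  fixes f :: "'a \<Rightarrow> ereal"
  shows "f \<in> borel_measurable M \<Longrightarrow> (\<lambda>\<omega>. e2ennreal (\<bar>f \<omega>\<bar> ^ 2)) \<in> borel_measurable M"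
  unfolding power2_eq_square
  by (intro measurable_compose[OF _ measurable_e2ennreal] borel_measurable_ereal_times borel_measurable_ereal_abs)

lemma finite_if_square_finite: "e2ennreal (\<bar>a\<bar> ^ 2) \<noteq> \<infinity> \<Longrightarrow> is_real a"
  by (cases a) (auto simp: is_real_def power2_eq_square)

lemma random_network_wf:
  assumes network: "random_decision_network M V E nb T G"
    and moments: "second_moments_bounded M V E T G K"
  shows "random_wf_network M V E nb T G"
proof -
  have P: "prob_space M" and S: "\<forall>\<omega>\<in>space M. decision_network (G \<omega>) \<and>
        nodes (G \<omega>) = V \<and> edges (G \<omega>) = E \<and> nbrs (G \<omega>) = nb \<and> acts (G \<omega>) = T"
    and Mv: "\<And>v x. v \<in> V \<Longrightarrow> x < T \<Longrightarrow> (\<lambda>\<omega>. node_pot (G \<omega>) v x) \<in> borel_measurable M"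
    and Me: "\<And>e x y. e \<in> E \<Longrightarrow> x < T \<Longrightarrow> y < T \<Longrightarrow> (\<lambda>\<omega>. edge_pot (G \<omega>) e x y) \<in> borel_measurable M"
    using network unfolding random_decision_network_def by auto
  interpret prob_space M by (rule P)
  obtain \<omega>0 where \<omega>0: "\<omega>0 \<in> space M" using not_empty by auto
  have finE: "finite E"
    using wf_networkD(3)[OF decision_network_wf] S \<omega>0 by metis
  have ae: "AE \<omega> in M. is_real (edge_pot (G \<omega>) e x y)" if e: "e \<in> E" and x: "x < T" and y: "y < T" for e x y
  proof -
    let ?I = "\<lambda>x y. \<integral>\<^sup>+\<omega>. e2ennreal (\<bar>edge_pot (G \<omega>) e x y\<bar> ^ 2) \<partial>M"
    have "?I x y \<le> (\<Sum>y<T. ?I x y)" using y by (intro member_le_sum) auto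
    also have "\<dots> \<le> (\<Sum>x<T. \<Sum>y<T. ?I x y)"
      using x by (intro member_le_sum[of x _ "\<lambda>x. \<Sum>y<T. ?I x y"]) (auto simp: sum_nonneg)
    also have "\<dots> < \<infinity>" using moments e unfolding second_moments_bounded_def Let_def by blast
    finally have "AE \<omega> in M. e2ennreal (\<bar>edge_pot (G \<omega>) e x y\<bar> ^ 2) \<noteq> \<infinity>"
      using ereal_power2_measurable[OF Me[OF e x y]] by (intro nn_integral_PInf_AE) auto
    then show ?thesis by (rule AE_mp) (auto intro!: AE_I2 finite_if_square_finite)
  qed
  have "AE \<omega> in M. \<forall>e\<in>E. \<forall>x\<in>{..<T}. \<forall>y\<in>{..<T}. is_real (edge_pot (G \<omega>) e x y)"
    using ae finE by (simp add: AE_ball_countable countable_finite)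
  then have "AE \<omega> in M. finite_potentials (G \<omega>)"
    by (rule AE_mp) (use S in \<open>auto intro!: AE_I2 simp: finite_potentials_def decision_network_def is_real_def\<close>)
  then show ?thesis
    unfolding random_wf_network_def using S Mv Me not_empty by (auto simp: decision_network_wf)
qed

lemma second_moments:
  assumes network: "random_decision_network M V E nb T G" and K: "0 < K"
    and moments: "second_moments_bounded M V E T G K"
  shows "e \<in> E \<Longrightarrow> (\<lambda>\<omega>. edge_square (G \<omega>) e) \<in> borel_measurable M"
    "e \<in> E \<Longrightarrow> (\<integral>\<^sup>+\<omega>. edge_square (G \<omega>) e \<partial>M) \<le> ennreal (K\<^sup>2)"
    "v \<in> V \<Longrightarrow> (\<lambda>\<omega>. node_square (G \<omega>) v) \<in> borel_measurable M"
    "v \<in> V \<Longrightarrow> (\<integral>\<^sup>+\<omega>. node_square (G \<omega>) v \<partial>M) \<le> ennreal (K\<^sup>2)"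
proof -
  note D = random_wf_networkD[OF random_network_wf[OF network moments]]
  have bound: "S \<le> ennreal (K\<^sup>2)" if "S < \<infinity>" "sqrt (enn2real S) \<le> K" for S :: ennreal
  proof -
    have "(sqrt (enn2real S))\<^sup>2 \<le> K\<^sup>2" using that(2) by (intro power_mono) auto
    then have "enn2real S \<le> K\<^sup>2" by simp
    have "S = ennreal (enn2real S)" using that(1) by simp
    also have "\<dots> \<le> ennreal (K\<^sup>2)" by (rule ennreal_leI) fact
    finally show ?thesis .
  qed
  have Me: "(\<lambda>\<omega>. e2ennreal (\<bar>edge_pot (G \<omega>) e x y\<bar> ^ 2)) \<in> borel_measurable M"
    if "e \<in> E" "x < T" "y < T" for e x y
    by (rule ereal_power2_measurable[OF D(8)[OF that]])
  have Mv: "(\<lambda>\<omega>. e2ennreal (\<bar>node_pot (G \<omega>) v x\<bar> ^ 2)) \<in> borel_measurable M"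
    if "v \<in> V" "x < T" for v x
    by (rule ereal_power2_measurable[OF D(7)[OF that]])
  show "(\<lambda>\<omega>. edge_square (G \<omega>) e) \<in> borel_measurable M" if e: "e \<in> E"
  proof -
    have "(\<lambda>\<omega>. \<Sum>x<T. \<Sum>y<T. e2ennreal (\<bar>edge_pot (G \<omega>) e x y\<bar> ^ 2)) \<in> borel_measurable M"
      using Me[OF e] by (intro borel_measurable_sum) auto
    then show ?thesis
      by (rule measurable_cong[THEN iffD1, rotated]) (simp add: edge_square_def D(6))
  qed
  show "(\<lambda>\<omega>. node_square (G \<omega>) v) \<in> borel_measurable M" if v: "v \<in> V"
  proof -
    have "(\<lambda>\<omega>. \<Sum>x<T. e2ennreal (\<bar>node_pot (G \<omega>) v x\<bar> ^ 2)) \<in> borel_measurable M"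
      using Mv[OF v] by (intro borel_measurable_sum) auto
    then show ?thesis
      by (rule measurable_cong[THEN iffD1, rotated]) (simp add: node_square_def D(6))
  qed
  show "(\<integral>\<^sup>+\<omega>. edge_square (G \<omega>) e \<partial>M) \<le> ennreal (K\<^sup>2)" if e: "e \<in> E"
  proof -
    have "(\<integral>\<^sup>+\<omega>. edge_square (G \<omega>) e \<partial>M) = (\<integral>\<^sup>+\<omega>. (\<Sum>x<T. \<Sum>y<T. e2ennreal (\<bar>edge_pot (G \<omega>) e x y\<bar> ^ 2)) \<partial>M)"
      by (rule nn_integral_cong) (simp add: edge_square_def D(6))
    also have "\<dots> = (\<Sum>x<T. \<integral>\<^sup>+\<omega>. (\<Sum>y<T. e2ennreal (\<bar>edge_pot (G \<omega>) e x y\<bar> ^ 2)) \<partial>M)"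
      using Me[OF e] by (intro nn_integral_sum borel_measurable_sum) auto
    also have "\<dots> = (\<Sum>x<T. \<Sum>y<T. \<integral>\<^sup>+\<omega>. e2ennreal (\<bar>edge_pot (G \<omega>) e x y\<bar> ^ 2) \<partial>M)"
      using Me[OF e] by (intro sum.cong nn_integral_sum) auto
    also have "\<dots> \<le> ennreal (K\<^sup>2)"
      using moments e unfolding second_moments_bounded_def Let_def by (intro bound) auto
    finally show ?thesis .
  qed
  show "(\<integral>\<^sup>+\<omega>. node_square (G \<omega>) v \<partial>M) \<le> ennreal (K\<^sup>2)" if v: "v \<in> V"
  proof -
    have "(\<integral>\<^sup>+\<omega>. node_square (G \<omega>) v \<partial>M) = (\<integral>\<^sup>+\<omega>. (\<Sum>x<T. e2ennreal (\<bar>node_pot (G \<omega>) v x\<bar> ^ 2)) \<partial>M)"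
      by (rule nn_integral_cong) (simp add: node_square_def D(6))
    also have "\<dots> = (\<Sum>x<T. \<integral>\<^sup>+\<omega>. e2ennreal (\<bar>node_pot (G \<omega>) v x\<bar> ^ 2) \<partial>M)"
      using Mv[OF v] by (intro nn_integral_sum) auto
    also have "\<dots> \<le> ennreal (K\<^sup>2)"
      using moments v unfolding second_moments_bounded_def Let_def by (intro bound) auto
    finally show ?thesis .
  qed
qed

lemma optimal_J_val:
  assumes wf: "wf_network G" and opt: "optimal_solution G x" and v: "v \<in> nodes G" and b: "b < acts G"
  shows "J_val G v (x v) = objective G x" "J_val G v b \<le> objective G x"
proof -
  have fin: "finite (solutions G)" by (rule finite_solutions[OF wf])
  have x: "x \<in> solutions G" "\<And>z. z \<in> solutions G \<Longrightarrow> objective G z \<le> objective G x"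
    using opt by (auto simp: optimal_solution_def)
  show "J_val G v (x v) = objective G x"
    unfolding J_val_def using fin x by (intro Max_eqI) auto
  show "J_val G v b \<le> objective G x"
    unfolding J_val_def using J_val_set[OF wf v b] x by (intro Max.boundedI) auto
qed

lemma optimal_cavity:
  assumes "wf_network G" "optimal_solution G x" "v \<in> nodes G" "b < acts G"
  shows "cavity G v b \<le> cavity G v (x v)"
  using optimal_J_val[OF assms] unfolding cavity_def by (intro ereal_minus_mono) auto

lemma optimal_solution_exists:
  assumes wf: "wf_network G"
  shows "\<exists>x. optimal_solution G x"
proof -
  have "finite (objective G ` solutions G)" "objective G ` solutions G \<noteq> {}"
    using finite_solutions[OF wf] solution_with_value[OF wf wf_networkD(4)[OF wf]] by auto
  from Max_in[OF this] obtain x where "x \<in> solutions G" "objective G x = Max (objective G ` solutions G)"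
    by auto
  then show ?thesis
    using finite_solutions[OF wf] by (intro exI[of _ x]) (auto simp: optimal_solution_def)
qed

text \<open>
  Two optimal solutions that differ at \<open>v\<close> attain the global maximum with two different actions at
  \<open>v\<close>, which forces a tie of cavities.
\<close>

lemma optimal_solution_unique:
  assumes wf: "wf_network G" and opt: "optimal_solution G x" "optimal_solution G z" and "x \<noteq> z"
  shows "\<exists>v\<in>nodes G. \<exists>a<acts G. \<exists>b<acts G. a \<noteq> b \<and> cavity G v a = cavity G v b"
proof -
  have mem: "x \<in> solutions G" "z \<in> solutions G" and eq: "objective G x = objective G z"
    using opt by (auto simp: optimal_solution_def intro: antisym)
  then obtain v where v: "v \<in> nodes G" "x v \<noteq> z v"
    using \<open>x \<noteq> z\<close> unfolding solutions_def by (metis PiE_ext)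
  have lt: "x v < acts G" "z v < acts G" using mem v(1) by (auto simp: solutions_def)
  have "cavity G v (x v) = cavity G v (z v)"
    using optimal_J_val(1)[OF wf opt(1) v(1) lt(1)] optimal_J_val(1)[OF wf opt(2) v(1) lt(2)] eq
    unfolding cavity_def by simp
  then show ?thesis using v lt by blast
qed

text \<open>
  A tie of cavities has probability \<open>0\<close> because their difference has a density.
\<close>

lemma unique_optimum_AE:
  assumes rn: "random_wf_network M V E nb T G" and g: "0 < g" and dens: "cavity_densities_bounded M V T G g"
  shows "AE \<omega> in M. \<exists>!x. optimal_solution (G \<omega>) x"
proof -
  note D = random_wf_networkD[OF rn]
  have ae: "AE \<omega> in M. cavity (G \<omega>) v a \<noteq> cavity (G \<omega>) v b"
    if v: "v \<in> V" and a: "a < T" and b: "b < T" and "a \<noteq> b" for v a b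
  proof -
    let ?X = "\<lambda>\<omega>. cavity (G \<omega>) v a - cavity (G \<omega>) v b"
    have X: "density_bounded_by M ?X g"
      using dens that unfolding cavity_densities_bounded_def by blast
    have "emeasure M {\<omega>\<in>space M. \<bar>real_of_ereal (?X \<omega>)\<bar> \<le> 0} = 0"
      using density_interval(1)[OF X, of 0] g by simp
    then have "AE \<omega> in M. \<not> \<bar>real_of_ereal (?X \<omega>)\<bar> \<le> 0"
      using density_interval(2)[OF X, of 0] g by (subst AE_iff_measurable) auto
    then show ?thesis
      using cavity_AE_finite[OF rn v a]
    proof eventually_elim
      case (elim \<omega>)
      then obtain c where c: "cavity (G \<omega>) v a = ereal c" by (cases "cavity (G \<omega>) v a") (auto simp: is_real_def)
      show ?case
      proof
        assume eq: "cavity (G \<omega>) v a = cavity (G \<omega>) v b"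
        have "?X \<omega> = 0" unfolding eq[symmetric] c by simp
        with elim(1) show False by simp
      qed
    qed
  qed
  have ae': "AE \<omega> in M. a \<noteq> b \<longrightarrow> cavity (G \<omega>) v a \<noteq> cavity (G \<omega>) v b"
    if "v \<in> V" "a \<in> {..<T}" "b \<in> {..<T}" for v a b
    using ae[of v a b] that by (cases "a = b") auto
  have "AE \<omega> in M. \<forall>v\<in>V. \<forall>a\<in>{..<T}. \<forall>b\<in>{..<T}. a \<noteq> b \<longrightarrow> cavity (G \<omega>) v a \<noteq> cavity (G \<omega>) v b"
    using ae' random_graph(1)[OF rn] by (simp add: AE_ball_countable countable_finite)
  then show ?thesis
  proof (rule AE_mp, intro AE_I2 impI)
    fix \<omega> assume \<omega>: "\<omega> \<in> space M"
      and ne: "\<forall>v\<in>V. \<forall>a\<in>{..<T}. \<forall>b\<in>{..<T}. a \<noteq> b \<longrightarrow> cavity (G \<omega>) v a \<noteq> cavity (G \<omega>) v b"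
    show "\<exists>!x. optimal_solution (G \<omega>) x"
      using optimal_solution_exists[OF D(2)[OF \<omega>]] optimal_solution_unique[OF D(2)[OF \<omega>]] ne
      unfolding D(3)[OF \<omega>] D(6)[OF \<omega>] by (metis lessThan_iff)
  qed
qed

text \<open>
  The event that the comparison of expansions at \<open>v\<close> cannot be trusted: two cavities are closer
  than \<open>2 \<delta>\<close>, or some expansion misses its cavity by \<open>\<delta>\<close> or more.
\<close>

definition ambiguous ::
  "'w measure \<Rightarrow> ('w \<Rightarrow> 'v network) \<Rightarrow> nat \<Rightarrow> nat \<Rightarrow> real \<Rightarrow> 'v \<Rightarrow> 'w set" where
  "ambiguous M G T r \<delta> v =
     (\<Union>(a, b)\<in>{(a, b) \<in> {..<T} \<times> {..<T}. a \<noteq> b}.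
        {\<omega>\<in>space M. \<bar>real_of_ereal (cavity (G \<omega>) v a - cavity (G \<omega>) v b)\<bar> \<le> 2 * \<delta>}) \<union>
     (\<Union>a\<in>{..<T}. {\<omega>\<in>space M. ennreal \<delta> \<le> e2ennreal \<bar>CE (G \<omega>) v r a - cavity (G \<omega>) v a\<bar>})"

text \<open>
  Union bound over the at most \<open>T\<^sup>2\<close> pairs of actions, with the density bound on an interval of
  length \<open>4 \<delta>\<close>, and over the \<open>T\<close> actions, with Markov's inequality for the error.
\<close>

lemma ambiguous_measure:
  assumes rn: "random_wf_network M V E nb T G" and g: "0 < g" and dens: "cavity_densities_bounded M V T G g"
    and decay: "exp_correlation_decay M V T G \<alpha> K" and r: "1 \<le> r" and v: "v \<in> V"
    and pos: "0 < K" "0 < \<alpha>" and \<delta>: "0 < \<delta>"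
  shows "ambiguous M G T r \<delta> v \<in> sets M"
    and "emeasure M (ambiguous M G T r \<delta> v) \<le>
           ennreal ((real T)\<^sup>2 * (4 * \<delta> * g) + real T * (K * \<alpha> ^ r / \<delta>))"
proof -
  let ?P = "{(a, b) \<in> {..<T} \<times> {..<T}. a \<noteq> b}"
  let ?A = "\<lambda>(a, b). {\<omega>\<in>space M. \<bar>real_of_ereal (cavity (G \<omega>) v a - cavity (G \<omega>) v b)\<bar> \<le> 2 * \<delta>}"
  let ?B = "\<lambda>a. {\<omega>\<in>space M. ennreal \<delta> \<le> e2ennreal \<bar>CE (G \<omega>) v r a - cavity (G \<omega>) v a\<bar>}"
  have amb: "ambiguous M G T r \<delta> v = (\<Union>p\<in>?P. ?A p) \<union> (\<Union>a\<in>{..<T}. ?B a)"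
    unfolding ambiguous_def by (simp add: case_prod_unfold)
  have finP: "finite ?P" by (rule finite_subset[of _ "{..<T} \<times> {..<T}"]) auto
  have cardP: "card ?P \<le> T * T"
    using card_mono[of "{..<T} \<times> {..<T}" ?P] by (auto simp: card_cartesian_product)
  have A: "?A p \<in> sets M" "emeasure M (?A p) \<le> ennreal (4 * \<delta> * g)" if "p \<in> ?P" for p
  proof -
    obtain a b where p: "p = (a, b)" "a < T" "b < T" "a \<noteq> b" using \<open>p \<in> ?P\<close> by auto
    have X: "density_bounded_by M (\<lambda>\<omega>. cavity (G \<omega>) v a - cavity (G \<omega>) v b) g"
      using dens v p unfolding cavity_densities_bounded_def by blast
    from density_interval[OF X, of "2 * \<delta>"] \<delta> g
    show "?A p \<in> sets M" "emeasure M (?A p) \<le> ennreal (4 * \<delta> * g)" by (auto simp: p(1))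
  qed
  have B: "?B a \<in> sets M" "emeasure M (?B a) \<le> ennreal (K * \<alpha> ^ r / \<delta>)" if "a \<in> {..<T}" for a
  proof -
    have a: "a < T" using that by simp
    have m: "(\<lambda>\<omega>. e2ennreal \<bar>CE (G \<omega>) v r a - cavity (G \<omega>) v a\<bar>) \<in> borel_measurable M"
      by (intro measurable_compose[OF _ measurable_e2ennreal] borel_measurable_ereal_abs
        borel_measurable_ereal_diff CE_measurable[OF rn v a] cavity_measurable[OF rn v a])
    then show "?B a \<in> sets M" by measurable
    have "emeasure M (?B a) \<le> ennreal (1 / \<delta>) * (\<integral>\<^sup>+\<omega>. e2ennreal \<bar>CE (G \<omega>) v r a - cavity (G \<omega>) v a\<bar> \<partial>M)"
      by (rule Markov_ennreal[OF m \<delta>])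
    also have "\<dots> \<le> ennreal (1 / \<delta>) * ennreal (K * \<alpha> ^ r)"
      by (intro mult_left_mono CE_error[OF rn decay r v a]) simp
    also have "\<dots> = ennreal (K * \<alpha> ^ r / \<delta>)"
      using \<delta> pos by (simp add: ennreal_mult[symmetric])
    finally show "emeasure M (?B a) \<le> ennreal (K * \<alpha> ^ r / \<delta>)" .
  qed
  have UA: "(\<Union>p\<in>?P. ?A p) \<in> sets M" using A(1) finP by (intro sets.finite_UN) auto
  have UB: "(\<Union>a\<in>{..<T}. ?B a) \<in> sets M" using B(1) by (intro sets.finite_UN) auto
  show "ambiguous M G T r \<delta> v \<in> sets M" unfolding amb using UA UB by (rule sets.Un)
  have "emeasure M (\<Union>p\<in>?P. ?A p) \<le> (\<Sum>p\<in>?P. emeasure M (?A p))"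
    using A(1) finP by (intro emeasure_subadditive_finite) auto
  also have "\<dots> \<le> (\<Sum>p\<in>?P. ennreal (4 * \<delta> * g))" by (rule sum_mono[OF A(2)])
  also have "\<dots> = ennreal (real (card ?P) * (4 * \<delta> * g))"
    using \<delta> g by (simp add: ennreal_of_nat_eq_real_of_nat ennreal_mult)
  also have "\<dots> \<le> ennreal ((real T)\<^sup>2 * (4 * \<delta> * g))"
    using cardP \<delta> g by (intro ennreal_leI mult_right_mono) (auto simp: power2_eq_square simp flip: of_nat_mult)
  finally have 1: "emeasure M (\<Union>p\<in>?P. ?A p) \<le> ennreal ((real T)\<^sup>2 * (4 * \<delta> * g))" .
  have "emeasure M (\<Union>a\<in>{..<T}. ?B a) \<le> (\<Sum>a<T. emeasure M (?B a))"
    using B(1) by (intro emeasure_subadditive_finite) auto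
  also have "\<dots> \<le> (\<Sum>a<T. ennreal (K * \<alpha> ^ r / \<delta>))" by (rule sum_mono[OF B(2)])
  also have "\<dots> = ennreal (real T * (K * \<alpha> ^ r / \<delta>))"
    using \<delta> pos by (simp add: ennreal_of_nat_eq_real_of_nat ennreal_mult[symmetric])
  finally have 2: "emeasure M (\<Union>a\<in>{..<T}. ?B a) \<le> ennreal (real T * (K * \<alpha> ^ r / \<delta>))" .
  have "emeasure M (ambiguous M G T r \<delta> v) \<le> emeasure M (\<Union>p\<in>?P. ?A p) + emeasure M (\<Union>a\<in>{..<T}. ?B a)"
    unfolding amb using UA UB by (rule emeasure_subadditive)
  also have "\<dots> \<le> ennreal ((real T)\<^sup>2 * (4 * \<delta> * g)) + ennreal (real T * (K * \<alpha> ^ r / \<delta>))"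
    by (rule add_mono[OF 1 2])
  also have "\<dots> = ennreal ((real T)\<^sup>2 * (4 * \<delta> * g) + real T * (K * \<alpha> ^ r / \<delta>))"
    using \<delta> g pos by (intro ennreal_plus[symmetric]) auto
  finally show "emeasure M (ambiguous M G T r \<delta> v) \<le>
           ennreal ((real T)\<^sup>2 * (4 * \<delta> * g) + real T * (K * \<alpha> ^ r / \<delta>))" .
qed

lemma not_ambiguous:
  assumes rn: "random_wf_network M V E nb T G" and \<omega>: "\<omega> \<in> space M" and fin: "finite_potentials (G \<omega>)"
    and v: "v \<in> V" and namb: "\<omega> \<notin> ambiguous M G T r \<delta> v" and \<delta>: "0 < \<delta>"
    and opt: "optimal_solution (G \<omega>) x" and ce: "CE_argmax (G \<omega>) r xr"
  shows "x v = xr v"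
proof (rule ccontr)
  assume ne: "x v \<noteq> xr v"
  note D = random_wf_networkD[OF rn]
  note wf = D(2)[OF \<omega>]
  let ?B = "cavity (G \<omega>) v" and ?C = "CE (G \<omega>) v r"
  have lt: "x v < T" "xr v < T"
    using opt ce v D(3,6)[OF \<omega>] by (auto simp: optimal_solution_def solutions_def CE_argmax_def)
  have real: "\<bar>?B a\<bar> \<noteq> \<infinity>" if "a < T" for a
    using finite_cavity[OF wf fin, of v a] v that D(3,6)[OF \<omega>] by (simp add: is_real_def)
  obtain p q where pq: "?B (x v) = ereal p" "?B (xr v) = ereal q"
    using real[OF lt(1)] real[OF lt(2)] by auto
  have "q \<le> p"
    using optimal_cavity[OF wf opt, of v "xr v"] lt v D(3,6)[OF \<omega>] pq by simp
  moreover have "\<not> \<bar>p - q\<bar> \<le> 2 * \<delta>"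
    using namb ne lt \<omega> pq unfolding ambiguous_def by force
  ultimately have gap: "p - q > 2 * \<delta>" by simp
  have close: "\<exists>c. ?C a = ereal c \<and> \<bar>c - b\<bar> < \<delta>" if a: "a < T" and b: "?B a = ereal b" for a b
  proof -
    have "e2ennreal \<bar>?C a - ?B a\<bar> < ennreal \<delta>"
      using namb a \<omega> unfolding ambiguous_def by (auto simp: not_le)
    then show ?thesis
      using b \<delta> by (cases "?C a") (auto simp: e2ennreal_ereal ennreal_less_iff)
  qed
  obtain c where c: "?C (x v) = ereal c" "\<bar>c - p\<bar> < \<delta>" using close[OF lt(1) pq(1)] by auto
  obtain c' where c': "?C (xr v) = ereal c'" "\<bar>c' - q\<bar> < \<delta>" using close[OF lt(2) pq(2)] by auto
  have "?C (x v) \<le> ?C (xr v)"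
    using ce v lt D(3,6)[OF \<omega>] by (auto simp: CE_argmax_def)
  then show False using c c' gap by simp
qed

section \<open>The loss caused by wrong decisions\<close>

text \<open>
  Young's inequality \<open>2 |a| \<le> l + a\<^sup>2 / l\<close>, applied to both values.  Taking expectations over an event
  and optimising \<open>l\<close> afterwards reproduces the Cauchy-Schwarz inequality.
\<close>

lemma gap_le_square_sum:
  fixes f :: "'a \<Rightarrow> real"
  assumes "finite I" "i \<in> I" "j \<in> I" and l: "0 < l"
  shows "f i - f j \<le> l + 1 / l * (\<Sum>k\<in>I. (f k)\<^sup>2)"
proof -
  have young: "2 * \<bar>f k\<bar> \<le> l + 1 / l * (\<Sum>k\<in>I. (f k)\<^sup>2)" if "k \<in> I" for k
  proof -
    have "0 \<le> (\<bar>f k\<bar> - l)\<^sup>2" by simp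
    then have "2 * \<bar>f k\<bar> * l \<le> l * l + (f k)\<^sup>2" by (simp add: power2_eq_square algebra_simps)
    also have "(f k)\<^sup>2 \<le> (\<Sum>k\<in>I. (f k)\<^sup>2)" using assms(1) that by (intro member_le_sum) auto
    finally show ?thesis using l by (simp add: field_simps)
  qed
  from young[OF assms(2)] young[OF assms(3)] show ?thesis by linarith
qed

lemma ennreal_combination:
  "0 \<le> a \<Longrightarrow> 0 \<le> b \<Longrightarrow> 0 \<le> c \<Longrightarrow> 0 \<le> d \<Longrightarrow>
     ennreal (a * b + c * d) = ennreal a * ennreal b + ennreal c * ennreal d"
  by (subst ennreal_plus) (auto intro!: ennreal_mult arg_cong2[of _ _ _ _ "(+)"])

text \<open>
  Nodes outside \<open>W\<close> and edges without an end in \<open>W\<close> contribute nothing to the difference; the others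
  are estimated by Young's inequality.  The bound is stated in \<^typ>\<open>ennreal\<close>, where its integral needs
  no integrability argument.
\<close>

lemma objective_gap_le:
  assumes wf: "wf_network G" and fin: "finite_potentials G" and l: "0 < l"
    and x: "\<And>v. v \<in> nodes G \<Longrightarrow> x v < acts G" and z: "\<And>v. v \<in> nodes G \<Longrightarrow> z v < acts G"
    and agree: "\<And>v. v \<in> nodes G \<Longrightarrow> v \<notin> W \<Longrightarrow> x v = z v"
    and gap: "objective G x - objective G z > ereal \<epsilon>"
  shows "ennreal \<epsilon> \<le>
     (\<Sum>e\<in>edges G. ennreal l * (indicator W (fst e) + indicator W (snd e)) + ennreal (1 / l) * edge_square G e) +
     (\<Sum>v\<in>nodes G. ennreal l * indicator W v + ennreal (1 / l) * node_square G v)"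
proof -
  note D = wf_networkD[OF wf]
  define fe where "fe e a b = real_of_ereal (edge_pot G e a b)" for e a b
  define fv where "fv v a = real_of_ereal (node_pot G v a)" for v a
  have fe: "edge_pot G e a b = ereal (fe e a b)" if "e \<in> edges G" "a < acts G" "b < acts G" for e a b
  proof -
    have "is_real (edge_pot G e a b)" using fin that by (simp add: finite_potentials_def)
    then show ?thesis unfolding fe_def is_real_def by (cases "edge_pot G e a b") simp_all
  qed
  have fv: "node_pot G v a = ereal (fv v a)" if "v \<in> nodes G" "a < acts G" for v a
  proof -
    have "is_real (node_pot G v a)" using fin that by (simp add: finite_potentials_def)
    then show ?thesis unfolding fv_def is_real_def by (cases "node_pot G v a") simp_all
  qed
  have ends: "fst e \<in> nodes G" "snd e \<in> nodes G" if "e \<in> edges G" for e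
    using subsetD[OF D(2) that] by (simp_all add: mem_Times_iff)
  have obj: "objective G y = ereal ((\<Sum>e\<in>edges G. fe e (y (fst e)) (y (snd e))) + (\<Sum>v\<in>nodes G. fv v (y v)))"
    if y: "\<And>v. v \<in> nodes G \<Longrightarrow> y v < acts G" for y
  proof -
    have "(\<Sum>(u, v)\<in>edges G. edge_pot G (u, v) (y u) (y v)) = (\<Sum>e\<in>edges G. ereal (fe e (y (fst e)) (y (snd e))))"
      using ends y by (intro sum.cong) (auto simp: fe)
    moreover have "(\<Sum>v\<in>nodes G. node_pot G v (y v)) = (\<Sum>v\<in>nodes G. ereal (fv v (y v)))"
      using y by (intro sum.cong) (auto simp: fv)
    ultimately show ?thesis by (simp add: objective_def)
  qed
  define se where "se e = (\<Sum>a<acts G. \<Sum>b<acts G. (fe e a b)\<^sup>2)" for e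
  define sv where "sv v = (\<Sum>a<acts G. (fv v a)\<^sup>2)" for v
  have se: "edge_square G e = ennreal (se e)" if e: "e \<in> edges G" for e
  proof -
    have "edge_square G e = (\<Sum>a<acts G. \<Sum>b<acts G. ennreal ((fe e a b)\<^sup>2))"
      unfolding edge_square_def by (intro sum.cong refl) (simp only: fe[OF e] lessThan_iff e2ennreal_square)
    then show ?thesis by (simp add: se_def sum_nonneg)
  qed
  have sv: "node_square G v = ennreal (sv v)" if v: "v \<in> nodes G" for v
  proof -
    have "node_square G v = (\<Sum>a<acts G. ennreal ((fv v a)\<^sup>2))"
      unfolding node_square_def by (intro sum.cong refl) (simp only: fv[OF v] lessThan_iff e2ennreal_square)
    then show ?thesis by (simp add: sv_def sum_nonneg)
  qed
  have nn: "0 \<le> se e" "0 \<le> sv v" for e v by (auto simp: se_def sv_def intro!: sum_nonneg)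
  define he where "he e = l * (indicator W (fst e) + indicator W (snd e)) + 1 / l * se e" for e
  define hv where "hv v = l * indicator W v + 1 / l * sv v" for v
  have h_nn: "0 \<le> he e" "0 \<le> hv v" for e v using l nn by (auto simp: he_def hv_def)
  have he: "fe e (x (fst e)) (x (snd e)) - fe e (z (fst e)) (z (snd e)) \<le> he e" if e: "e \<in> edges G" for e
  proof (cases "fst e \<in> W \<or> snd e \<in> W")
    case True
    have "fe e (x (fst e)) (x (snd e)) - fe e (z (fst e)) (z (snd e)) \<le>
        l + 1 / l * (\<Sum>k\<in>{..<acts G} \<times> {..<acts G}. ((\<lambda>(a, b). fe e a b) k)\<^sup>2)"
      using gap_le_square_sum[of "{..<acts G} \<times> {..<acts G}" "(x (fst e), x (snd e))" "(z (fst e), z (snd e))"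
          l "\<lambda>(a, b). fe e a b"] l x z ends[OF e] by simp
    also have "(\<Sum>k\<in>{..<acts G} \<times> {..<acts G}. ((\<lambda>(a, b). fe e a b) k)\<^sup>2) = se e"
      by (simp add: se_def sum.cartesian_product case_prod_unfold)
    also have "l + 1 / l * se e \<le> he e"
      using True l by (auto simp: he_def indicator_def)
    finally show ?thesis .
  next
    case False
    then show ?thesis using agree ends[OF e] h_nn(1)[of e] by simp
  qed
  have hv: "fv v (x v) - fv v (z v) \<le> hv v" if v: "v \<in> nodes G" for v
  proof (cases "v \<in> W")
    case True
    then show ?thesis
      using gap_le_square_sum[of "{..<acts G}" "x v" "z v" l "fv v"] l x[OF v] z[OF v]
      by (simp add: hv_def sv_def)
  next
    case False
    then show ?thesis using agree v h_nn(2)[of v] by simp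
  qed
  have ox: "objective G x = ereal ((\<Sum>e\<in>edges G. fe e (x (fst e)) (x (snd e))) + (\<Sum>v\<in>nodes G. fv v (x v)))"
    by (rule obj) (rule x)
  have oz: "objective G z = ereal ((\<Sum>e\<in>edges G. fe e (z (fst e)) (z (snd e))) + (\<Sum>v\<in>nodes G. fv v (z v)))"
    by (rule obj) (rule z)
  have "\<epsilon> \<le> (\<Sum>e\<in>edges G. fe e (x (fst e)) (x (snd e)) - fe e (z (fst e)) (z (snd e))) +
      (\<Sum>v\<in>nodes G. fv v (x v) - fv v (z v))"
    using gap unfolding ox oz by (simp add: sum_subtractf)
  also have "\<dots> \<le> (\<Sum>e\<in>edges G. he e) + (\<Sum>v\<in>nodes G. hv v)"
    by (intro add_mono sum_mono he hv)
  finally have "ennreal \<epsilon> \<le> ennreal ((\<Sum>e\<in>edges G. he e) + (\<Sum>v\<in>nodes G. hv v))"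
    by (rule ennreal_leI)
  also have "\<dots> = (\<Sum>e\<in>edges G. ennreal (he e)) + (\<Sum>v\<in>nodes G. ennreal (hv v))"
    using h_nn by (simp add: ennreal_plus sum_nonneg)
  also have "(\<Sum>e\<in>edges G. ennreal (he e)) = (\<Sum>e\<in>edges G. ennreal l * (indicator W (fst e) + indicator W (snd e)) +
      ennreal (1 / l) * edge_square G e)"
  proof (rule sum.cong[OF refl])
    fix e assume "e \<in> edges G"
    have "ennreal (he e) = ennreal l * ennreal (indicator W (fst e) + indicator W (snd e)) +
        ennreal (1 / l) * ennreal (se e)"
      unfolding he_def using l nn by (intro ennreal_combination) simp_all
    also have "ennreal (indicator W (fst e) + indicator W (snd e)) = indicator W (fst e) + indicator W (snd e)"
      by (simp add: ennreal_indicator)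
    finally show "ennreal (he e) = ennreal l * (indicator W (fst e) + indicator W (snd e)) + ennreal (1 / l) * edge_square G e"
      unfolding se[OF \<open>e \<in> edges G\<close>] .
  qed
  also have "(\<Sum>v\<in>nodes G. ennreal (hv v)) = (\<Sum>v\<in>nodes G. ennreal l * indicator W v + ennreal (1 / l) * node_square G v)"
  proof (rule sum.cong[OF refl])
    fix v assume "v \<in> nodes G"
    have "ennreal (hv v) = ennreal l * ennreal (indicator W v) + ennreal (1 / l) * ennreal (sv v)"
      unfolding hv_def using l nn by (intro ennreal_combination) simp_all
    then show "ennreal (hv v) = ennreal l * indicator W v + ennreal (1 / l) * node_square G v"
      unfolding sv[OF \<open>v \<in> nodes G\<close>] ennreal_indicator .
  qed
  finally show ?thesis .
qed

text \<open>
  The nested square root is the fourth root \<open>(g K\<^sub>c \<alpha> ^ r) powr (1/4)\<close>, so the left-hand side of the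
  second claim is \<open>K\<^sub>2 \<alpha> powr (r/4)\<close>, and, unless this vanishes, the depth bound says that its logarithm is at
  most \<open>2 ln \<epsilon>\<close>.
\<close>

lemma depth_suffices:
  fixes \<epsilon> :: real
  assumes \<epsilon>: "0 < \<epsilon>" "\<epsilon> < 1" and T: "0 < T" and pos: "0 < g" "0 < K" "0 < K_c" and \<alpha>: "0 < \<alpha>" "\<alpha> < 1"
    and r: "real r \<ge> depth_bound T g K K_c \<alpha> n m \<epsilon>"
  shows "1 \<le> r"
    and "10 * K * real T * real (n + m) * sqrt (sqrt (g * (K_c * \<alpha> ^ r))) \<le> \<epsilon>\<^sup>2"
proof -
  define a where "a = \<bar>ln \<alpha>\<bar>"
  have a: "a > 0" "ln \<alpha> = - a" using \<alpha> by (auto simp: a_def)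
  define K2 where "K2 = 10 * K * real T * real (n + m) * (g * K_c) powr (1 / 4)"
  have "depth_bound T g K K_c \<alpha> n m \<epsilon> = (8 * \<bar>ln \<epsilon>\<bar> + 4 * \<bar>ln K2\<bar>) / a"
    by (simp only: depth_bound_def K2_def a_def Let_def divide_inverse)
  then have r': "8 * \<bar>ln \<epsilon>\<bar> + 4 * \<bar>ln K2\<bar> \<le> real r * a"
    using r a by (simp add: divide_le_eq)
  have ln_eps: "\<bar>ln \<epsilon>\<bar> = - ln \<epsilon>" "ln \<epsilon> < 0" using \<epsilon> by auto
  show "1 \<le> r"
  proof (rule ccontr)
    assume "\<not> 1 \<le> r"
    then have "real r * a = 0" by simp
    then show False using r' ln_eps abs_ge_zero[of "ln K2"] by linarith
  qed
  have root: "sqrt (sqrt (g * (K_c * \<alpha> ^ r))) = (g * K_c) powr (1 / 4) * \<alpha> powr (real r / 4)"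
  proof -
    have "g * (K_c * \<alpha> ^ r) = (g * K_c) * \<alpha> powr real r"
      using \<alpha> by (simp add: powr_realpow)
    moreover have "sqrt (sqrt y) = y powr (1 / 4)" if "y > 0" for y :: real
    proof -
      have "sqrt (sqrt y) = (y powr (1 / 2)) powr (1 / 2)"
        using that by (subst (1 2) powr_half_sqrt) auto
      then show ?thesis by (simp only: powr_powr) simp
    qed
    moreover have "(g * K_c) * \<alpha> powr real r > 0" using pos \<alpha> by simp
    moreover have "((g * K_c) * \<alpha> powr real r) powr (1 / 4) = (g * K_c) powr (1 / 4) * \<alpha> powr (real r / 4)"
      using pos \<alpha> by (subst powr_mult) (auto simp only: powr_powr times_divide_eq_right mult_1_right)
    ultimately show ?thesis by (simp only:)
  qed
  have "10 * K * real T * real (n + m) * sqrt (sqrt (g * (K_c * \<alpha> ^ r))) = K2 * \<alpha> powr (real r / 4)"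
    unfolding root K2_def by simp
  also have "\<dots> \<le> \<epsilon>\<^sup>2"
  proof (cases "K2 = 0")
    case False
    moreover have "K2 \<ge> 0" unfolding K2_def using pos by (intro mult_nonneg_nonneg) auto
    ultimately have K2: "K2 > 0" by linarith
    have "ln (K2 * \<alpha> powr (real r / 4)) = ln K2 - real r * a / 4"
      using K2 \<alpha> by (simp add: ln_mult ln_powr a(2))
    also have "\<dots> \<le> 2 * ln \<epsilon>" using r' ln_eps(1) abs_ge_self[of "ln K2"] by linarith
    also have "\<dots> = ln (\<epsilon>\<^sup>2)" using \<epsilon> by (simp add: ln_realpow)
    finally have "ln (K2 * \<alpha> powr (real r / 4)) \<le> ln (\<epsilon>\<^sup>2)" .
    moreover have "0 < K2 * \<alpha> powr (real r / 4)" "0 < \<epsilon>\<^sup>2" using K2 \<alpha> \<epsilon> by simp_all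
    ultimately show ?thesis by (simp only: ln_le_cancel_iff)
  qed simp
  finally show "10 * K * real T * real (n + m) * sqrt (sqrt (g * (K_c * \<alpha> ^ r))) \<le> \<epsilon>\<^sup>2" .
qed

text \<open>
  For \<open>\<epsilon> \<ge> 1\<close> the claim is trivial.  Otherwise the loss is dominated, outside a null set, by a
  measurable function whose integral is at most \<open>\<epsilon>\<^sup>2\<close>; this also explains why the tie-breaking in
  \<open>xr\<close> may be non-measurable.
\<close>

lemma gap_probability:
  fixes \<epsilon> :: real
  assumes network: "random_decision_network M V E nb T G"
    and g: "0 < g" and dens: "cavity_densities_bounded M V T G g"
    and K: "0 < K" and moments: "second_moments_bounded M V E T G K"
    and \<alpha>: "0 < \<alpha>" "\<alpha> < 1" and K_c: "0 < K_c" and decay: "exp_correlation_decay M V T G \<alpha> K_c"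
    and \<epsilon>: "0 < \<epsilon>" and r: "real r \<ge> depth_bound T g K K_c \<alpha> (card V) (card E) \<epsilon>"
    and opt: "\<And>\<omega>. \<omega> \<in> space M \<Longrightarrow> optimal_solution (G \<omega>) (x \<omega>)"
    and ce: "\<And>\<omega>. \<omega> \<in> space M \<Longrightarrow> CE_argmax (G \<omega>) r (xr \<omega>)"
  shows "outer_measure_of M {\<omega>\<in>space M. objective (G \<omega>) (x \<omega>) - objective (G \<omega>) (xr \<omega>) > ereal \<epsilon>} \<le> ennreal \<epsilon>"
    (is "outer_measure_of M ?gap \<le> _")
proof (cases "\<epsilon> < 1")
  case False
  interpret prob_space M using network by (simp add: random_decision_network_def)
  have "outer_measure_of M ?gap \<le> outer_measure_of M (space M)" by (rule outer_measure_of_mono) auto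
  also have "\<dots> = 1" by (simp add: emeasure_space_1)
  also have "\<dots> \<le> ennreal \<epsilon>" using False by simp
  finally show ?thesis .
next
  case True
  have rn: "random_wf_network M V E nb T G" by (rule random_network_wf[OF network moments])
  note D = random_wf_networkD[OF rn] and R = random_graph[OF rn]
  note T = R(4)
  note depth = depth_suffices[OF \<epsilon> True T g K K_c \<alpha> r]
  define k where "k = K_c * \<alpha> ^ r"
  have k: "k > 0" using K_c \<alpha> by (simp add: k_def)
  \<comment> \<open>The resulting \<open>\<delta> = s / g\<close> balances the two contributions to the probability of an ambiguous decision.\<close>
  define s where "s = sqrt (g * k)"
  have s: "s > 0" using g k by (simp add: s_def)
  define \<delta> where "\<delta> = s / g"
  have \<delta>: "\<delta> > 0" using s g by (simp add: \<delta>_def)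
  have ss: "s * s = g * k" using g k by (simp add: s_def)
  have k\<delta>: "K_c * \<alpha> ^ r / \<delta> = s" unfolding k_def[symmetric] using s g ss by (simp add: \<delta>_def field_simps)
  define q where "q = 5 * (real T)\<^sup>2 * s"
  have q: "q > 0" using T s by (simp add: q_def)
  \<comment> \<open>An edge is affected with probability at most \<open>2 q\<close>; this \<open>l\<close> minimises \<open>2 q l + K\<^sup>2 / l\<close>.\<close>
  define l where "l = K / sqrt (2 * q)"
  have l: "l > 0" using K q by (simp add: l_def)
  let ?A = "ambiguous M G T r \<delta>"
  have A: "?A v \<in> sets M" "emeasure M (?A v) \<le> ennreal q" if v: "v \<in> V" for v
  proof -
    note amb = ambiguous_measure[OF rn g dens decay depth(1) v K_c \<alpha>(1) \<delta>]
    show "?A v \<in> sets M" by (rule amb(1))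
    have "(real T)\<^sup>2 * (4 * \<delta> * g) + real T * (K_c * \<alpha> ^ r / \<delta>) = (real T)\<^sup>2 * (4 * s) + real T * s"
      unfolding k\<delta> using g by (simp add: \<delta>_def)
    also have "\<dots> \<le> q"
    proof -
      have "real T * 1 \<le> real T * real T" using T by (intro mult_left_mono) auto
      then have "real T * s \<le> (real T)\<^sup>2 * s"
        unfolding power2_eq_square using s by (intro mult_right_mono) auto
      then show ?thesis unfolding q_def by linarith
    qed
    finally show "emeasure M (?A v) \<le> ennreal q"
      using amb(2) by (meson ennreal_leI order_trans)
  qed
  define H where "H \<omega> =
     (\<Sum>e\<in>E. ennreal l * (indicator (?A (fst e)) \<omega> + indicator (?A (snd e)) \<omega>) +
        ennreal (1 / l) * edge_square (G \<omega>) e) +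
     (\<Sum>v\<in>V. ennreal l * indicator (?A v) \<omega> + ennreal (1 / l) * node_square (G \<omega>) v)" for \<omega>
  note mom = second_moments[OF network K moments]
  have ends: "fst e \<in> V" "snd e \<in> V" if "e \<in> E" for e using R(2) that by auto
  have mE: "(\<lambda>\<omega>. ennreal l * (indicator (?A (fst e)) \<omega> + indicator (?A (snd e)) \<omega>) +
        ennreal (1 / l) * edge_square (G \<omega>) e) \<in> borel_measurable M" if "e \<in> E" for e
    using A(1)[OF ends(1)[OF that]] A(1)[OF ends(2)[OF that]] mom(1)[OF that] by measurable
  have mV: "(\<lambda>\<omega>. ennreal l * indicator (?A v) \<omega> + ennreal (1 / l) * node_square (G \<omega>) v) \<in> borel_measurable M"
    if "v \<in> V" for v
    using A(1)[OF that] mom(3)[OF that] by measurable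
  have H: "H \<in> borel_measurable M"
    unfolding H_def[abs_def]
    by (rule borel_measurable_add[OF borel_measurable_sum[OF mE] borel_measurable_sum[OF mV]])
  define t where "t = l * (2 * q) + 1 / l * K\<^sup>2"
  have t_eq: "t = 2 * K * sqrt (2 * q)"
    using K q by (simp add: t_def l_def field_simps power2_eq_square)
  have intE: "(\<integral>\<^sup>+\<omega>. ennreal l * (indicator (?A (fst e)) \<omega> + indicator (?A (snd e)) \<omega>) +
        ennreal (1 / l) * edge_square (G \<omega>) e \<partial>M) \<le> ennreal t" if e: "e \<in> E" for e
  proof -
    have "(\<integral>\<^sup>+\<omega>. ennreal l * (indicator (?A (fst e)) \<omega> + indicator (?A (snd e)) \<omega>) +
        ennreal (1 / l) * edge_square (G \<omega>) e \<partial>M) =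
        ennreal l * (emeasure M (?A (fst e)) + emeasure M (?A (snd e))) +
        ennreal (1 / l) * (\<integral>\<^sup>+\<omega>. edge_square (G \<omega>) e \<partial>M)"
      using A(1)[OF ends(1)[OF e]] A(1)[OF ends(2)[OF e]] mom(1)[OF e]
      by (simp add: nn_integral_add nn_integral_cmult)
    also have "\<dots> \<le> ennreal l * (ennreal q + ennreal q) + ennreal (1 / l) * ennreal (K\<^sup>2)"
      by (intro add_mono mult_left_mono A(2) ends e mom(2)) auto
    also have "\<dots> = ennreal t"
      using l q by (simp add: t_def ennreal_plus[symmetric] ennreal_mult[symmetric] del: ennreal_plus)
    finally show ?thesis .
  qed
  have intV: "(\<integral>\<^sup>+\<omega>. ennreal l * indicator (?A v) \<omega> + ennreal (1 / l) * node_square (G \<omega>) v \<partial>M) \<le> ennreal t"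
    if v: "v \<in> V" for v
  proof -
    have "(\<integral>\<^sup>+\<omega>. ennreal l * indicator (?A v) \<omega> + ennreal (1 / l) * node_square (G \<omega>) v \<partial>M) =
        ennreal l * emeasure M (?A v) + ennreal (1 / l) * (\<integral>\<^sup>+\<omega>. node_square (G \<omega>) v \<partial>M)"
      using A(1)[OF v] mom(3)[OF v] by (simp add: nn_integral_add nn_integral_cmult)
    also have "\<dots> \<le> ennreal l * ennreal q + ennreal (1 / l) * ennreal (K\<^sup>2)"
      by (intro add_mono mult_left_mono A(2) v mom(4)) auto
    also have "\<dots> \<le> ennreal t"
      using l q by (simp add: t_def ennreal_plus[symmetric] ennreal_mult[symmetric] del: ennreal_plus)
    finally show ?thesis .
  qed
  have "(\<integral>\<^sup>+\<omega>. H \<omega> \<partial>M) =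
     (\<Sum>e\<in>E. \<integral>\<^sup>+\<omega>. ennreal l * (indicator (?A (fst e)) \<omega> + indicator (?A (snd e)) \<omega>) +
        ennreal (1 / l) * edge_square (G \<omega>) e \<partial>M) +
     (\<Sum>v\<in>V. \<integral>\<^sup>+\<omega>. ennreal l * indicator (?A v) \<omega> + ennreal (1 / l) * node_square (G \<omega>) v \<partial>M)"
  proof -
    have "(\<integral>\<^sup>+\<omega>. H \<omega> \<partial>M) =
      (\<integral>\<^sup>+\<omega>. (\<Sum>e\<in>E. ennreal l * (indicator (?A (fst e)) \<omega> + indicator (?A (snd e)) \<omega>) +
        ennreal (1 / l) * edge_square (G \<omega>) e) \<partial>M) +
      (\<integral>\<^sup>+\<omega>. (\<Sum>v\<in>V. ennreal l * indicator (?A v) \<omega> + ennreal (1 / l) * node_square (G \<omega>) v) \<partial>M)"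
      unfolding H_def by (intro nn_integral_add borel_measurable_sum mE mV)
    then show ?thesis by (simp only: nn_integral_sum[OF mE] nn_integral_sum[OF mV])
  qed
  also have "\<dots> \<le> (\<Sum>e\<in>E. ennreal t) + (\<Sum>v\<in>V. ennreal t)"
    by (intro add_mono sum_mono intE intV)
  also have "\<dots> = ennreal (real (card V + card E) * t)"
  proof -
    have "t \<ge> 0" unfolding t_eq using K q by simp
    then show ?thesis
      by (simp add: ennreal_of_nat_eq_real_of_nat ennreal_mult[symmetric] ennreal_plus[symmetric]
          distrib_right add.commute del: ennreal_plus)
  qed
  also have "\<dots> \<le> ennreal (\<epsilon>\<^sup>2)"
  proof (rule ennreal_leI)
    have "sqrt (2 * q) = sqrt 10 * real T * sqrt s"
      using T by (simp add: q_def real_sqrt_mult mult.assoc[symmetric])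
    also have "\<dots> \<le> 5 * real T * sqrt s"
      using s by (intro mult_right_mono real_le_lsqrt) auto
    finally have "t \<le> 2 * K * (5 * real T * sqrt s)"
      unfolding t_eq using K by (intro mult_left_mono) auto
    then have "real (card V + card E) * t \<le> real (card V + card E) * (2 * K * (5 * real T * sqrt s))"
      by (rule mult_left_mono) simp
    also have "\<dots> = 10 * K * real T * real (card V + card E) * sqrt (sqrt (g * (K_c * \<alpha> ^ r)))"
      by (simp add: s_def k_def)
    also have "\<dots> \<le> \<epsilon>\<^sup>2" by (rule depth(2))
    finally show "real (card V + card E) * t \<le> \<epsilon>\<^sup>2" .
  qed
  finally have intH: "(\<integral>\<^sup>+\<omega>. H \<omega> \<partial>M) \<le> ennreal (\<epsilon>\<^sup>2)" .
  have "emeasure M {\<omega>\<in>space M. ennreal \<epsilon> \<le> H \<omega>} \<le> ennreal (1 / \<epsilon>) * (\<integral>\<^sup>+\<omega>. H \<omega> \<partial>M)"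
    by (rule Markov_ennreal[OF H \<epsilon>])
  also have "\<dots> \<le> ennreal (1 / \<epsilon>) * ennreal (\<epsilon>\<^sup>2)" using intH by (rule mult_left_mono) simp
  also have "\<dots> = ennreal \<epsilon>" using \<epsilon> by (simp add: ennreal_mult[symmetric] power2_eq_square)
  finally have tail: "emeasure M {\<omega>\<in>space M. ennreal \<epsilon> \<le> H \<omega>} \<le> ennreal \<epsilon>" .
  obtain N where N: "{\<omega>\<in>space M. \<not> finite_potentials (G \<omega>)} \<subseteq> N" "N \<in> null_sets M"
    using D(9) by (auto elim!: AE_E simp: null_setsI)
  have "?gap \<subseteq> {\<omega>\<in>space M. ennreal \<epsilon> \<le> H \<omega>} \<union> N"
  proof
    fix \<omega> assume gap: "\<omega> \<in> ?gap"
    then have \<omega>: "\<omega> \<in> space M" by simp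
    show "\<omega> \<in> {\<omega>\<in>space M. ennreal \<epsilon> \<le> H \<omega>} \<union> N"
    proof (cases "finite_potentials (G \<omega>)")
      case fin: True
      let ?W = "{v. \<omega> \<in> ?A v}"
      have ind: "indicator ?W v = (indicator (?A v) \<omega> :: ennreal)" for v by (simp add: indicator_def)
      have "ennreal \<epsilon> \<le> H \<omega>"
        using objective_gap_le[OF D(2)[OF \<omega>] fin l, of "x \<omega>" "xr \<omega>" ?W \<epsilon>] gap
          opt[OF \<omega>] ce[OF \<omega>] not_ambiguous[OF rn \<omega> fin _ _ \<delta> opt[OF \<omega>] ce[OF \<omega>]]
        unfolding H_def ind D(3-4,6)[OF \<omega>]
        by (auto simp: optimal_solution_def solutions_def CE_argmax_def D(3,6)[OF \<omega>])
      then show ?thesis using \<omega> by simp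
    qed (use \<omega> N(1) in auto)
  qed
  then have "outer_measure_of M ?gap \<le> outer_measure_of M ({\<omega>\<in>space M. ennreal \<epsilon> \<le> H \<omega>} \<union> N)"
    by (rule outer_measure_of_mono)
  also have "\<dots> = emeasure M ({\<omega>\<in>space M. ennreal \<epsilon> \<le> H \<omega>} \<union> N)"
    using H N(2) by (intro outer_measure_of_eq sets.Un) auto
  also have "\<dots> = emeasure M {\<omega>\<in>space M. ennreal \<epsilon> \<le> H \<omega>}"
    using H N(2) by (intro emeasure_Un_null_set) auto
  also have "\<dots> \<le> ennreal \<epsilon>" by (rule tail)
  finally show ?thesis .
qed

section \<open>Symbolic execution of programs\<close>

text \<open>
  A functional version of the relation \<^const>\<open>eval\<close>, with an oracle \<open>C\<close> for function calls.
  It is structurally recursive, so that the simplifier can execute the bodies of functions.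
\<close>

fun evaluate ::
  "(nat \<Rightarrow> 'v val \<Rightarrow> ('v val \<times> nat) option) \<Rightarrow> 'v val list \<Rightarrow> expr \<Rightarrow> ('v val \<times> nat) option"
where
  "evaluate C \<rho> (Var i) = (if i < length \<rho> then Some (\<rho> ! i, 1) else None)"
| "evaluate C \<rho> NullLit = Some (Null, 1)"
| "evaluate C \<rho> (NatLit n) = Some (Nat n, 1)"
| "evaluate C \<rho> (NumLit k) = Some (Num (ereal (of_int k)), 1)"
| "evaluate C \<rho> (Op1 f e) =
     (case evaluate C \<rho> e of None \<Rightarrow> None | Some (a, t) \<Rightarrow>
       (case app1 f a of None \<Rightarrow> None | Some v \<Rightarrow> Some (v, t + 1)))"
| "evaluate C \<rho> (Op2 f e e') =
     (case evaluate C \<rho> e of None \<Rightarrow> None | Some (a, t) \<Rightarrow>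
       (case evaluate C \<rho> e' of None \<Rightarrow> None | Some (a', t') \<Rightarrow>
         (case app2 f a a' of None \<Rightarrow> None | Some v \<Rightarrow> Some (v, t + t' + 1))))"
| "evaluate C \<rho> (Cond b e e') =
     (case evaluate C \<rho> b of None \<Rightarrow> None | Some (c, t) \<Rightarrow>
       (case c of
          Nat n \<Rightarrow>
            (case (if n = 0 then evaluate C \<rho> e' else evaluate C \<rho> e) of None \<Rightarrow> None
             | Some (v, t') \<Rightarrow> Some (v, t + t' + 1))
        | _ \<Rightarrow> None))"
| "evaluate C \<rho> (LetIn e e') =
     (case evaluate C \<rho> e of None \<Rightarrow> None | Some (a, t) \<Rightarrow>
       (case evaluate C (a # \<rho>) e' of None \<Rightarrow> None | Some (v, t') \<Rightarrow> Some (v, t + t' + 1)))"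
| "evaluate C \<rho> (Call f e) =
     (case evaluate C \<rho> e of None \<Rightarrow> None | Some (a, t) \<Rightarrow>
       (case C f a of None \<Rightarrow> None | Some (v, t') \<Rightarrow> Some (v, t + t' + 1)))"

lemma eval_deterministic:
  assumes "eval fs \<rho> e v t" "eval fs \<rho> e v' t'"
  shows "v' = v \<and> t' = t"
  using assms
proof (induction arbitrary: v' t' rule: eval.induct)
  case (eval_Var i \<rho>) from this(2) show ?case by cases auto
next
  case (eval_NullLit \<rho>) from this show ?case by cases auto
next
  case (eval_NatLit \<rho> n) from this show ?case by cases auto
next
  case (eval_NumLit \<rho> k) from this show ?case by cases auto
next
  case (eval_Op1 \<rho> e a t f v)
  from eval_Op1(4) show ?case by cases (use eval_Op1(2,3) in fastforce)
next
  case (eval_Op2 \<rho> e a t e' a' t' f v)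
  from eval_Op2(6) show ?case by cases (use eval_Op2(3-5) in fastforce)
next
  case (eval_Cond_True \<rho> b n t e v t' e')
  from eval_Cond_True(5) show ?case by cases (use eval_Cond_True(3,4) in fastforce)+
next
  case (eval_Cond_False \<rho> b t e' v t' e)
  from eval_Cond_False(5) show ?case by cases (use eval_Cond_False(3,4) in fastforce)+
next
  case (eval_LetIn \<rho> e a t e' v t')
  from eval_LetIn(5) show ?case by cases (use eval_LetIn(3,4) in fastforce)
next
  case (eval_Call f \<rho> e a t v t')
  from eval_Call(6) show ?case by cases (use eval_Call(4,5) in fastforce)
qed

text \<open>
  The oracle that answers a call by the true result and cost of the called function.  It exists
  because evaluation is deterministic.
\<close>

definition run :: "expr list \<Rightarrow> nat \<Rightarrow> 'v val \<Rightarrow> ('v val \<times> nat) option" where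
  "run fs f a =
     (if f < length fs \<and> (\<exists>v t. eval fs [a] (fs ! f) v t)
      then Some (SOME (v, t). eval fs [a] (fs ! f) v t) else None)"

lemma run_eq_Some: "run fs f a = Some (v, t) \<longleftrightarrow> f < length fs \<and> eval fs [a] (fs ! f) v t"
proof
  assume r: "run fs f a = Some (v, t)"
  then have "f < length fs" "\<exists>p. case p of (v, t) \<Rightarrow> eval fs [a] (fs ! f) v t"
    and p: "(SOME (v, t). eval fs [a] (fs ! f) v t) = (v, t)"
    by (auto simp: run_def split: if_splits)
  from someI_ex[OF this(2)] this(1) show "f < length fs \<and> eval fs [a] (fs ! f) v t"
    unfolding p by simp
next
  assume r: "f < length fs \<and> eval fs [a] (fs ! f) v t"
  then have "(SOME (v, t). eval fs [a] (fs ! f) v t) = (v, t)"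
    by (intro some_equality) (auto dest: eval_deterministic)
  with r show "run fs f a = Some (v, t)"
    unfolding run_def by auto
qed

lemma eval_iff_evaluate: "eval fs \<rho> e v t \<longleftrightarrow> evaluate (run fs) \<rho> e = Some (v, t)"
proof
  assume "eval fs \<rho> e v t"
  then show "evaluate (run fs) \<rho> e = Some (v, t)"
  proof induction
    case (eval_Call f \<rho> e a t v t')
    then have "run fs f a = Some (v, t')" by (simp add: run_eq_Some)
    with eval_Call show ?case by simp
  qed auto
next
  assume "evaluate (run fs) \<rho> e = Some (v, t)"
  then show "eval fs \<rho> e v t"
  proof (induction e arbitrary: \<rho> v t)
    case (Cond b e e')
    from Cond.prems obtain n tb t' where b': "evaluate (run fs) \<rho> b = Some (Nat n, tb)"
      and t: "t = tb + t' + 1"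
      and e: "(if n = 0 then evaluate (run fs) \<rho> e' else evaluate (run fs) \<rho> e) = Some (v, t')"
      by (auto split: option.splits prod.splits val.splits simp del: if_split)
    from Cond.IH(1)[OF b'] have b: "eval fs \<rho> b (Nat n) tb" .
    show ?case
    proof (cases n)
      case 0
      then show ?thesis
        using eval_Cond_False[of fs \<rho> b tb e' v t' e] b e Cond.IH(3) unfolding t by simp
    next
      case (Suc m)
      then show ?thesis
        using eval_Cond_True[of fs \<rho> b m tb e v t' e'] b e Cond.IH(2) unfolding t by simp
    qed
  next
    case (Op2 f e e')
    then obtain a ta a' ta' where "evaluate (run fs) \<rho> e = Some (a, ta)"
      "evaluate (run fs) \<rho> e' = Some (a', ta')" "app2 f a a' = Some v" "t = ta + ta' + 1"
      by (auto split: option.splits prod.splits)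
    with Op2.IH show ?case by (blast intro: eval_Op2)
  next
    case (LetIn e e')
    then obtain a ta ta' where "evaluate (run fs) \<rho> e = Some (a, ta)"
      "evaluate (run fs) (a # \<rho>) e' = Some (v, ta')" "t = ta + ta' + 1"
      by (auto split: option.splits prod.splits)
    with LetIn.IH show ?case by (blast intro: eval_LetIn)
  next
    case (Call f e)
    then obtain a ta ta' where "evaluate (run fs) \<rho> e = Some (a, ta)"
      "run fs f a = Some (v, ta')" "t = ta + ta' + 1"
      by (auto split: option.splits prod.splits)
    with Call.IH show ?case by (auto simp: run_eq_Some simp del: One_nat_def intro: eval_Call)
  next
    case (Op1 f e)
    then obtain a ta where "evaluate (run fs) \<rho> e = Some (a, ta)" "app1 f a = Some v" "t = ta + 1"
      by (auto split: option.splits prod.splits)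
    with Op1.IH show ?case by (blast intro: eval_Op1)
  next
    case (Var i)
    then show ?case by (auto split: if_splits simp del: One_nat_def intro: eval_Var)
  qed (auto simp del: One_nat_def intro: eval_NullLit eval_NatLit eval_NumLit)
qed

text \<open>
  Together with facts about the recursive calls, this equation lets the simplifier execute one call.
\<close>

lemma run_unfold: "f < length fs \<Longrightarrow> run fs f a = evaluate (run fs) [a] (fs ! f)"
proof (cases "evaluate (run fs) [a] (fs ! f)")
  case None
  then show ?thesis by (cases "run fs f a") (auto simp: run_eq_Some eval_iff_evaluate)
next
  case (Some p)
  assume "f < length fs"
  with Some show ?thesis by (cases p) (simp add: run_eq_Some eval_iff_evaluate)
qed

text \<open>
  Costs are only needed up to upper bounds, which keeps the cost formulas independent of the branches
  taken.
\<close>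

definition runs_within :: "expr list \<Rightarrow> nat \<Rightarrow> 'v val \<Rightarrow> 'v val \<Rightarrow> nat \<Rightarrow> bool" where
  "runs_within fs f a v t \<longleftrightarrow> (\<exists>s\<le>t. run fs f a = Some (v, s))"

lemma runs_withinE:
  assumes "runs_within fs f a v t"
  obtains s where "run fs f a = Some (v, s)" "s \<le> t"
  using assms by (auto simp: runs_within_def)

section \<open>A program for the cavity expansion\<close>

abbreviation fst_of :: "expr \<Rightarrow> expr" where "fst_of e \<equiv> Op1 Fst e"
abbreviation snd_of :: "expr \<Rightarrow> expr" where "snd_of e \<equiv> Op1 Snd e"
abbreviation pair_of :: "expr \<Rightarrow> expr \<Rightarrow> expr" where "pair_of e e' \<equiv> Op2 Cons2 e e'"

abbreviation (input) "fn_main \<equiv> 0 :: nat"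
abbreviation (input) "fn_solve \<equiv> 1 :: nat"
abbreviation (input) "fn_lookup \<equiv> 2 :: nat"
abbreviation (input) "fn_nth \<equiv> 3 :: nat"
abbreviation (input) "fn_member \<equiv> 4 :: nat"
abbreviation (input) "fn_remove \<equiv> 5 :: nat"
abbreviation (input) "fn_potential \<equiv> 6 :: nat"
abbreviation (input) "fn_suffix \<equiv> 7 :: nat"
abbreviation (input) "fn_maxsum \<equiv> 8 :: nat"
abbreviation (input) "fn_CE \<equiv> 9 :: nat"
abbreviation (input) "fn_sum \<equiv> 10 :: nat"
abbreviation (input) "fn_vector \<equiv> 11 :: nat"
abbreviation (input) "fn_argmax \<equiv> 12 :: nat"

text \<open>
  Functions take one argument, so tuples are passed as nested pairs; here \<open>(u, net)\<close>: the entry of node \<open>u\<close> in the adjacency list \<open>net\<close>.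
\<close>

definition lookup_body :: expr where
  "lookup_body =
     Cond (Op2 Eq (fst_of (fst_of (snd_of (Var 0)))) (fst_of (Var 0)))
       (fst_of (snd_of (Var 0)))
       (Call fn_lookup (pair_of (fst_of (Var 0)) (snd_of (snd_of (Var 0)))))"

definition nth_body :: expr where
  "nth_body =
     Cond (fst_of (Var 0))
       (Call fn_nth (pair_of (Op1 Decr (fst_of (Var 0))) (snd_of (snd_of (Var 0)))))
       (fst_of (snd_of (Var 0)))"

definition member_body :: expr where
  "member_body =
     Cond (Op1 IsPair (snd_of (Var 0)))
       (Cond (Op2 Eq (fst_of (Var 0)) (fst_of (snd_of (Var 0))))
         (NatLit 1)
         (Call fn_member (pair_of (fst_of (Var 0)) (snd_of (snd_of (Var 0))))))
       (NatLit 0)"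

text \<open>
  \<open>(us, adj)\<close>: the entries of \<open>adj\<close> whose node is not in \<open>us\<close>.
\<close>

definition remove_body :: expr where
  "remove_body =
     Cond (Op1 IsPair (snd_of (Var 0)))
       (LetIn (Call fn_remove (pair_of (fst_of (Var 0)) (snd_of (snd_of (Var 0)))))
         (Cond (Call fn_member (pair_of (fst_of (fst_of (snd_of (Var 1)))) (fst_of (Var 1))))
           (Var 0)
           (pair_of (fst_of (snd_of (Var 1))) (Var 0))))
       NullLit"

text \<open>
  \<open>((u, x), (acc, mods))\<close>: the sum of \<open>acc\<close> and of the \<open>x\<close>-th numbers of all rows in \<open>mods\<close> that are
  marked with \<open>u\<close>.
\<close>

definition potential_body :: expr where
  "potential_body =
     Cond (Op1 IsPair (snd_of (snd_of (Var 0))))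
       (LetIn (fst_of (snd_of (snd_of (Var 0))))
         (Call fn_potential
           (pair_of (fst_of (Var 1))
             (pair_of
               (Cond (Op2 Eq (fst_of (Var 0)) (fst_of (fst_of (Var 1))))
                 (Op2 Add (fst_of (snd_of (Var 1)))
                   (Call fn_nth (pair_of (snd_of (fst_of (Var 1))) (snd_of (Var 0)))))
                 (fst_of (snd_of (Var 1))))
               (snd_of (snd_of (snd_of (Var 1))))))))
       (fst_of (snd_of (Var 0)))"

text \<open>
  \<open>(adj, mods)\<close>: puts the rows for action \<open>0\<close> of all entries of \<open>adj\<close> in front of \<open>mods\<close>.
\<close>

definition suffix_body :: expr where
  "suffix_body =
     Cond (Op1 IsPair (fst_of (Var 0)))
       (pair_of
         (pair_of (fst_of (fst_of (fst_of (Var 0)))) (fst_of (snd_of (fst_of (fst_of (Var 0))))))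
         (Call fn_suffix (pair_of (snd_of (fst_of (Var 0))) (snd_of (Var 0)))))
       (snd_of (Var 0))"

text \<open>
  \<open>(row, vec)\<close>: the maximum of the entrywise sums.
\<close>

definition maxsum_body :: expr where
  "maxsum_body =
     LetIn (Op2 Add (fst_of (fst_of (Var 0))) (fst_of (snd_of (Var 0))))
       (Cond (Op1 IsPair (snd_of (fst_of (Var 1))))
         (LetIn (Call fn_maxsum (pair_of (snd_of (fst_of (Var 1))) (snd_of (snd_of (Var 1)))))
           (Cond (Op2 Leq (Var 1) (Var 0)) (Var 0) (Var 1)))
         (Var 0))"

text \<open>
  The argument is a list of numbers; the result is the pair of the first position of its maximum and
  the maximum.
\<close>

definition argmax_body :: expr where
  "argmax_body =
     Cond (Op1 IsPair (snd_of (Var 0)))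
       (LetIn (Call fn_argmax (snd_of (Var 0)))
         (Cond (Op2 Leq (snd_of (Var 0)) (fst_of (Var 1)))
           (pair_of (NatLit 0) (fst_of (Var 1)))
           (pair_of (Op1 Incr (fst_of (Var 0))) (snd_of (Var 0)))))
       (pair_of (NatLit 0) (fst_of (Var 0)))"

text \<open>
  \<open>(x, (net, (us, (mods, (u, r)))))\<close>.  The local variables are, outermost first: the action, the
  argument without the action, the node, the list \<open>mods\<close>, the entry of the node, and its table of
  potentials.
\<close>

definition CE_body :: expr where
  "CE_body =
     Cond (snd_of (snd_of (snd_of (snd_of (snd_of (Var 0))))))
       (LetIn (fst_of (Var 0))
       (LetIn (snd_of (Var 1))
       (LetIn (fst_of (snd_of (snd_of (snd_of (Var 0)))))
       (LetIn (fst_of (snd_of (snd_of (Var 1))))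
       (LetIn (Call fn_lookup (pair_of (Var 1) (fst_of (Var 2))))
       (LetIn (fst_of (snd_of (Var 0)))
         (Call fn_sum
           (pair_of (fst_of (Var 4))
           (pair_of (pair_of (Var 3) (fst_of (snd_of (Var 4))))
           (pair_of (Var 5)
           (pair_of (Op1 Decr (snd_of (snd_of (snd_of (snd_of (Var 4))))))
           (pair_of (Call fn_remove (pair_of (fst_of (snd_of (Var 4))) (snd_of (snd_of (Var 1)))))
           (pair_of (Var 2)
             (Op2 Sub
               (Call fn_potential
                 (pair_of (pair_of (Var 3) (Var 5))
                   (pair_of (Call fn_nth (pair_of (Var 5) (Var 0))) (Var 2))))
               (Call fn_potential
                 (pair_of (pair_of (Var 3) (NatLit 0))
                   (pair_of (fst_of (Var 0)) (Var 2))))))))))))))))))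
       (NumLit 0)"

text \<open>
  \<open>(net, (us, (x, (r, (adj, (mods, acc))))))\<close>: adds the partial cavities of the remaining neighbours
  \<open>adj\<close> to \<open>acc\<close>.  The list \<open>mods\<close> already contains the rows for action \<open>x\<close> of the neighbours that were
  treated before; the subnetwork of the current neighbour also needs the rows for action \<open>0\<close> of
  those still to come.  The local variables are, outermost first: the tail of the argument from \<open>adj\<close>
  on, \<open>adj\<close>, the current entry, the action, its row, the list \<open>mods\<close>, the depth, and the vector of
  recursive results.
\<close>

definition sum_body :: "nat \<Rightarrow> expr" where
  "sum_body T =
     LetIn (snd_of (snd_of (snd_of (snd_of (Var 0)))))
     (LetIn (fst_of (Var 0))
       (Cond (Op1 IsPair (Var 0))
         (LetIn (fst_of (Var 0))
         (LetIn (fst_of (snd_of (snd_of (Var 3))))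
         (LetIn (Call fn_nth (pair_of (Var 0) (snd_of (Var 1))))
         (LetIn (fst_of (snd_of (Var 4)))
         (LetIn (fst_of (snd_of (snd_of (snd_of (Var 6)))))
         (LetIn (Call fn_vector
                  (pair_of (NatLit T)
                  (pair_of NullLit
                  (pair_of (fst_of (Var 7))
                  (pair_of (fst_of (snd_of (Var 7)))
                  (pair_of (Call fn_suffix (pair_of (snd_of (Var 5)) (Var 1)))
                  (pair_of (fst_of (Var 4)) (Var 0))))))))
           (Call fn_sum
             (pair_of (fst_of (Var 8))
             (pair_of (fst_of (snd_of (Var 8)))
             (pair_of (Var 4)
             (pair_of (Var 1)
             (pair_of (snd_of (Var 6))
             (pair_of (pair_of (pair_of (fst_of (Var 5)) (Var 3)) (Var 2))
               (Op2 Add (snd_of (snd_of (Var 7)))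
                 (Op2 Sub
                   (Call fn_maxsum (pair_of (Var 3) (Var 0)))
                   (Call fn_maxsum (pair_of (fst_of (snd_of (Var 5))) (Var 0))))))))))))))))))
         (snd_of (snd_of (Var 1)))))"

text \<open>
  \<open>(k, (acc, context))\<close>: the results of the expansion for the actions below \<open>k\<close>, in front of \<open>acc\<close>.
\<close>

definition vector_body :: expr where
  "vector_body =
     Cond (fst_of (Var 0))
       (LetIn (Op1 Decr (fst_of (Var 0)))
         (Call fn_vector
           (pair_of (Var 0)
             (pair_of (pair_of (Call fn_CE (pair_of (Var 0) (snd_of (snd_of (Var 1)))))
                               (fst_of (snd_of (Var 1))))
               (snd_of (snd_of (Var 1)))))))
       (fst_of (snd_of (Var 0)))"

definition solve_body :: "nat \<Rightarrow> expr" where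
  "solve_body T =
     Cond (Op1 IsPair (fst_of (Var 0)))
       (LetIn (fst_of (fst_of (fst_of (Var 0))))
         (pair_of
           (pair_of (Var 0)
             (fst_of (Call fn_argmax
               (Call fn_vector
                 (pair_of (NatLit T)
                 (pair_of NullLit
                 (pair_of (fst_of (snd_of (Var 1)))
                 (pair_of NullLit
                 (pair_of NullLit
                 (pair_of (Var 0) (snd_of (snd_of (Var 1)))))))))))))
           (Call fn_solve (pair_of (snd_of (fst_of (Var 1))) (snd_of (Var 1))))))
       NullLit"

definition main_body :: expr where
  "main_body = Call fn_solve
     (pair_of (snd_of (Var 0)) (pair_of (snd_of (Var 0)) (fst_of (Var 0))))"

definition program :: "nat \<Rightarrow> expr list" where
  "program T =
     [main_body, solve_body T, lookup_body, nth_body, member_body, remove_body, potential_body,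
      suffix_body, maxsum_body, CE_body, sum_body T, vector_body, argmax_body]"

lemma run_program:
  "run (program T) fn_main a = evaluate (run (program T)) [a] main_body"
  "run (program T) fn_solve a = evaluate (run (program T)) [a] (solve_body T)"
  "run (program T) fn_lookup a = evaluate (run (program T)) [a] lookup_body"
  "run (program T) fn_nth a = evaluate (run (program T)) [a] nth_body"
  "run (program T) fn_member a = evaluate (run (program T)) [a] member_body"
  "run (program T) fn_remove a = evaluate (run (program T)) [a] remove_body"
  "run (program T) fn_potential a = evaluate (run (program T)) [a] potential_body"
  "run (program T) fn_suffix a = evaluate (run (program T)) [a] suffix_body"
  "run (program T) fn_maxsum a = evaluate (run (program T)) [a] maxsum_body"
  "run (program T) fn_CE a = evaluate (run (program T)) [a] CE_body"
  "run (program T) fn_sum a = evaluate (run (program T)) [a] (sum_body T)"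
  "run (program T) fn_vector a = evaluate (run (program T)) [a] vector_body"
  "run (program T) fn_argmax a = evaluate (run (program T)) [a] argmax_body"
  by (subst run_unfold; simp add: program_def)+

lemma runs_within_evaluate:
  assumes "run fs f a = evaluate C \<rho> e"
    and "case evaluate C \<rho> e of None \<Rightarrow> False | Some (v', s) \<Rightarrow> v' = v \<and> s \<le> t"
  shows "runs_within fs f a v t"
  using assms by (auto simp: runs_within_def split: option.splits)

lemma enc_node_name: "app1 Fst (enc_node N w) = Some (Node w)"
  by (simp add: enc_node_def)

lemma lookup_runs:
  assumes "u \<in> set vs"
  shows "runs_within (program T) fn_lookup (val.Pair (Node u) (enc_list (map (enc_node N) vs)))
           (enc_node N u) (30 * length vs)"
  using assms
proof (induction vs)
  case (Cons w vs)
  show ?case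
  proof (cases "w = u")
    case True
    then show ?thesis
      by - (rule runs_within_evaluate, rule run_program, auto simp: lookup_body_def enc_node_name)
  next
    case False
    with Cons obtain s where "run (program T) fn_lookup
        (val.Pair (Node u) (enc_list (map (enc_node N) vs))) = Some (enc_node N u, s)"
      "s \<le> 30 * length vs" by (auto elim: runs_withinE)
    with False show ?thesis
      by - (rule runs_within_evaluate, rule run_program, auto simp: lookup_body_def enc_node_name)
  qed
qed simp

lemma nth_runs:
  assumes "k < length xs"
  shows "runs_within (program T) fn_nth (val.Pair (Nat k) (enc_list xs)) (xs ! k) (30 * length xs)"
  using assms
proof (induction xs arbitrary: k)
  case (Cons x xs)
  show ?case
  proof (cases k)
    case 0
    then show ?thesis
      by - (rule runs_within_evaluate, rule run_program, auto simp: nth_body_def)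
  next
    case (Suc k')
    with Cons obtain s where "run (program T) fn_nth
        (val.Pair (Nat k') (enc_list xs)) = Some (xs ! k', s)"
      "s \<le> 30 * length xs" by (auto elim: runs_withinE)
    with Suc show ?thesis
      by - (rule runs_within_evaluate, rule run_program, auto simp: nth_body_def)
  qed
qed simp

lemma member_runs:
  "runs_within (program T) fn_member (val.Pair (Node u) (enc_list (map Node us)))
     (truth (u \<in> set us)) (30 * (length us + 1))"
proof (induction us)
  case Nil
  show ?case by - (rule runs_within_evaluate, rule run_program, auto simp: member_body_def)
next
  case (Cons w us)
  then obtain s where "run (program T) fn_member
      (val.Pair (Node u) (enc_list (map Node us))) = Some (truth (u \<in> set us), s)"
    "s \<le> 30 * (length us + 1)" by (auto elim: runs_withinE)
  then show ?case
    by - (rule runs_within_evaluate, rule run_program, auto simp: member_body_def)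
qed

lemma remove_runs:
  "runs_within (program T) fn_remove
     (val.Pair (enc_list (map Node us)) (enc_list (map (\<lambda>w. val.Pair (Node w) (tb w)) ws)))
     (enc_list (map (\<lambda>w. val.Pair (Node w) (tb w)) (filter (\<lambda>w. w \<notin> set us) ws)))
     (60 * (length ws + 1) * (length us + 2))"
proof (induction ws)
  case Nil
  show ?case by - (rule runs_within_evaluate, rule run_program, auto simp: remove_body_def)
next
  case (Cons w ws)
  then obtain s where s: "run (program T) fn_remove
     (val.Pair (enc_list (map Node us)) (enc_list (map (\<lambda>w. val.Pair (Node w) (tb w)) ws))) =
     Some (enc_list (map (\<lambda>w. val.Pair (Node w) (tb w)) (filter (\<lambda>w. w \<notin> set us) ws)), s)"
    "s \<le> 60 * (length ws + 1) * (length us + 2)" by (auto elim: runs_withinE)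
  obtain s' where s': "run (program T) fn_member
      (val.Pair (Node w) (enc_list (map Node us))) = Some (truth (w \<in> set us), s')"
    "s' \<le> 30 * (length us + 1)" by (rule runs_withinE[OF member_runs])
  from s s' show ?case
    by - (rule runs_within_evaluate, rule run_program, auto simp: remove_body_def algebra_simps)
qed

definition enc_row :: "nat \<Rightarrow> (nat \<Rightarrow> ereal) \<Rightarrow> 'v val" where
  "enc_row T f = enc_list (map (\<lambda>y. Num (f y)) [0..<T])"

definition enc_mods :: "nat \<Rightarrow> ('v \<times> (nat \<Rightarrow> ereal)) list \<Rightarrow> 'v val" where
  "enc_mods T ms = enc_list (map (\<lambda>(w, f). val.Pair (Node w) (enc_row T f)) ms)"

definition enc_entry :: "nat \<Rightarrow> ('v \<Rightarrow> nat \<Rightarrow> nat \<Rightarrow> ereal) \<Rightarrow> 'v \<Rightarrow> 'v val" where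
  "enc_entry T I w = val.Pair (Node w) (enc_list (map (\<lambda>x. enc_row T (I w x)) [0..<T]))"

text \<open>
  The effect of the recorded rows on the potential of \<open>u\<close> at \<open>x\<close>.
\<close>

definition mods_sum :: "('v \<times> (nat \<Rightarrow> ereal)) list \<Rightarrow> 'v \<Rightarrow> nat \<Rightarrow> ereal" where
  "mods_sum ms u x = (\<Sum>(w, f)\<leftarrow>ms. if w = u then f x else 0)"

lemma enc_mods_simps [simp]:
  "enc_mods T [] = Null"
  "enc_mods T ((w, f) # ms) = val.Pair (val.Pair (Node w) (enc_row T f)) (enc_mods T ms)"
  by (simp_all add: enc_mods_def)

lemma mods_sum_simps [simp]:
  "mods_sum [] u x = 0"
  "mods_sum ((w, f) # ms) u x = (if w = u then f x else 0) + mods_sum ms u x"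
  by (simp_all add: mods_sum_def)

lemma row_nth_runs:
  "x < T \<Longrightarrow> runs_within (program T) fn_nth (val.Pair (Nat x) (enc_row T f)) (Num (f x)) (30 * T)"
  using nth_runs[of x "map (\<lambda>y. Num (f y)) [0..<T]" T] by (simp add: enc_row_def)

lemma table_nth_runs:
  "x < T \<Longrightarrow> runs_within (program T) fn_nth
     (val.Pair (Nat x) (enc_list (map (\<lambda>x. enc_row T (F x)) [0..<T]))) (enc_row T (F x)) (30 * T)"
  using nth_runs[of x "map (\<lambda>x. enc_row T (F x)) [0..<T]" T] by simp

lemma potential_runs:
  fixes u :: 'v
  assumes "x < T"
  shows "runs_within (program T) fn_potential
     (val.Pair (val.Pair (Node u) (Nat x)) (val.Pair (Num acc) (enc_mods T ms)))
     (Num (acc + mods_sum ms u x)) ((60 + 30 * T) * (length ms + 1))"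
proof (induction ms arbitrary: acc)
  case Nil
  show ?case
    by - (rule runs_within_evaluate, rule run_program, auto simp: potential_body_def)
next
  case (Cons m ms)
  obtain w f where m: "m = (w, f)" by (cases m)
  obtain s where s: "run (program T) fn_potential
     (val.Pair (val.Pair (Node u) (Nat x))
        (val.Pair (Num (if u = w then acc + f x else acc)) (enc_mods T ms))) =
     Some (Num ((if u = w then acc + f x else acc) + mods_sum ms u x), s)"
     "s \<le> (60 + 30 * T) * (length ms + 1)"
    by (rule runs_withinE[OF Cons.IH])
  obtain s' where s': "run (program T) fn_nth (val.Pair (Nat x) (enc_row T f)) = Some (Num (f x) :: 'v val, s')"
    "s' \<le> 30 * T" by (rule runs_withinE[OF row_nth_runs[OF assms]])
  show ?case
    using s s' by - (rule runs_within_evaluate, rule run_program,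
      cases "u = w", auto simp: potential_body_def m add.assoc)
qed

lemma enc_entry_parts:
  "app1 Fst (enc_entry T I w) = Some (Node w)"
  "app1 Snd (enc_entry T I w) = Some (enc_list (map (\<lambda>x. enc_row T (I w x)) [0..<T]))"
  by (simp_all add: enc_entry_def)

lemma table_first:
  "0 < T \<Longrightarrow> app1 Fst (enc_list (map (\<lambda>x. enc_row T (F x)) [0..<T])) = Some (enc_row T (F 0))"
  by (simp add: upt_conv_Cons)

lemma suffix_runs:
  assumes "0 < T"
  shows "runs_within (program T) fn_suffix
     (val.Pair (enc_list (map (enc_entry T I) ws)) (enc_mods T ms))
     (enc_mods T (map (\<lambda>w. (w, I w 0)) ws @ ms)) (40 * (length ws + 1))"
proof (induction ws)
  case Nil
  show ?case by - (rule runs_within_evaluate, rule run_program, auto simp: suffix_body_def)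
next
  case (Cons w ws)
  then obtain s where s: "run (program T) fn_suffix
     (val.Pair (enc_list (map (enc_entry T I) ws)) (enc_mods T ms)) =
     Some (enc_mods T (map (\<lambda>w. (w, I w 0)) ws @ ms), s)" "s \<le> 40 * (length ws + 1)"
    by (auto elim: runs_withinE)
  show ?case
    using s assms
    by - (rule runs_within_evaluate, rule run_program,
      auto simp: suffix_body_def enc_entry_parts table_first)
qed

lemma is_pair_enc_list:
  "xs \<noteq> [] \<Longrightarrow> case enc_list (map f xs) of val.Pair _ _ \<Rightarrow> True | _ \<Rightarrow> False"
  by (cases xs) auto

lemma maxsum_runs:
  assumes "length xs = length ys" "xs \<noteq> []"
  shows "runs_within (program T) fn_maxsum
     (val.Pair (enc_list (map Num xs)) (enc_list (map Num ys)))
     (Num (Max (set (map2 (+) xs ys))) :: 'v val) (40 * length xs)"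
  using assms
proof (induction xs arbitrary: ys)
  case (Cons x xs)
  note IH = Cons.IH
  from Cons.prems obtain y ys' where ys: "ys = y # ys'" "length xs = length ys'" by (cases ys) auto
  show ?case
  proof (cases xs)
    case Nil
    then show ?thesis using ys
      by - (rule runs_within_evaluate, rule run_program, auto simp: maxsum_body_def)
  next
    case (Cons x' xs')
    then have ne: "xs \<noteq> []" by simp
    from IH[OF ys(2) ne] obtain s where s: "run (program T) fn_maxsum
       (val.Pair (enc_list (map Num xs)) (enc_list (map Num ys'))) =
       Some (Num (Max (set (map2 (+) xs ys'))) :: 'v val, s)" "s \<le> 40 * length xs"
      by (rule runs_withinE)
    have "Max (set (map2 (+) (x # xs) ys)) = max (x + y) (Max (set (map2 (+) xs ys')))"
      using ys Cons by (cases ys') auto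
    moreover define m where "m = Max (set (map2 (+) xs ys'))"
    ultimately have M: "Max (set (map2 (+) (x # xs) ys)) = (if x + y \<le> m then m else x + y)"
      by (simp add: max_def)
    show ?thesis
      unfolding M using s[folded m_def] ys(1)
      by - (rule runs_within_evaluate, rule run_program, simp add: maxsum_body_def is_pair_enc_list[OF ne])
  qed
qed simp

text \<open>
  The position depends on how ties are broken, so only its characteristic property is stated.
\<close>

lemma argmax_runs:
  assumes "xs \<noteq> []"
  shows "\<exists>i < length xs. (\<forall>x \<in> set xs. x \<le> xs ! i) \<and>
     runs_within (program T) fn_argmax (enc_list (map Num xs)) (val.Pair (Nat i) (Num (xs ! i)) :: 'v val)
       (40 * length xs)"
  using assms
proof (induction xs)
  case (Cons x xs)
  note IH = Cons.IH
  show ?case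
  proof (cases xs)
    case Nil
    have "runs_within (program T) fn_argmax (enc_list (map Num (x # xs)))
         (val.Pair (Nat 0) (Num x) :: 'v val) (40 * length (x # xs))"
      using Nil by - (rule runs_within_evaluate, rule run_program, auto simp: argmax_body_def)
    then show ?thesis using Nil by (intro exI[of _ 0]) auto
  next
    case (Cons x' xs')
    then have ne: "xs \<noteq> []" by simp
    from IH[OF ne] obtain i where i: "i < length xs" "\<forall>x \<in> set xs. x \<le> xs ! i"
      and r: "runs_within (program T) fn_argmax (enc_list (map Num xs))
         (val.Pair (Nat i) (Num (xs ! i)) :: 'v val) (40 * length xs)"
      by blast
    from r obtain s where s: "run (program T) fn_argmax (enc_list (map Num xs)) =
        Some (val.Pair (Nat i) (Num (xs ! i)) :: 'v val, s)" "s \<le> 40 * length xs"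
      by (rule runs_withinE)
    show ?thesis
    proof (cases "xs ! i \<le> x")
      case True
      have "runs_within (program T) fn_argmax (enc_list (map Num (x # xs)))
         (val.Pair (Nat 0) (Num x) :: 'v val) (40 * length (x # xs))"
        using s True
        by - (rule runs_within_evaluate, rule run_program, simp add: argmax_body_def is_pair_enc_list[OF ne])
      then show ?thesis using i True by (intro exI[of _ 0]) auto
    next
      case False
      have "runs_within (program T) fn_argmax (enc_list (map Num (x # xs)))
         (val.Pair (Nat (Suc i)) (Num (xs ! i)) :: 'v val) (40 * length (x # xs))"
        using s False
        by - (rule runs_within_evaluate, rule run_program, simp add: argmax_body_def is_pair_enc_list[OF ne])
      then show ?thesis using i False by (intro exI[of _ "Suc i"]) auto
    qed
  qed
qed simp

lemma rows_maxsum_runs: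
  assumes "0 < T"
  shows "runs_within (program T) fn_maxsum (val.Pair (enc_row T f) (enc_row T b))
     (Num (Max ((\<lambda>y. f y + b y) ` {..<T}))) (40 * T)"
proof -
  have "set (map2 (+) (map f [0..<T]) (map b [0..<T])) = (\<lambda>y. f y + b y) ` {..<T}"
    by (auto simp: zip_map_map zip_same_conv_map)
  then show ?thesis
    using maxsum_runs[of "map f [0..<T]" "map b [0..<T]" T] assms
    by (simp add: enc_row_def comp_def)
qed

definition enc_context ::
  "nat \<Rightarrow> 'v val \<Rightarrow> 'v list \<Rightarrow> ('v \<times> (nat \<Rightarrow> ereal)) list \<Rightarrow> 'v \<Rightarrow> nat \<Rightarrow> 'v val" where
  "enc_context T net us ms u r =
     val.Pair net (val.Pair (enc_list (map Node us)) (val.Pair (enc_mods T ms) (val.Pair (Node u) (Nat r))))"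

lemma vector_runs:
  assumes CE: "\<And>y. y < T \<Longrightarrow> runs_within (program T) fn_CE (val.Pair (Nat y) c) (Num (F y)) A"
  shows "runs_within (program T) fn_vector (val.Pair (Nat T) (val.Pair Null c)) (enc_row T F)
           (T * (A + 40) + 40)"
proof -
  have "runs_within (program T) fn_vector
     (val.Pair (Nat k) (val.Pair (enc_list (map (\<lambda>y. Num (F y)) [k..<T])) c)) (enc_row T F)
     (k * (A + 40) + 40)" if "k \<le> T" for k
    using that
  proof (induction k)
    case 0
    show ?case by - (rule runs_within_evaluate, rule run_program, auto simp: vector_body_def enc_row_def)
  next
    case (Suc k)
    from Suc.prems have k: "k \<le> T" "k < T" by simp_all
    from Suc.IH[OF k(1)] obtain s where s: "run (program T) fn_vector
       (val.Pair (Nat k) (val.Pair (enc_list (map (\<lambda>y. Num (F y)) [k..<T])) c)) = Some (enc_row T F, s)"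
       "s \<le> k * (A + 40) + 40"
      by (rule runs_withinE)
    from CE[OF k(2)] obtain s'
      where s': "run (program T) fn_CE (val.Pair (Nat k) c) = Some (Num (F k), s')" "s' \<le> A"
      by (rule runs_withinE)
    have "[k..<T] = k # [Suc k..<T]" using Suc.prems upt_conv_Cons by simp
    with s s' show ?case
      by - (rule runs_within_evaluate, rule run_program, simp add: vector_body_def)
  qed
  from this[of T] show ?thesis by simp
qed

text \<open>
  The loop over the neighbours, abstracted from networks: \<open>ws = pre @ rest\<close> are all neighbours, \<open>pre\<close>
  those already treated, whose rows were pushed one by one and are therefore in reverse order, and
  \<open>b j\<close> is the vector that the recursive calls deliver for the \<open>j\<close>-th one.
\<close>

lemma sum_runs:
  fixes net :: "'v val" and us ws :: "'v list" and I :: "'v \<Rightarrow> nat \<Rightarrow> nat \<Rightarrow> ereal"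
  assumes T: "0 < T" and x: "x < T"
    and CE: "\<And>pre v post y. ws = pre @ v # post \<Longrightarrow> y < T \<Longrightarrow>
      runs_within (program T) fn_CE
        (val.Pair (Nat y) (enc_context T net us
           (map (\<lambda>w. (w, I w 0)) post @ rev (map (\<lambda>w. (w, I w x)) pre) @ ms) v r))
        (Num (b (length pre) y)) A"
    and ws: "ws = pre @ rest"
  shows "runs_within (program T) fn_sum
     (val.Pair net (val.Pair (enc_list (map Node us)) (val.Pair (Nat x) (val.Pair (Nat r)
       (val.Pair (enc_list (map (enc_entry T I) rest))
       (val.Pair (enc_mods T (rev (map (\<lambda>w. (w, I w x)) pre) @ ms)) (Num acc)))))))
     (Num (acc + (\<Sum>j = length pre..<length ws.
        Max ((\<lambda>y. I (ws ! j) x y + b j y) ` {..<T}) - Max ((\<lambda>y. I (ws ! j) 0 y + b j y) ` {..<T}))))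
     (length rest * (T * A + (150 * T + 40 * length ws + 300)) + 30)"
  using ws
proof (induction rest arbitrary: pre acc)
  case Nil
  show ?case
    using Nil by - (rule runs_within_evaluate, rule run_program, auto simp: sum_body_def)
next
  case (Cons v rest)
  let ?ms = "rev (map (\<lambda>w. (w, I w x)) pre) @ ms"
  let ?ms' = "rev (map (\<lambda>w. (w, I w x)) (pre @ [v])) @ ms"
  let ?b = "b (length pre)"
  define d where "d = Max ((\<lambda>y. I v x y + ?b y) ` {..<T}) - Max ((\<lambda>y. I v 0 y + ?b y) ` {..<T})"
  define tot where "tot p a = a + (\<Sum>j = length p..<length ws.
        Max ((\<lambda>y. I (ws ! j) x y + b j y) ` {..<T}) - Max ((\<lambda>y. I (ws ! j) 0 y + b j y) ` {..<T}))" for p :: "'v list" and a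
  have nth: "ws ! length pre = v" using Cons.prems by simp
  have "tot pre acc = tot (pre @ [v]) (acc + d)"
    unfolding tot_def using Cons.prems nth
    by (simp add: sum.atLeast_Suc_lessThan d_def ac_simps)
  moreover have IH: "runs_within (program T) fn_sum
     (val.Pair net (val.Pair (enc_list (map Node us)) (val.Pair (Nat x) (val.Pair (Nat r)
       (val.Pair (enc_list (map (enc_entry T I) rest))
       (val.Pair (enc_mods T ?ms') (Num (acc + d))))))))
     (Num (tot (pre @ [v]) (acc + d)))
     (length rest * (T * A + (150 * T + 40 * length ws + 300)) + 30)"
    using Cons.IH[of "pre @ [v]" "acc + d"] Cons.prems unfolding tot_def by simp
  moreover obtain s where s: "run (program T) fn_sum
     (val.Pair net (val.Pair (enc_list (map Node us)) (val.Pair (Nat x) (val.Pair (Nat r)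
       (val.Pair (enc_list (map (enc_entry T I) rest))
       (val.Pair (enc_mods T ?ms') (Num (acc + d)))))))) = Some (Num (tot (pre @ [v]) (acc + d)), s)"
     "s \<le> length rest * (T * A + (150 * T + 40 * length ws + 300)) + 30"
    using IH by (rule runs_withinE)
  ultimately have s: "run (program T) fn_sum
     (val.Pair net (val.Pair (enc_list (map Node us)) (val.Pair (Nat x) (val.Pair (Nat r)
       (val.Pair (enc_list (map (enc_entry T I) rest))
       (val.Pair (val.Pair (val.Pair (Node v) (enc_row T (I v x))) (enc_mods T ?ms))
         (Num (acc + d)))))))) = Some (Num (tot pre acc), s)"
     "s \<le> length rest * (T * A + (150 * T + 40 * length ws + 300)) + 30"
    by simp_all
  obtain s1 where s1: "run (program T) fn_nth
     (val.Pair (Nat x) (enc_list (map (\<lambda>x. enc_row T (I v x)) [0..<T]))) = Some (enc_row T (I v x) :: 'v val, s1)"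
     "s1 \<le> 30 * T"
    by (rule runs_withinE[OF table_nth_runs[OF x]])
  obtain s2 where s2: "run (program T) fn_suffix
     (val.Pair (enc_list (map (enc_entry T I) rest)) (enc_mods T ?ms)) =
     Some (enc_mods T (map (\<lambda>w. (w, I w 0)) rest @ ?ms), s2)" "s2 \<le> 40 * (length rest + 1)"
    by (rule runs_withinE[OF suffix_runs[OF T]])
  obtain s3 where s3: "run (program T) fn_vector (val.Pair (Nat T) (val.Pair Null
      (enc_context T net us (map (\<lambda>w. (w, I w 0)) rest @ ?ms) v r))) = Some (enc_row T ?b, s3)"
      "s3 \<le> T * (A + 40) + 40"
    by (rule runs_withinE[OF vector_runs[OF CE[OF Cons.prems]]])
  obtain s4 where s4: "run (program T) fn_maxsum (val.Pair (enc_row T (I v x)) (enc_row T ?b)) =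
     Some (Num (Max ((\<lambda>y. I v x y + ?b y) ` {..<T})) :: 'v val, s4)" "s4 \<le> 40 * T"
    by (rule runs_withinE[OF rows_maxsum_runs[OF T]])
  obtain s5 where s5: "run (program T) fn_maxsum (val.Pair (enc_row T (I v 0)) (enc_row T ?b)) =
     Some (Num (Max ((\<lambda>y. I v 0 y + ?b y) ` {..<T})) :: 'v val, s5)" "s5 \<le> 40 * T"
    by (rule runs_withinE[OF rows_maxsum_runs[OF T]])
  have len: "length rest \<le> length ws" using Cons.prems by simp
  show ?case
    unfolding tot_def[symmetric]
    using s s1 s2 s3 s4 s5 len
    by - (rule runs_within_evaluate, rule run_program, auto simp: sum_body_def enc_entry_parts table_first T d_def enc_context_def algebra_simps
             simp del: upt.simps)
qed

section \<open>Correctness and cost of the program\<close>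

text \<open>
  The network \<open>G\<close> arises from the input \<open>N\<close> by deleting the nodes \<open>us\<close> and adding the rows \<open>ms\<close> to the
  potentials.  Nothing is said about the potentials of deleted nodes.
\<close>

definition represents ::
  "'v network \<Rightarrow> 'v list \<Rightarrow> ('v \<times> (nat \<Rightarrow> ereal)) list \<Rightarrow> 'v network \<Rightarrow> bool" where
  "represents N us ms G \<longleftrightarrow>
     wf_network G \<and> nodes G = nodes N - set us \<and> acts G = acts N \<and>
     (\<forall>v\<in>nodes G. nbrs G v = filter (\<lambda>w. w \<notin> set us) (nbrs N v)) \<and>
     (\<forall>v\<in>nodes G. \<forall>w\<in>set (nbrs G v). \<forall>x<acts N. \<forall>y<acts N.
        interaction G v w x y = interaction N v w x y) \<and>
     (\<forall>v\<in>nodes G. \<forall>y<acts N. node_pot G v y = node_pot N v y + mods_sum ms v y)"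

lemma representsD:
  assumes "represents N us ms G"
  shows "wf_network G" "nodes G = nodes N - set us" "acts G = acts N"
    "v \<in> nodes G \<Longrightarrow> nbrs G v = filter (\<lambda>w. w \<notin> set us) (nbrs N v)"
    "v \<in> nodes G \<Longrightarrow> w \<in> set (nbrs G v) \<Longrightarrow> x < acts N \<Longrightarrow> y < acts N \<Longrightarrow>
       interaction G v w x y = interaction N v w x y"
    "v \<in> nodes G \<Longrightarrow> y < acts N \<Longrightarrow> node_pot G v y = node_pot N v y + mods_sum ms v y"
  using assms unfolding represents_def by blast+

lemma represents_self: "wf_network N \<Longrightarrow> represents N [] [] N"
  by (simp add: represents_def)

lemma mods_sum_append: "mods_sum (ms @ ms') u x = mods_sum ms u x + mods_sum ms' u x"
  by (simp add: mods_sum_def)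

lemma mods_sum_rev: "mods_sum (rev ms) u x = mods_sum ms u x"
  by (induction ms) (auto simp: mods_sum_append ac_simps)

lemma mods_sum_map:
  "distinct ws \<Longrightarrow> mods_sum (map (\<lambda>w. (w, F w)) ws) u x = (if u \<in> set ws then F u x else 0)"
  by (induction ws) auto

lemma interaction_subnetwork:
  assumes wf: "wf_network G" and "v \<in> nodes G - {u}" "w \<in> set (nbrs G v) - {u}" "y < acts G" "z < acts G"
  shows "interaction (subnetwork G u j x) v w y z = interaction G v w y z"
proof -
  have "(v, w) \<in> edges G \<or> (w, v) \<in> edges G"
    using assms wf_networkD(8)[OF wf, of v] by (auto simp: neighbours_def)
  then show ?thesis using assms unfolding interaction_def by auto
qed

text \<open>
  The neighbours of \<open>u\<close> are distinct, so each of them receives exactly one new row: for action \<open>x\<close> if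
  it precedes \<open>v\<close> and for action \<open>0\<close> if it follows \<open>v\<close>.
\<close>

lemma represents_subnetwork:
  assumes rep: "represents N us ms G" and u: "u \<in> nodes G" and x: "x < acts N"
    and nb: "nbrs G u = pre @ v # post"
  shows "represents N (u # us)
     (map (\<lambda>w. (w, interaction N u w 0)) post @ rev (map (\<lambda>w. (w, interaction N u w x)) pre) @ ms)
     (subnetwork G u (length pre) x)"
proof -
  note R = representsD[OF rep]
  note wf = R(1)
  have T: "0 < acts N" using wf_networkD(4)[OF wf] R(3) by simp
  have dist: "distinct (pre @ v # post)" using wf_networkD(7)[OF wf u] nb by simp
  have pot: "node_pot (subnetwork G u (length pre) x) w y = node_pot N w y + mods_sum
     (map (\<lambda>w. (w, interaction N u w 0)) post @ rev (map (\<lambda>w. (w, interaction N u w x)) pre) @ ms) w y"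
    if "w \<in> nodes G - {u}" "y < acts N" for w y
    using that dist R(3) R(5)[OF u, of w] R(6)[of w y] x T
    by (auto simp: nb mods_sum_append mods_sum_rev mods_sum_map ac_simps)
  show ?thesis
    unfolding represents_def
  proof (intro conjI ballI allI impI)
    fix w w' y z assume "w \<in> nodes (subnetwork G u (length pre) x)"
      "w' \<in> set (nbrs (subnetwork G u (length pre) x) w)" "y < acts N" "z < acts N"
    then show "interaction (subnetwork G u (length pre) x) w w' y z = interaction N w w' y z"
      using interaction_subnetwork[OF wf, of w u w' y z] R(3) R(5)[of w w'] by auto
  qed (use R wf_subnetwork[OF wf u] pot in
      \<open>auto simp: removeAll_filter_not_eq filter_filter intro: filter_cong\<close>)
qed

text \<open>
  The cost of one call without its recursive calls, for \<open>n\<close> nodes, total depth \<open>R\<close> and degree \<open>\<Delta>\<close>: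
  the terms pay for the lookup of the node, the removal of deleted neighbours, the two potentials,
  an access to a table, and the loop over the neighbours.
\<close>

definition call_cost :: "nat \<Rightarrow> nat \<Rightarrow> nat \<Rightarrow> nat \<Rightarrow> nat" where
  "call_cost T \<Delta> n R =
     30 * n + 60 * (\<Delta> + 1) * (R + 2) + 2 * (60 + 30 * T) * (\<Delta> * R + 1) + 30 * T +
     \<Delta> * (150 * T + 40 * \<Delta> + 300) + 200"

definition CE_cost :: "nat \<Rightarrow> nat \<Rightarrow> nat \<Rightarrow> nat \<Rightarrow> nat \<Rightarrow> nat" where
  "CE_cost T \<Delta> n R r = call_cost T \<Delta> n R * (\<Delta> * T + 1) ^ r"

text \<open>
  The recurrence of the running time: at most \<open>\<Delta>\<close> neighbours with \<open>T\<close> recursive calls each.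
\<close>

lemma CE_cost_Suc: "call_cost T \<Delta> n R + \<Delta> * (T * CE_cost T \<Delta> n R r) \<le> CE_cost T \<Delta> n R (Suc r)"
proof -
  have "call_cost T \<Delta> n R * 1 \<le> call_cost T \<Delta> n R * (\<Delta> * T + 1) ^ r"
    by (intro mult_left_mono) auto
  then show ?thesis by (simp add: CE_cost_def algebra_simps)
qed

lemma enc_node_parts:
  assumes "acts N = T"
  shows "enc_node N u = val.Pair (Node u) (val.Pair (enc_row T (node_pot N u))
     (enc_list (map (enc_entry T (interaction N u)) (nbrs N u))))"
  using assms by (simp add: enc_node_def enc_adj_def[abs_def] enc_row_def enc_entry_def[abs_def])

text \<open>
  Each level of the recursion deletes one node and adds at most \<open>\<Delta>\<close> rows, so that the
  lengths of both lists are controlled by the total depth \<open>R\<close>.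
\<close>

lemma CE_runs:
  fixes N :: "'v network" and vs :: "'v list"
  assumes N: "acts N = T" "set vs = nodes N" "\<And>v. v \<in> nodes N \<Longrightarrow> length (nbrs N v) \<le> \<Delta>"
    and rep: "represents N us ms G" and u: "u \<in> nodes G" and x: "x < T"
    and R: "length us + r \<le> R" and ms: "length ms \<le> \<Delta> * length us"
  shows "runs_within (program T) fn_CE
     (val.Pair (Nat x) (enc_context T (enc_list (map (enc_node N) vs)) us ms u r))
     (Num (CE G u r x)) (CE_cost T \<Delta> (length vs) R r)"
  using rep u x R ms
proof (induction r arbitrary: us ms G u x)
  case 0
  have "40 \<le> CE_cost T \<Delta> (length vs) R 0" by (simp add: CE_cost_def call_cost_def)
  then show ?case
    by - (rule runs_within_evaluate, rule run_program,
      simp add: CE_body_def enc_context_def CE_simps zero_ereal_def)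
next
  case (Suc r)
  let ?net = "enc_list (map (enc_node N) vs)" and ?A = "CE_cost T \<Delta> (length vs) R r"
  let ?I = "interaction N u" and ?ws = "nbrs G u"
  note rep = Suc.prems(1) and x = Suc.prems(3)
  note rD = representsD[OF rep]
  have u: "u \<in> nodes G" "u \<in> nodes N" "u \<in> set vs" using Suc.prems(2) rD(2) N(2) by auto
  have T: "0 < T" using x by simp
  have aG: "acts G = T" using rD(3) N(1) by simp
  have nb: "?ws = filter (\<lambda>w. w \<notin> set us) (nbrs N u)" by (rule rD(4)[OF u(1)])
  have deg: "length (nbrs N u) \<le> \<Delta>" "length ?ws \<le> \<Delta>"
    using N(3)[OF u(2)] unfolding nb by (auto intro: le_trans[OF length_filter_le])
  define b where "b j = CE (subnetwork G u j x) (?ws ! j) r" for j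
  have CE: "runs_within (program T) fn_CE
        (val.Pair (Nat y) (enc_context T ?net (u # us)
           (map (\<lambda>w. (w, ?I w 0)) post @ rev (map (\<lambda>w. (w, ?I w x)) pre) @ ms) v r))
        (Num (b (length pre) y)) ?A"
    if ws: "?ws = pre @ v # post" and y: "y < T" for pre v post y
  proof -
    have v: "?ws ! length pre = v" "length pre < length ?ws" using ws by auto
    have "v \<in> nodes (subnetwork G u (length pre) x)"
      using nbrs_nth[OF rD(1) u(1) v(2)] v(1) by simp
    moreover have "length (map (\<lambda>w. (w, ?I w 0)) post @ rev (map (\<lambda>w. (w, ?I w x)) pre) @ ms)
        \<le> \<Delta> * length (u # us)"
      using Suc.prems(5) deg(2) ws by simp
    ultimately show ?thesis
      unfolding b_def v(1) using Suc.prems(4) y x N(1)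
      by (intro Suc.IH represents_subnetwork[OF rep u(1) _ ws]) simp_all
  qed
  define acc where "acc = node_pot G u x - node_pot G u 0"
  have total: "acc + (\<Sum>j = length []..<length ?ws.
        Max ((\<lambda>y. ?I (?ws ! j) x y + b j y) ` {..<T}) - Max ((\<lambda>y. ?I (?ws ! j) 0 y + b j y) ` {..<T}))
      = CE G u (Suc r) x"
  proof -
    have "partial_cavity G u (?ws ! j) x (b j) =
       Max ((\<lambda>y. ?I (?ws ! j) x y + b j y) ` {..<T}) - Max ((\<lambda>y. ?I (?ws ! j) 0 y + b j y) ` {..<T})"
      if "j < length ?ws" for j
      unfolding partial_cavity_def aG
      using rD(5)[OF u(1) nbrs_nth(3)[OF rD(1) u(1) that]] x T N(1)
      by (intro arg_cong2[of _ _ _ _ "(-)"] arg_cong[of _ _ Max] image_cong) auto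
    then show ?thesis
      unfolding CE_simps acc_def b_def[symmetric] by (simp add: atLeast0LessThan)
  qed
  have "?ws = [] @ ?ws" by simp
  from sum_runs[OF T x CE this, where acc = acc, unfolded total] obtain s where
    s: "run (program T) fn_sum
     (val.Pair ?net (val.Pair (enc_list (map Node (u # us))) (val.Pair (Nat x) (val.Pair (Nat r)
       (val.Pair (enc_list (map (enc_entry T ?I) ?ws))
       (val.Pair (enc_mods T ms) (Num acc))))))) = Some (Num (CE G u (Suc r) x), s)"
     "s \<le> length ?ws * (T * ?A + (150 * T + 40 * length ?ws + 300)) + 30"
    by (auto elim: runs_withinE)
  have "s \<le> \<Delta> * (T * ?A + (150 * T + 40 * \<Delta> + 300)) + 30"
    using s(2) by (rule order_trans) (use deg(2) in \<open>intro add_mono mult_mono; simp\<close>)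
  then have s_le: "s \<le> \<Delta> * (T * ?A) + \<Delta> * (150 * T + 40 * \<Delta> + 300) + 30"
    by (simp add: algebra_simps)
  from lookup_runs[OF u(3), of T N] obtain s1 where s1:
    "run (program T) fn_lookup (val.Pair (Node u) ?net) = Some (enc_node N u, s1)" "s1 \<le> 30 * length vs"
    by (rule runs_withinE)
  from remove_runs[of T us "\<lambda>w. enc_list (map (\<lambda>x. enc_row T (?I w x)) [0..<T])" "nbrs N u"]
  obtain s2 where s2: "run (program T) fn_remove
     (val.Pair (enc_list (map Node us)) (enc_list (map (enc_entry T ?I) (nbrs N u)))) =
     Some (enc_list (map (enc_entry T ?I) ?ws), s2)"
     "s2 \<le> 60 * (length (nbrs N u) + 1) * (length us + 2)"
    unfolding nb enc_entry_def[symmetric] by (rule runs_withinE)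
  have "s2 \<le> 60 * (\<Delta> + 1) * (R + 2)"
    using s2(2) by (rule order_trans) (use deg(1) Suc.prems(4) in \<open>intro mult_mono; simp\<close>)
  note s2 = s2(1) this
  have msR: "length ms \<le> \<Delta> * R"
    using Suc.prems(5) by (rule order_trans) (use Suc.prems(4) in simp)
  from row_nth_runs[OF x, of "node_pot N u"] obtain s3 where
    s3: "run (program T) fn_nth (val.Pair (Nat x) (enc_row T (node_pot N u))) =
      Some (Num (node_pot N u x) :: 'v val, s3)" "s3 \<le> 30 * T"
    by (rule runs_withinE)
  have pot: "\<exists>s. run (program T) fn_potential
     (val.Pair (val.Pair (Node u) (Nat y)) (val.Pair (Num (node_pot N u y)) (enc_mods T ms))) =
     Some (Num (node_pot G u y), s) \<and> s \<le> (60 + 30 * T) * (\<Delta> * R + 1)" if y: "y < T" for y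
  proof -
    from potential_runs[OF y, of u "node_pot N u y" ms] obtain s where
      s: "run (program T) fn_potential
     (val.Pair (val.Pair (Node u) (Nat y)) (val.Pair (Num (node_pot N u y)) (enc_mods T ms))) =
     Some (Num (node_pot N u y + mods_sum ms u y), s)" "s \<le> (60 + 30 * T) * (length ms + 1)"
      by (rule runs_withinE)
    have "s \<le> (60 + 30 * T) * (\<Delta> * R + 1)"
      using s(2) by (rule order_trans) (use msR in \<open>intro mult_mono; simp\<close>)
    then show ?thesis using s(1) rD(6)[OF u(1)] y N(1) by auto
  qed
  from pot[OF x] obtain s4 where s4: "run (program T) fn_potential
     (val.Pair (val.Pair (Node u) (Nat x)) (val.Pair (Num (node_pot N u x)) (enc_mods T ms))) =
     Some (Num (node_pot G u x), s4)" "s4 \<le> (60 + 30 * T) * (\<Delta> * R + 1)" by auto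
  from pot[OF T] obtain s5 where s5: "run (program T) fn_potential
     (val.Pair (val.Pair (Node u) (Nat 0)) (val.Pair (Num (node_pot N u 0)) (enc_mods T ms))) =
     Some (Num (node_pot G u 0), s5)" "s5 \<le> (60 + 30 * T) * (\<Delta> * R + 1)" by auto
  have first: "app1 Fst (enc_row T f) = Some (Num (f 0))" for f
    using T by (simp add: enc_row_def upt_conv_Cons)
  have cost: "s + s1 + s2 + s3 + s4 + s5 + 150 \<le> CE_cost T \<Delta> (length vs) R (Suc r)"
    by (rule order_trans[OF _ CE_cost_Suc])
       (use s_le s1(2) s2(2) s3(2) s4(2) s5(2) in \<open>simp add: call_cost_def algebra_simps\<close>)
  show ?case
    using s(1) s1(1) s2(1) s3(1) s4(1) s5(1) cost
    by - (rule runs_within_evaluate, rule run_program,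
      simp add: CE_body_def enc_context_def enc_node_parts[OF N(1), of u] first acc_def)
qed

lemma solve_runs:
  fixes N :: "'v network" and vs :: "'v list"
  assumes wf: "wf_network N" and N: "acts N = T" "set vs = nodes N" "\<And>v. v \<in> nodes N \<Longrightarrow> length (nbrs N v) \<le> \<Delta>"
    and ws: "set ws \<subseteq> nodes N" "distinct ws"
  shows "\<exists>z. (\<forall>v\<in>set ws. z v < T \<and> (\<forall>a<T. CE N v r a \<le> CE N v r (z v))) \<and>
     runs_within (program T) fn_solve
       (val.Pair (enc_list (map (enc_node N) ws)) (val.Pair (enc_list (map (enc_node N) vs)) (Nat r)))
       (enc_solution ws z) (length ws * (T * CE_cost T \<Delta> (length vs) r r + 80 * T + 100) + 10)"
  using ws
proof (induction ws)
  case Nil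
  show ?case
    by (intro exI conjI runs_within_evaluate, simp, rule run_program) (simp add: solve_body_def enc_solution_def)
next
  case (Cons w ws)
  let ?net = "enc_list (map (enc_node N) vs)"
  have T: "0 < T" using wf_networkD(4)[OF wf] N(1) by simp
  from Cons obtain z where z: "\<forall>v\<in>set ws. z v < T \<and> (\<forall>a<T. CE N v r a \<le> CE N v r (z v))"
    and r: "runs_within (program T) fn_solve
       (val.Pair (enc_list (map (enc_node N) ws)) (val.Pair ?net (Nat r)))
       (enc_solution ws z) (length ws * (T * CE_cost T \<Delta> (length vs) r r + 80 * T + 100) + 10)" by auto
  from r obtain s where s: "run (program T) fn_solve
       (val.Pair (enc_list (map (enc_node N) ws)) (val.Pair ?net (Nat r))) = Some (enc_solution ws z, s)"
     "s \<le> length ws * (T * CE_cost T \<Delta> (length vs) r r + 80 * T + 100) + 10" by (rule runs_withinE)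
  have "runs_within (program T) fn_vector (val.Pair (Nat T) (val.Pair Null (enc_context T ?net [] [] w r)))
     (enc_row T (CE N w r)) (T * (CE_cost T \<Delta> (length vs) r r + 40) + 40)"
    using Cons.prems by (intro vector_runs CE_runs N represents_self wf) auto
  then obtain s1 where s1: "run (program T) fn_vector
      (val.Pair (Nat T) (val.Pair Null (enc_context T ?net [] [] w r))) = Some (enc_row T (CE N w r), s1)"
    "s1 \<le> T * (CE_cost T \<Delta> (length vs) r r + 40) + 40" by (rule runs_withinE)
  have "map (CE N w r) [0..<T] \<noteq> []" using T by simp
  from argmax_runs[where 'v = 'v, OF this, of T] obtain i where
    i: "i < T" "\<forall>a<T. CE N w r a \<le> CE N w r i" and
    r2: "runs_within (program T) fn_argmax (enc_row T (CE N w r) :: 'v val) (val.Pair (Nat i) (Num (CE N w r i))) (40 * T)"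
    by (auto simp: enc_row_def comp_def)
  from r2 obtain s2 where s2: "run (program T) fn_argmax (enc_row T (CE N w r) :: 'v val) =
      Some (val.Pair (Nat i) (Num (CE N w r i)), s2)" "s2 \<le> 40 * T" by (rule runs_withinE)
  let ?z = "z(w := i)"
  have enc: "enc_solution (w # ws) ?z = val.Pair (val.Pair (Node w) (Nat i)) (enc_solution ws z)"
    using Cons.prems by (auto simp: enc_solution_def intro!: arg_cong[of _ _ enc_list])
  have "s + s1 + s2 + 60 \<le> length (w # ws) * (T * CE_cost T \<Delta> (length vs) r r + 80 * T + 100) + 10"
    using s(2) s1(2) s2(2) by (simp add: algebra_simps)
  then have "runs_within (program T) fn_solve
       (val.Pair (enc_list (map (enc_node N) (w # ws))) (val.Pair ?net (Nat r)))
       (enc_solution (w # ws) ?z) (length (w # ws) * (T * CE_cost T \<Delta> (length vs) r r + 80 * T + 100) + 10)"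
    unfolding enc using s(1) s1(1) s2(1)
    by - (rule runs_within_evaluate, rule run_program,
      simp add: solve_body_def enc_context_def enc_node_parts[OF N(1), of w])
  moreover have "\<forall>v\<in>set (w # ws). ?z v < T \<and> (\<forall>a<T. CE N v r a \<le> CE N v r (?z v))"
    using z i by auto
  ultimately show ?case by blast
qed

theorem program_correct:
  fixes N :: "'v network" and vs :: "'v list"
  assumes net: "decision_network N" and N: "acts N = T" "\<And>v. v \<in> nodes N \<Longrightarrow> card (neighbours N v) \<le> \<Delta>"
    and vs: "distinct vs" "set vs = nodes N"
  shows "\<exists>z t. CE_argmax N r z \<and> runs (program T) (enc_input N vs r) (enc_solution vs z) t \<and>
     t \<le> length vs * (T * CE_cost T \<Delta> (length vs) r r + 80 * T + 100) + 30"
proof -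
  have wf: "wf_network N" by (rule decision_network_wf[OF net])
  have "length (nbrs N v) \<le> \<Delta>" if "v \<in> nodes N" for v
    using N(2)[OF that] wf_networkD(7,8)[OF wf that] distinct_card by metis
  from solve_runs[where r = r, OF wf N(1) vs(2) this, of vs] vs obtain z where
    z: "\<forall>v\<in>nodes N. z v < T \<and> (\<forall>a<T. CE N v r a \<le> CE N v r (z v))" and
    r: "runs_within (program T) fn_solve
       (val.Pair (enc_list (map (enc_node N) vs)) (val.Pair (enc_list (map (enc_node N) vs)) (Nat r)))
       (enc_solution vs z) (length vs * (T * CE_cost T \<Delta> (length vs) r r + 80 * T + 100) + 10)"
    by auto
  from r obtain s where s: "run (program T) fn_solve
       (val.Pair (enc_list (map (enc_node N) vs)) (val.Pair (enc_list (map (enc_node N) vs)) (Nat r))) =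
      Some (enc_solution vs z, s)"
    "s \<le> length vs * (T * CE_cost T \<Delta> (length vs) r r + 80 * T + 100) + 10" by (rule runs_withinE)
  have "runs_within (program T) fn_main (enc_input N vs r) (enc_solution vs z) (s + 20)"
    using s(1) by - (rule runs_within_evaluate, rule run_program, simp add: main_body_def enc_input_def)
  then obtain t where t: "run (program T) fn_main (enc_input N vs r) = Some (enc_solution vs z, t)"
    "t \<le> s + 20" by (rule runs_withinE)
  then have "runs (program T) (enc_input N vs r) (enc_solution vs z) t"
    by (simp add: runs_def run_eq_Some program_def)
  moreover have "CE_argmax N r z" using z N(1) by (simp add: CE_argmax_def)
  ultimately show ?thesis using s(2) t(2) by (intro exI[of _ z] exI[of _ t]) auto
qed

section \<open>Polynomial running time\<close>

text \<open>
  The linear dependence on the depth is absorbed into an exponential, since exponentials in the depth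
  are polynomial anyway.
\<close>

lemma call_cost_le:
  "\<exists>c. \<forall>n R. call_cost T \<Delta> n R \<le> c * ((n + 1) * 2 ^ R)"
proof -
  define d where "d = \<Delta> * (150 * T + 40 * \<Delta> + 300)"
  define c where "c = 30 + 60 * (\<Delta> + 1) * 2 + 2 * (60 + 30 * T) * (\<Delta> + 1) + 30 * T + d + 200"
  have "call_cost T \<Delta> n R \<le> c * ((n + 1) * 2 ^ R)" for n R
  proof -
    define X where "X = n + R + 1"
    have X: "n \<le> X" "R + 2 \<le> 2 * X" "R \<le> X" "1 \<le> X" by (simp_all add: X_def)
    have "60 * (\<Delta> + 1) * (R + 2) \<le> 60 * (\<Delta> + 1) * 2 * X"
      using mult_left_mono[OF X(2), of "60 * (\<Delta> + 1)"] by (simp only: mult.assoc)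
    moreover have "\<Delta> * R + 1 \<le> (\<Delta> + 1) * X"
      using add_mono[OF mult_left_mono[OF X(3), of \<Delta>] X(4)] by (simp only: distrib_right mult_1)
    then have "2 * (60 + 30 * T) * (\<Delta> * R + 1) \<le> 2 * (60 + 30 * T) * (\<Delta> + 1) * X"
      unfolding mult.assoc[of _ "\<Delta> + 1" X] by (rule mult_left_mono) simp
    moreover have "30 * n \<le> 30 * X" "30 * T \<le> 30 * T * X" "d \<le> d * X" "200 \<le> 200 * X"
      using X by simp_all
    ultimately have "call_cost T \<Delta> n R \<le> c * X"
      unfolding call_cost_def d_def[symmetric] c_def distrib_right[of _ _ X] by linarith
    moreover have "X \<le> (n + 1) * 2 ^ R"
    proof -
      have "X \<le> (n + 1) * (R + 1)" by (simp add: X_def)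
      also have "\<dots> \<le> (n + 1) * 2 ^ R"
        using less_exp[of R] by (intro mult_left_mono) (auto simp: Suc_le_eq)
      finally show ?thesis .
    qed
    then have "c * X \<le> c * ((n + 1) * 2 ^ R)" by (rule mult_left_mono) simp
    ultimately show ?thesis by linarith
  qed
  then show ?thesis by blast
qed

lemma max_reciprocal_ge_1:
  fixes \<epsilon> :: real
  assumes "0 < \<epsilon>"
  shows "1 \<le> max \<epsilon> (1 / \<epsilon>)"
  using assms by (cases "\<epsilon> \<ge> 1") (auto simp: le_max_iff_disj)

text \<open>
  With \<open>B = n + max \<epsilon> (1/\<epsilon>)\<close>, both \<open>|ln \<epsilon>|\<close> and the number of nodes and edges contribute at most
  \<open>ln B\<close> up to a constant.  For \<open>n = 0\<close> this uses \<open>ln 0 = 0\<close>.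
\<close>

lemma depth_le_log:
  assumes T: "0 < T" and pos: "0 < g" "0 < K_Phi" "0 < K_c" and \<alpha>: "0 < \<alpha>" "\<alpha> < 1"
  shows "\<exists>p q. 0 \<le> p \<and> 0 \<le> q \<and> (\<forall>n m r. \<forall>\<epsilon>>0. m \<le> \<Delta> * n \<longrightarrow>
     r = (LEAST r::nat. 0 < r \<and> real r \<ge> depth_bound T g K_Phi K_c \<alpha> n m \<epsilon>) \<longrightarrow>
     real r \<le> p * ln (real n + max \<epsilon> (1 / \<epsilon>)) + q)"
proof -
  define a where "a = \<bar>ln \<alpha>\<bar>"
  have a: "a > 0" using \<alpha> by (simp add: a_def)
  define \<kappa> where "\<kappa> = 10 * K_Phi * real T * (g * K_c) powr (1 / 4)"
  have \<kappa>: "\<kappa> > 0" using T pos by (simp add: \<kappa>_def)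
  define h where "h = \<bar>ln \<kappa>\<bar> + ln (1 + real \<Delta>)"
  have h: "h \<ge> 0" by (simp add: h_def)
  have "real r \<le> 12 / a * ln B + (4 * h / a + 1)"
    if \<epsilon>: "\<epsilon> > 0" and m: "m \<le> \<Delta> * n"
      and r: "r = (LEAST r::nat. 0 < r \<and> real r \<ge> depth_bound T g K_Phi K_c \<alpha> n m \<epsilon>)"
      and B: "B = real n + max \<epsilon> (1 / \<epsilon>)" for n m r \<epsilon> B
  proof -
    have max1: "max \<epsilon> (1 / \<epsilon>) \<ge> 1" by (rule max_reciprocal_ge_1[OF \<epsilon>])
    have B1: "B \<ge> 1" "B \<ge> n" using max1 B by auto
    have "\<bar>ln \<epsilon>\<bar> \<le> ln (max \<epsilon> (1 / \<epsilon>))"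
    proof -
      have "max \<epsilon> (1 / \<epsilon>) > 0" using max1 by linarith
      then have 1: "ln \<epsilon> \<le> ln (max \<epsilon> (1 / \<epsilon>))" and 2: "ln (1 / \<epsilon>) \<le> ln (max \<epsilon> (1 / \<epsilon>))"
        using \<epsilon> by (simp_all only: ln_le_cancel_iff max.cobounded1 max.cobounded2 divide_pos_pos zero_less_one)
      have "ln (1 / \<epsilon>) = - ln \<epsilon>" using \<epsilon> by (simp add: ln_div)
      with 1 2 show ?thesis by linarith
    qed
    also have "\<dots> \<le> ln B" using max1 B by simp
    finally have ln_eps: "\<bar>ln \<epsilon>\<bar> \<le> ln B" .
    define K2 where "K2 = \<kappa> * real (n + m)"
    have ln_K2: "\<bar>ln K2\<bar> \<le> h + ln B"
    proof (cases "n = 0")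
      case True
      then show ?thesis using m B1 h by (simp add: K2_def)
    next
      case False
      have "real m \<le> real (\<Delta> * n)" using m by (rule of_nat_mono)
      then have "real (n + m) \<le> (1 + real \<Delta>) * real n" by (simp add: distrib_right)
      also have "\<dots> \<le> (1 + real \<Delta>) * B" using B1 by (intro mult_left_mono) auto
      finally have "ln (real (n + m)) \<le> ln ((1 + real \<Delta>) * B)"
        using False by simp
      also have "\<dots> = ln (1 + real \<Delta>) + ln B" using B1 by (simp add: ln_mult add_pos_nonneg)
      finally have "ln (real (n + m)) \<le> ln (1 + real \<Delta>) + ln B" .
      moreover have "ln K2 = ln \<kappa> + ln (real (n + m))"
        unfolding K2_def using \<kappa> False by (intro ln_mult_pos) auto
      moreover have "ln (real (n + m)) \<ge> 0" using False by (intro ln_ge_zero) linarith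
      ultimately show ?thesis by (simp add: h_def)
    qed
    define b where "b = depth_bound T g K_Phi K_c \<alpha> n m \<epsilon>"
    have b: "b = (8 * \<bar>ln \<epsilon>\<bar> + 4 * \<bar>ln K2\<bar>) / a"
    proof -
      have "10 * K_Phi * real T * real (n + m) * (g * K_c) powr (1 / 4) = K2"
        by (simp only: K2_def \<kappa>_def mult.assoc mult.commute mult.left_commute)
      then show ?thesis
        by (simp only: b_def depth_bound_def a_def Let_def divide_inverse)
    qed
    have b0: "b \<ge> 0" unfolding b using a by simp
    have "b \<le> (12 * ln B + 4 * h) / a"
      unfolding b using a ln_eps ln_K2 by (intro divide_right_mono) auto
    also have "\<dots> = 12 / a * ln B + 4 * h / a" by (simp add: add_divide_distrib)
    finally have b_le: "b \<le> 12 / a * ln B + 4 * h / a" .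
    have "r \<le> nat \<lfloor>b\<rfloor> + 1"
      unfolding r b_def[symmetric] using b0 by (intro Least_le) linarith
    then have "real r \<le> b + 1" using b0 by linarith
    with b_le show ?thesis by simp
  qed
  note bound = this
  show ?thesis
  proof (intro exI conjI allI impI)
    show "0 \<le> 12 / a" "0 \<le> 4 * h / a + 1" using a h by simp_all
  qed (rule bound[OF _ _ _ refl])
qed

text \<open>
  \<open>D ^ r \<le> D powr (p ln B + q)\<close>, which is a constant multiple of \<open>B powr (p ln D)\<close>.
\<close>

lemma running_time_polynomial:
  assumes "0 < T" "0 < g" "0 < K_Phi" "0 < K_c" "0 < \<alpha>" "\<alpha> < 1"
  shows "\<exists>c k. \<forall>n m r. \<forall>\<epsilon>>0. m \<le> \<Delta> * n \<longrightarrow>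
     r = (LEAST r::nat. 0 < r \<and> real r \<ge> depth_bound T g K_Phi K_c \<alpha> n m \<epsilon>) \<longrightarrow>
     real (n * (T * CE_cost T \<Delta> n r r + 80 * T + 100) + 30) \<le> c * (real n + max \<epsilon> (1 / \<epsilon>)) ^ k"
proof -
  obtain c0 where c0: "\<And>n R. call_cost T \<Delta> n R \<le> c0 * ((n + 1) * 2 ^ R)"
    using call_cost_le by blast
  obtain p q where pq: "0 \<le> p" "0 \<le> q" and r_le: "\<And>n m r \<epsilon>. \<epsilon> > 0 \<Longrightarrow> m \<le> \<Delta> * n \<Longrightarrow>
     r = (LEAST r::nat. 0 < r \<and> real r \<ge> depth_bound T g K_Phi K_c \<alpha> n m \<epsilon>) \<Longrightarrow>
     real r \<le> p * ln (real n + max \<epsilon> (1 / \<epsilon>)) + q"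
    using depth_le_log[OF assms, of \<Delta>] by blast
  \<comment> \<open>The factor \<open>2\<close> pays for the power of \<open>2\<close> in the bound on \<open>call_cost\<close>.\<close>
  define D where "D = 2 * (real (\<Delta> * T) + 1)"
  have D: "D > 0" "ln D \<ge> 0" by (auto simp: D_def intro!: add_nonneg_pos ln_ge_zero)
  define k where "k = nat \<lceil>p * ln D\<rceil>"
  define c1 where "c1 = exp (q * ln D)"
  define c where "c = real T * (real c0 * c1) + 80 * real T + 130"
  have "real (n * (T * CE_cost T \<Delta> n r r + 80 * T + 100) + 30) \<le> c * B ^ (k + 2)"
    if \<epsilon>: "\<epsilon> > 0" and m: "m \<le> \<Delta> * n"
      and r: "r = (LEAST r::nat. 0 < r \<and> real r \<ge> depth_bound T g K_Phi K_c \<alpha> n m \<epsilon>)"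
      and B: "B = real n + max \<epsilon> (1 / \<epsilon>)" for n m r \<epsilon> B
  proof -
    have max1: "max \<epsilon> (1 / \<epsilon>) \<ge> 1" by (rule max_reciprocal_ge_1[OF \<epsilon>])
    have B1: "B \<ge> 1" "B \<ge> real n + 1" using max1 B by auto
    have "D ^ r = exp (real r * ln D)" using D by (simp add: exp_of_nat_mult)
    also have "\<dots> \<le> exp ((p * ln B + q) * ln D)"
      using r_le[OF \<epsilon> m r] D(2) B by (simp add: mult_right_mono)
    also have "\<dots> = c1 * B powr (p * ln D)"
      using B1 by (simp add: c1_def powr_def exp_add[symmetric] algebra_simps)
    also have "\<dots> \<le> c1 * B powr real k"
      using B1 by (intro mult_left_mono powr_mono) (auto simp: c1_def k_def intro: real_nat_ceiling_ge)
    also have "\<dots> = c1 * B ^ k" using B1 by (simp add: powr_realpow)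
    finally have Dr: "D ^ r \<le> c1 * B ^ k" .
    have "real (call_cost T \<Delta> n r) \<le> real c0 * (real n + 1) * 2 ^ r"
    proof -
      have "real (call_cost T \<Delta> n r) \<le> real (c0 * ((n + 1) * 2 ^ r))"
        using c0[of n r] by (rule of_nat_mono)
      also have "\<dots> = real c0 * (real n + 1) * 2 ^ r" by (simp add: algebra_simps)
      finally show ?thesis .
    qed
    then have "real (call_cost T \<Delta> n r) * (real (\<Delta> * T) + 1) ^ r \<le>
        real c0 * (real n + 1) * 2 ^ r * (real (\<Delta> * T) + 1) ^ r"
      by (rule mult_right_mono) simp
    then have "real (CE_cost T \<Delta> n r r) \<le> real c0 * (real n + 1) * D ^ r"
      unfolding D_def power_mult_distrib by (simp add: CE_cost_def add.commute mult.assoc)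
    also have "\<dots> \<le> real c0 * B * (c1 * B ^ k)"
      using B1 Dr D(1) by (intro mult_mono) auto
    finally have CE: "real (CE_cost T \<Delta> n r r) \<le> real c0 * c1 * B ^ (k + 1)"
      by (simp add: ac_simps)
    have Bk: "1 \<le> B ^ (k + 1)" "1 \<le> B ^ (k + 2)" using B1 by (auto intro: one_le_power simp del: power_Suc)
    have "real (n * (T * CE_cost T \<Delta> n r r + 80 * T + 100) + 30) =
        real n * (real T * real (CE_cost T \<Delta> n r r) + (80 * real T + 100) * 1) + 30 * 1"
      by (simp add: algebra_simps)
    also have "\<dots> \<le> B * (real T * (real c0 * c1 * B ^ (k + 1)) + (80 * real T + 100) * B ^ (k + 1)) + 30 * B ^ (k + 2)"
      using B1 CE Bk by (intro add_mono mult_mono) (auto simp: c1_def)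
    also have "\<dots> = c * B ^ (k + 2)"
      by (simp add: c_def algebra_simps)
    finally show ?thesis .
  qed
  note bound = this
  show ?thesis by (intro exI allI impI) (rule bound[OF _ _ _ refl])
qed

lemma card_edges_le:
  assumes wf: "wf_network N" and deg: "\<And>v. v \<in> nodes N \<Longrightarrow> card (neighbours N v) \<le> \<Delta>"
  shows "card (edges N) \<le> \<Delta> * card (nodes N)"
proof -
  note D = wf_networkD[OF wf]
  have fin: "finite (neighbours N v)" for v
    using D(1,2) by (auto simp: neighbours_def intro: finite_subset[of _ "nodes N"])
  have "edges N \<subseteq> Sigma (nodes N) (neighbours N)"
    using D(2) by (auto simp: neighbours_def)
  then have "card (edges N) \<le> card (Sigma (nodes N) (neighbours N))"
    using D(1) fin by (intro card_mono finite_SigmaI) auto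
  also have "\<dots> = (\<Sum>v\<in>nodes N. card (neighbours N v))"
    using D(1) fin by simp
  also have "\<dots> \<le> \<Delta> * card (nodes N)"
    using sum_bounded_above[of "nodes N" "\<lambda>v. card (neighbours N v)" \<Delta>] deg by (simp add: mult.commute)
  finally show ?thesis .
qed

section \<open>The corollary\<close>

theorem corollary2:
  fixes M :: "'w measure"
    and V :: "'v set" and E :: "('v \<times> 'v) set" and nb :: "'v \<Rightarrow> 'v list"
    and T :: nat
    and G :: "'w \<Rightarrow> 'v network"
    and g K_Phi K_c \<alpha>\<^sub>c :: real
  assumes network: "random_decision_network M V E nb T G"
    and g_pos: "0 < g"
    and density: "cavity_densities_bounded M V T G g"
    and K_Phi_pos: "0 < K_Phi"
    and moments: "second_moments_bounded M V E T G K_Phi"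
    and rate: "0 < \<alpha>\<^sub>c" "\<alpha>\<^sub>c < 1"
    and K_c_pos: "0 < K_c"
    and decay: "exp_correlation_decay M V T G \<alpha>\<^sub>c K_c"
  shows
    "(AE \<omega> in M. \<exists>!x. optimal_solution (G \<omega>) x) \<and>
     (\<forall>\<epsilon>>0. \<forall>r::nat. real r \<ge> depth_bound T g K_Phi K_c \<alpha>\<^sub>c (card V) (card E) \<epsilon> \<longrightarrow>
        (\<forall>x xr. (\<forall>\<omega>\<in>space M. optimal_solution (G \<omega>) (x \<omega>)) \<longrightarrow>
                (\<forall>\<omega>\<in>space M. CE_argmax (G \<omega>) r (xr \<omega>)) \<longrightarrow>
           \<comment> \<open>outer measure, as an arbitrary tie-breaking need not depend measurably on \<open>\<omega>\<close>;
               it is the probability whenever the event is measurable\<close>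
           outer_measure_of M
             {\<omega>\<in>space M. objective (G \<omega>) (x \<omega>) - objective (G \<omega>) (xr \<omega>) > ereal \<epsilon>}
             \<le> ennreal \<epsilon>)) \<and>
     \<comment> \<open>the program and the polynomial depend on the fixed constants only;
         \<open>N\<close> is any realisation of any network with these constants\<close>
     (\<forall>\<Delta>::nat. \<exists>P c k. \<forall>N :: 'v network.
        decision_network N \<and> acts N = T \<and> (\<forall>v\<in>nodes N. card (neighbours N v) \<le> \<Delta>) \<longrightarrow>
        (\<forall>\<epsilon>>0. \<forall>r vs.
           r = (LEAST r::nat. 0 < r \<and>
                  real r \<ge> depth_bound T g K_Phi K_c \<alpha>\<^sub>c (card (nodes N)) (card (edges N)) \<epsilon>) \<longrightarrow>
           distinct vs \<and> set vs = nodes N \<longrightarrow>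
           (\<exists>xr t. CE_argmax N r xr \<and>
              runs P (enc_input N vs r) (enc_solution vs xr) t \<and>
              real t \<le> c * (real (card (nodes N)) + max \<epsilon> (1 / \<epsilon>)) ^ k)))"
proof (intro conjI)
  have T: "0 < T"
    using random_graph(4)[OF random_network_wf[OF network moments]] .
  show "AE \<omega> in M. \<exists>!x. optimal_solution (G \<omega>) x"
    by (rule unique_optimum_AE[OF random_network_wf[OF network moments] g_pos density])
  show "\<forall>\<epsilon>>0. \<forall>r::nat. real r \<ge> depth_bound T g K_Phi K_c \<alpha>\<^sub>c (card V) (card E) \<epsilon> \<longrightarrow>
        (\<forall>x xr. (\<forall>\<omega>\<in>space M. optimal_solution (G \<omega>) (x \<omega>)) \<longrightarrow>
                (\<forall>\<omega>\<in>space M. CE_argmax (G \<omega>) r (xr \<omega>)) \<longrightarrow>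
           outer_measure_of M
             {\<omega>\<in>space M. objective (G \<omega>) (x \<omega>) - objective (G \<omega>) (xr \<omega>) > ereal \<epsilon>}
             \<le> ennreal \<epsilon>)"
  proof (intro allI impI)
    fix \<epsilon> :: real and r x xr
    assume "0 < \<epsilon>" "real r \<ge> depth_bound T g K_Phi K_c \<alpha>\<^sub>c (card V) (card E) \<epsilon>"
      and sol: "\<forall>\<omega>\<in>space M. optimal_solution (G \<omega>) (x \<omega>)" "\<forall>\<omega>\<in>space M. CE_argmax (G \<omega>) r (xr \<omega>)"
    then show "outer_measure_of M
             {\<omega>\<in>space M. objective (G \<omega>) (x \<omega>) - objective (G \<omega>) (xr \<omega>) > ereal \<epsilon>}
             \<le> ennreal \<epsilon>"
      using gap_probability[OF network g_pos density K_Phi_pos moments rate K_c_pos decay, where x = x and xr = xr]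
      by blast
  qed
  show "\<forall>\<Delta>::nat. \<exists>P c k. \<forall>N :: 'v network.
        decision_network N \<and> acts N = T \<and> (\<forall>v\<in>nodes N. card (neighbours N v) \<le> \<Delta>) \<longrightarrow>
        (\<forall>\<epsilon>>0. \<forall>r vs.
           r = (LEAST r::nat. 0 < r \<and>
                  real r \<ge> depth_bound T g K_Phi K_c \<alpha>\<^sub>c (card (nodes N)) (card (edges N)) \<epsilon>) \<longrightarrow>
           distinct vs \<and> set vs = nodes N \<longrightarrow>
           (\<exists>xr t. CE_argmax N r xr \<and>
              runs P (enc_input N vs r) (enc_solution vs xr) t \<and>
              real t \<le> c * (real (card (nodes N)) + max \<epsilon> (1 / \<epsilon>)) ^ k))"
  proof
    fix \<Delta> :: nat
    obtain c k where "\<forall>n m r. \<forall>\<epsilon>>0. m \<le> \<Delta> * n \<longrightarrow>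
        r = (LEAST r::nat. 0 < r \<and> real r \<ge> depth_bound T g K_Phi K_c \<alpha>\<^sub>c n m \<epsilon>) \<longrightarrow>
        real (n * (T * CE_cost T \<Delta> n r r + 80 * T + 100) + 30) \<le> c * (real n + max \<epsilon> (1 / \<epsilon>)) ^ k"
      using running_time_polynomial[OF T g_pos K_Phi_pos K_c_pos rate, of \<Delta>] by (elim exE) (rule that)
    note ck = this[rule_format]
    have "\<exists>xr t. CE_argmax N r xr \<and> runs (program T) (enc_input N vs r) (enc_solution vs xr) t \<and>
        real t \<le> c * (real (card (nodes N)) + max \<epsilon> (1 / \<epsilon>)) ^ k"
      if N: "decision_network N" "acts N = T" "\<And>v. v \<in> nodes N \<Longrightarrow> card (neighbours N v) \<le> \<Delta>" and "0 < \<epsilon>"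
        and r: "r = (LEAST r::nat. 0 < r \<and>
                  real r \<ge> depth_bound T g K_Phi K_c \<alpha>\<^sub>c (card (nodes N)) (card (edges N)) \<epsilon>)"
        and vs: "distinct vs" "set vs = nodes N"
      for N :: "'v network" and \<epsilon> r vs
    proof -
      have len: "length vs = card (nodes N)" using vs distinct_card by metis
      have "\<exists>z t. CE_argmax N r z \<and> runs (program T) (enc_input N vs r) (enc_solution vs z) t \<and>
          t \<le> length vs * (T * CE_cost T \<Delta> (length vs) r r + 80 * T + 100) + 30"
        by (rule program_correct) (use N vs in auto)
      then obtain z t where z: "CE_argmax N r z" "runs (program T) (enc_input N vs r) (enc_solution vs z) t"
        and t: "t \<le> length vs * (T * CE_cost T \<Delta> (length vs) r r + 80 * T + 100) + 30"
        by (elim exE conjE) (rule that)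
      have "real t \<le> real (card (nodes N) * (T * CE_cost T \<Delta> (card (nodes N)) r r + 80 * T + 100) + 30)"
        using t unfolding len by (rule of_nat_mono)
      also have "\<dots> \<le> c * (real (card (nodes N)) + max \<epsilon> (1 / \<epsilon>)) ^ k"
        by (rule ck[OF \<open>0 < \<epsilon>\<close> card_edges_le[OF decision_network_wf[OF N(1)] N(3)] r])
      finally show ?thesis using z by (intro exI conjI)
    qed
    note correct = this
    show "\<exists>P c k. \<forall>N :: 'v network.
        decision_network N \<and> acts N = T \<and> (\<forall>v\<in>nodes N. card (neighbours N v) \<le> \<Delta>) \<longrightarrow>
        (\<forall>\<epsilon>>0. \<forall>r vs.
           r = (LEAST r::nat. 0 < r \<and>
                  real r \<ge> depth_bound T g K_Phi K_c \<alpha>\<^sub>c (card (nodes N)) (card (edges N)) \<epsilon>) \<longrightarrow>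
           distinct vs \<and> set vs = nodes N \<longrightarrow>
           (\<exists>xr t. CE_argmax N r xr \<and>
              runs P (enc_input N vs r) (enc_solution vs xr) t \<and>
              real t \<le> c * (real (card (nodes N)) + max \<epsilon> (1 / \<epsilon>)) ^ k))"
      by (rule exI[of _ "program T"], rule exI[of _ c], rule exI[of _ k], intro allI impI, elim conjE,
          rule correct) simp_all
  qed
qed

end
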